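(* Let $V$ be a finite-dimensional complex vector space and let $G\subset\mathrm{GL}(V)$ be a semidirect product of a torus $T$ and a finite subgroup $F$. Suppose that $\mathrm{span}_{\mathbb C}\,Tv=V$ for some $v\in V$ and that $Gv\subset T^{\mathbb C}v$ for a generic $v\in V$. Then $(V,G)$ can be realized by Construction E of the context, i.e. there is a linear isomorphism $V\to\mathbb C^n$ carrying $G$ to a group of the form described there. Furthermore: (1) $(V,G)$ is of type (A) if and only if $G^{\mathbb C}$ has an open orbit in $V$; (2) $(V,G)$ is of type (B) if and only if the center of $G$ is finite; (3) if $G$ is irreducible, then $(V,G)$ is of type (A) or of type (B).
   Context: "For a generic $v$" means for all $v$ in some open dense subset of $V$. $T^{\mathbb C}=\exp(\mathfrak t+i\mathfrak t)\subset\mathrm{GL}(V)$, where $\mathfrak t$ is the Lie algebra of $T$; $G^{\mathbb C}=FT^{\mathbb C}$. Construction E. Let $\mathbb C^n=C(K)$ be the space of complex functions on $K=\{1,\dots,n\}$, let $F$ be a subgroup of the symmetric group $S_n$ acting by permutations of coordinates, and let $K=K_1\cup\dots\cup K_p$ be the partition of $K$ into $F$-orbits. Let $\mathbb T^n$ be the torus of all diagonal unitary matrices. For each $k$ let $\mathfrak t_k^0$ be the space of purely imaginary functions $u$ on $K_k$ with $\sum_{q\in K_k}u(q)=0$, and let $T_k^0$ be its image under the (coordinatewise) exponential, i.e. the torus of functions $K_k\to\mathbb T$ (where $\mathbb T$ is the unit circle) with product of values equal to $1$. Put $T^0=T_1^0\times\dots\times T_p^0\subseteq\mathbb T^n$ (acting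 by multiplication). Let $T$ be an $F$-invariant torus with $T^0\subseteq T\subseteq\mathbb T^n$ and put $G=FT$. Type (A) is the case $T=\mathbb T^n$; type (B) is the case $T=T^0$. *)

theory Defs
  imports
    "HOL-Analysis.Analysis"
    "HOL-Algebra.Sym_Groups"
    "HOL-Algebra.Group_Action"
    "HOL-Library.Function_Algebras"
begin

text \<open>
  The norm on \<open>'v\<close> serves only to provide the topology of \<open>V\<close>: all norms on a finite-dimensional
  space are equivalent and every such space carries one, so it restricts nothing and nothing
  below depends on its choice.
\<close>

locale fin_dim_complex_space = vector_space smul
  for smul :: "complex \<Rightarrow> 'v::real_normed_vector \<Rightarrow> 'v" +
  assumes smul_of_real: "smul (complex_of_real r) x = r *\<^sub>R x"
    and finite_spanning: "\<exists>B. finite B \<and> module.span smul B = UNIV"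

definition GL :: "(complex \<Rightarrow> 'v::ab_group_add \<Rightarrow> 'v) \<Rightarrow> ('v \<Rightarrow> 'v) monoid" where
  "GL smul = \<lparr>carrier = {g. Vector_Spaces.linear smul smul g \<and> bij g},
               monoid.mult = (\<circ>), one = id\<rparr>"

definition semidirect_product ::
    "('a, 'b) monoid_scheme \<Rightarrow> 'a set \<Rightarrow> 'a set \<Rightarrow> 'a set \<Rightarrow> bool" where
  "semidirect_product M G T F \<longleftrightarrow>
     subgroup G M \<and> T \<lhd> (M\<lparr>carrier := G\<rparr>) \<and> subgroup F (M\<lparr>carrier := G\<rparr>) \<and>
     F \<inter> T = {\<one>\<^bsub>M\<^esub>} \<and> G = F <#>\<^bsub>M\<^esub> T"

definition center_of :: "('a, 'b) monoid_scheme \<Rightarrow> 'a set \<Rightarrow> 'a set" where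
  "center_of M G = {z \<in> G. \<forall>g \<in> G. z \<otimes>\<^bsub>M\<^esub> g = g \<otimes>\<^bsub>M\<^esub> z}"

text \<open>
  Functions on \<open>K = {1..n}\<close> are functions on \<open>nat\<close> with a fixed value off \<open>K\<close>: the value \<open>0\<close> for
  vectors and for Lie algebra elements, the value \<open>1\<close> for torus elements.
\<close>

definition Cn :: "nat \<Rightarrow> (nat \<Rightarrow> complex) set" where
  "Cn n = {x. \<forall>q. q \<notin> {1..n} \<longrightarrow> x q = 0}"

definition full_torus :: "nat \<Rightarrow> (nat \<Rightarrow> complex) set" where
  "full_torus n = {t. (\<forall>q \<in> {1..n}. cmod (t q) = 1) \<and> (\<forall>q. q \<notin> {1..n} \<longrightarrow> t q = 1)}"

text \<open>
  A torus is a group isomorphic, as a topological group, to a power of the unit circle. Since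
  that power is compact, a continuous injective homomorphism into a Hausdorff space is a
  homeomorphism onto its image. Sets of linear operators carry the topology of the function
  space, i.e. that of pointwise convergence, which for linear operators on a finite-dimensional
  space is the usual one.
\<close>

definition is_torus :: "('g \<Rightarrow> 'g \<Rightarrow> 'g) \<Rightarrow> 'g::topological_space set \<Rightarrow> bool" where
  "is_torus mul T \<longleftrightarrow>
     (\<exists>k h. continuous_on (full_torus k) h \<and> bij_betw h (full_torus k) T \<and>
        (\<forall>s \<in> full_torus k. \<forall>t \<in> full_torus k. h (s * t) = mul (h s) (h t)))"

definition op_exp :: "('v::real_normed_vector \<Rightarrow> 'v) \<Rightarrow> 'v \<Rightarrow> 'v" where
  "op_exp A v = (\<Sum>m. (A ^^ m) v /\<^sub>R fact m)"

definition lie_algebra ::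
    "(complex \<Rightarrow> 'v::real_normed_vector \<Rightarrow> 'v) \<Rightarrow> ('v \<Rightarrow> 'v) set \<Rightarrow> ('v \<Rightarrow> 'v) set" where
  "lie_algebra smul T =
     {A. Vector_Spaces.linear smul smul A \<and> (\<forall>s::real. op_exp (\<lambda>v. s *\<^sub>R A v) \<in> T)}"

definition torus_complexification ::
    "(complex \<Rightarrow> 'v::real_normed_vector \<Rightarrow> 'v) \<Rightarrow> ('v \<Rightarrow> 'v) set \<Rightarrow> ('v \<Rightarrow> 'v) set" where
  "torus_complexification smul T =
     {op_exp (\<lambda>v. A v + smul \<i> (B v)) | A B. A \<in> lie_algebra smul T \<and> B \<in> lie_algebra smul T}"

definition op_orbit :: "('v \<Rightarrow> 'v) set \<Rightarrow> 'v \<Rightarrow> 'v set" where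
  "op_orbit G v = (\<lambda>g. g v) ` G"

definition generically :: "('v::topological_space \<Rightarrow> bool) \<Rightarrow> bool" where
  "generically P \<longleftrightarrow> (\<exists>U. open U \<and> closure U = UNIV \<and> (\<forall>v \<in> U. P v))"

definition irreducible_on ::
    "(complex \<Rightarrow> 'v::ab_group_add \<Rightarrow> 'v) \<Rightarrow> ('v \<Rightarrow> 'v) set \<Rightarrow> bool" where
  "irreducible_on smul G \<longleftrightarrow>
     (UNIV :: 'v set) \<noteq> {0} \<and>
     (\<forall>W. module.subspace smul W \<and> (\<forall>g \<in> G. g ` W \<subseteq> W) \<longrightarrow> W = {0} \<or> W = UNIV)"

definition perm_op :: "(nat \<Rightarrow> nat) \<Rightarrow> (nat \<Rightarrow> complex) \<Rightarrow> nat \<Rightarrow> complex" where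
  "perm_op \<sigma> x = x \<circ> inv_into UNIV \<sigma>"

definition index_orbits :: "nat \<Rightarrow> (nat \<Rightarrow> nat) set \<Rightarrow> nat set set" where
  "index_orbits n F = orbits (sym_group n\<lparr>carrier := F\<rparr>) {1..n} (\<lambda>\<sigma>. \<sigma>)"

definition t0_block :: "nat set \<Rightarrow> (nat \<Rightarrow> complex) set" where
  "t0_block K = {u. (\<forall>q \<in> K. Re (u q) = 0) \<and> (\<forall>q. q \<notin> K \<longrightarrow> u q = 0) \<and> (\<Sum>q\<in>K. u q) = 0}"

definition T0_block :: "nat set \<Rightarrow> (nat \<Rightarrow> complex) set" where
  "T0_block K = (\<lambda>u q. exp (u q)) ` t0_block K"

text \<open>The product of the tori of the blocks: the restriction of \<open>t\<close> to each orbit is in its torus.\<close>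

definition T0 :: "nat \<Rightarrow> (nat \<Rightarrow> nat) set \<Rightarrow> (nat \<Rightarrow> complex) set" where
  "T0 n F = {t. (\<forall>q. q \<notin> {1..n} \<longrightarrow> t q = 1) \<and>
                (\<forall>K \<in> index_orbits n F. (\<lambda>q. if q \<in> K then t q else 1) \<in> T0_block K)}"

definition construction_E :: "nat \<Rightarrow> (nat \<Rightarrow> nat) set \<Rightarrow> (nat \<Rightarrow> complex) set \<Rightarrow> bool" where
  "construction_E n F T \<longleftrightarrow>
     subgroup F (sym_group n) \<and> is_torus (*) T \<and> (\<forall>\<sigma> \<in> F. perm_op \<sigma> ` T \<subseteq> T) \<and>
     T0 n F \<subseteq> T \<and> T \<subseteq> full_torus n"

text \<open>Torus elements act by pointwise multiplication.\<close>

definition group_E ::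
    "(nat \<Rightarrow> nat) set \<Rightarrow> (nat \<Rightarrow> complex) set \<Rightarrow> ((nat \<Rightarrow> complex) \<Rightarrow> nat \<Rightarrow> complex) set" where
  "group_E F T = {perm_op \<sigma> \<circ> (*) t | \<sigma> t. \<sigma> \<in> F \<and> t \<in> T}"

text \<open>
  The last conjunct says that conjugation by \<open>\<phi>\<close> carries \<open>G\<close> onto the constructed group.
\<close>

definition realized_by ::
    "(complex \<Rightarrow> 'v::ab_group_add \<Rightarrow> 'v) \<Rightarrow> ('v \<Rightarrow> 'v) set \<Rightarrow>
     nat \<Rightarrow> (nat \<Rightarrow> nat) set \<Rightarrow> (nat \<Rightarrow> complex) set \<Rightarrow> bool" where
  "realized_by smul G n F T \<longleftrightarrow>
     construction_E n F T \<and>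
     (\<exists>\<phi> :: 'v \<Rightarrow> nat \<Rightarrow> complex.
        Vector_Spaces.linear smul (\<lambda>c x q. c * x q) \<phi> \<and> bij_betw \<phi> UNIV (Cn n) \<and>
        G = {g. \<exists>h \<in> group_E F T. \<phi> \<circ> g = h \<circ> \<phi>})"

definition realizable_by_E ::
    "(complex \<Rightarrow> 'v::ab_group_add \<Rightarrow> 'v) \<Rightarrow> ('v \<Rightarrow> 'v) set \<Rightarrow> bool" where
  "realizable_by_E smul G \<longleftrightarrow> (\<exists>n F T. realized_by smul G n F T)"

definition type_A :: "(complex \<Rightarrow> 'v::ab_group_add \<Rightarrow> 'v) \<Rightarrow> ('v \<Rightarrow> 'v) set \<Rightarrow> bool" where
  "type_A smul G \<longleftrightarrow> (\<exists>n F T. realized_by smul G n F T \<and> T = full_torus n)"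

definition type_B :: "(complex \<Rightarrow> 'v::ab_group_add \<Rightarrow> 'v) \<Rightarrow> ('v \<Rightarrow> 'v) set \<Rightarrow> bool" where
  "type_B smul G \<longleftrightarrow> (\<exists>n F T. realized_by smul G n F T \<and> T = T0 n F)"

end

theory Submission
  imports
    "HOL-Algebra.Multiplicative_Group"
    Defs
    "HOL-Computational_Algebra.Fundamental_Theorem_Algebra"
begin

text \<open>
  A torus acts with bounded orbits, so its operators are semisimple and \<open>V\<close> has a basis of weight
  vectors; a cyclic vector makes the weights distinct, hence \<open>G\<close>, which normalizes \<open>T\<close>, acts by
  monomial matrices, and after rescaling the basis the coefficients of \<open>F\<close> are unitary.

  Let \<open>f\<close> in \<open>F\<close> have permutation \<open>\<sigma>\<close> and coefficients \<open>c\<close>, and write a vector with nonzero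
  coordinates as \<open>exp w\<close>. Then \<open>f v \<in> T\<^sup>\<complex> v\<close> says that \<open>log c + w \<circ> \<sigma>\<^sup>-\<^sup>1 - w\<close> lies in
  \<open>\<tt>\<^sup>\<complex> + 2\<pi>i\<int>\<^sup>n\<close>. Along a line \<open>w + s z\<close> with \<open>s\<close> real, two of the uncountably many parameters give
  the same integer vector, so \<open>z \<circ> \<sigma>\<^sup>-\<^sup>1 - z \<in> \<tt>\<^sup>\<complex>\<close> for every \<open>z\<close>. These differences span the
  functions of sum zero on the orbits, which gives \<open>T\<^sup>0 \<subseteq> T\<close>; moreover \<open>c \<in> exp \<tt>\<^sup>\<complex>\<close> is unitary, so
  \<open>c \<in> T\<close> and \<open>f\<close> may be replaced by the permutation \<open>\<sigma>\<close>. The same counting argument turns an open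
  orbit into \<open>\<tt>\<^sup>\<complex> = \<complex>\<^sup>n\<close>.

  The torus of any realization is \<open>T\<close> itself, because both are divisible of finite index in \<open>G\<close>. An
  element of \<open>T\<close> may be changed by \<open>T\<^sup>0\<close> to one that is constant on the orbits, hence central; if the
  center is finite, divisibility forces its orbit products to be \<open>1\<close>. If \<open>G\<close> is irreducible there is
  a single orbit, and the product of coordinates maps the connected group \<open>T\<close> onto \<open>{1}\<close> or onto the
  whole circle.
\<close>

section \<open>Finite-dimensional complex spaces in linear coordinates\<close>

text \<open>\<open>type_A\<close> and \<open>type_B\<close> quantify over all realizations, so a
  witness may come with coordinates, permutations and a torus other than those constructed here.
  Hence the torus of an arbitrary realization has to be compared with \<open>T\<close>, and the
  criteria are proved for every realization. In that comparison and in the argument about the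
  center, connectedness of a torus enters as divisibility, which is explicit through angles; only
  the image of the product of coordinates calls for a path.

  The counting argument is used because orbit membership supplies the exponents point by point:
  nothing makes them depend continuously on the parameter, so their branch cannot be claimed to be
  locally constant. Countably many branches against an interval of parameters call for no
  continuity.

  Coordinates are given as an algebraic isomorphism and the norm of the space is homogeneous for
  real scalars only. So continuity of the coordinates is itself a compactness argument, and the
  estimates along orbits always control both \<open>x\<close> and
  \<open>smul \<i> x\<close>.\<close>

lemma compact_fun_box:
  fixes S :: "'a \<Rightarrow> 'b::topological_space set"
  assumes "\<And>i. compact (S i)"
  shows "compact {x. \<forall>i. x i \<in> S i}"
proof -
  have "compactin (product_topology (\<lambda>_. euclidean) UNIV) (PiE UNIV S)"
    using assms by (auto simp: compactin_PiE)
  moreover have "PiE UNIV S = {x. \<forall>i. x i \<in> S i}"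
    by (auto simp: PiE_def Pi_def)
  ultimately show ?thesis
    by (simp add: euclidean_product_topology)
qed

text \<open>A box whose factors off \<open>{1..k}\<close> are the singleton \<open>{1}\<close>,
  which is the shape to which Tychonoff applies.\<close>

lemma full_torus_altdef:
  "full_torus k = {t. \<forall>q. t q \<in> (if q \<in> {1..k} then sphere 0 1 else {1})}"
  by (auto simp: full_torus_def dist_norm)

lemma compact_full_torus: "compact (full_torus k)"
  unfolding full_torus_altdef by (rule compact_fun_box) auto

context fin_dim_complex_space
begin

lemma smul_Re_Im: "smul c x = Re c *\<^sub>R x + Im c *\<^sub>R smul \<i> x"
proof -
  have "smul c x = smul (of_real (Re c) + of_real (Im c) * \<i>) x"
    by (metis complex_eq mult.commute)
  then show ?thesis
    by (simp add: scale_left_distrib smul_of_real flip: scale_scale)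
qed

lemma bounded_linear_smul_left: "bounded_linear (\<lambda>c. smul c x)"
  by (subst smul_Re_Im, rule bounded_linear_add)
    (rule bounded_linear_compose [OF bounded_linear_scaleR_left bounded_linear_Re]
      bounded_linear_compose [OF bounded_linear_scaleR_left bounded_linear_Im])+

text \<open>Multiplication by \<open>\<i>\<close> need not be isometric for the given norm; the
  second summand pays for this.\<close>

lemma norm_smul_le: "norm (smul c x) \<le> norm c * (norm x + norm (smul \<i> x))"
proof -
  have "norm (smul c x) \<le> norm (Re c *\<^sub>R x) + norm (Im c *\<^sub>R smul \<i> x)"
    by (subst smul_Re_Im) (rule norm_triangle_ineq)
  also have "\<dots> \<le> norm c * norm x + norm c * norm (smul \<i> x)"
    by (intro add_mono) (auto intro!: mult_right_mono abs_Re_le_cmod abs_Im_le_cmod)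
  finally show ?thesis
    by (simp add: algebra_simps)
qed

end

text \<open>The isomorphism in \<open>realized_by\<close>, detached from any group. Weight bases and
  arbitrary realizations are both instances, so the analysis in coordinates is done once.\<close>

locale linear_coordinates = fin_dim_complex_space smul
  for smul :: "complex \<Rightarrow> 'v::real_normed_vector \<Rightarrow> 'v" +
  fixes n :: nat and \<phi> :: "'v \<Rightarrow> nat \<Rightarrow> complex"
  assumes linear_coord: "Vector_Spaces.linear smul (\<lambda>c x q. c * x q) \<phi>"
    and bij_coord: "bij_betw \<phi> UNIV (Cn n)"
begin

lemma coord_add: "\<phi> (v + w) q = \<phi> v q + \<phi> w q"
  by (simp add: module_hom.add [OF linear_coord [unfolded linear_iff_module_hom]])

lemma coord_smul: "\<phi> (smul c v) q = c * \<phi> v q"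
  by (simp add: module_hom.scale [OF linear_coord [unfolded linear_iff_module_hom]])

lemma coord_zero: "\<phi> 0 q = 0"
  by (simp add: module_hom.zero [OF linear_coord [unfolded linear_iff_module_hom]])

lemma coord_scaleR: "\<phi> (r *\<^sub>R v) q = of_real r * \<phi> v q"
  by (simp add: coord_smul flip: smul_of_real)

lemma coord_sum: "\<phi> (\<Sum>i\<in>I. f i) q = (\<Sum>i\<in>I. \<phi> (f i) q)"
  by (induction I rule: infinite_finite_induct) (auto simp: coord_add coord_zero)

lemma coord_in_Cn: "\<phi> v \<in> Cn n"
  using bij_coord by (auto simp: bij_betw_def)

lemma coord_outside: "q \<notin> {1..n} \<Longrightarrow> \<phi> v q = 0"
  using coord_in_Cn [of v] unfolding Cn_def by blast

lemma coord_inject: "\<phi> v = \<phi> w \<longleftrightarrow> v = w"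
  using bij_coord by (auto simp: bij_betw_def inj_on_def)

lemma vec_eqI: "(\<And>q. q \<in> {1..n} \<Longrightarrow> \<phi> v q = \<phi> w q) \<Longrightarrow> v = w"
  unfolding coord_inject [symmetric] by (rule ext) (metis coord_outside)

text \<open>Values off \<open>{1..n}\<close> are discarded, so that functions without zeros, such as
  exponentials, can be passed directly.\<close>

definition vec_of :: "(nat \<Rightarrow> complex) \<Rightarrow> 'v" where
  "vec_of x = inv_into UNIV \<phi> (\<lambda>q. if q \<in> {1..n} then x q else 0)"

lemma coord_vec: "\<phi> (vec_of x) q = (if q \<in> {1..n} then x q else 0)"
proof -
  have "(\<lambda>q. if q \<in> {1..n} then x q else 0) \<in> \<phi> ` UNIV"
    using bij_coord by (auto simp: bij_betw_def Cn_def)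
  from fun_cong [OF f_inv_into_f [OF this], of q] show ?thesis
    by (simp only: vec_of_def)
qed

lemma vec_coord: "vec_of (\<phi> v) = v"
  by (rule vec_eqI) (simp add: coord_vec)

definition basis_vec :: "nat \<Rightarrow> 'v" where
  "basis_vec q = vec_of (\<lambda>p. if p = q then 1 else 0)"

lemma coord_basis_vec: "q \<in> {1..n} \<Longrightarrow> \<phi> (basis_vec q) p = (if p = q then 1 else 0)"
  by (auto simp: basis_vec_def coord_vec)

lemma vec_expand: "vec_of x = (\<Sum>q\<in>{1..n}. smul (x q) (basis_vec q))"
proof (rule vec_eqI)
  fix p assume p: "p \<in> {1..n}"
  have "\<phi> (\<Sum>q\<in>{1..n}. smul (x q) (basis_vec q)) p = (\<Sum>q\<in>{1..n}. x q * (if p = q then 1 else 0))"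
    unfolding coord_sum coord_smul by (intro sum.cong) (auto simp: coord_basis_vec)
  also have "\<dots> = (\<Sum>q\<in>{1..n}. if p = q then x q else 0)"
    by (intro sum.cong) auto
  also have "\<dots> = x p"
    using p by (simp add: sum.delta)
  finally show "\<phi> (vec_of x) p = \<phi> (\<Sum>q\<in>{1..n}. smul (x q) (basis_vec q)) p"
    using p by (simp add: coord_vec)
qed

lemma basis_expand: "v = (\<Sum>q\<in>{1..n}. smul (\<phi> v q) (basis_vec q))"
  using vec_coord [of v] vec_expand [of "\<phi> v"] by simp

lemma continuous_on_vec:
  assumes "\<And>q. q \<in> {1..n} \<Longrightarrow> continuous_on S (\<lambda>s. x s q)"
  shows "continuous_on S (\<lambda>s. vec_of (x s))"
  unfolding vec_expand
  by (rule continuous_on_sum, rule bounded_linear.continuous_on [OF bounded_linear_smul_left])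
    (rule assms)

lemma sums_vec:
  assumes "\<And>q. q \<in> {1..n} \<Longrightarrow> (\<lambda>m. x m q) sums y q"
  shows "(\<lambda>m. vec_of (x m)) sums vec_of y"
  unfolding vec_expand
  by (rule sums_sum, rule bounded_linear.sums [OF bounded_linear_smul_left]) (rule assms)

definition coord_norm :: "'v \<Rightarrow> real" where
  "coord_norm v = (\<Sum>q\<in>{1..n}. cmod (\<phi> v q))"

lemma cmod_coord_le: "cmod (\<phi> v q) \<le> coord_norm v"
proof (cases "q \<in> {1..n}")
  case True
  then show ?thesis
    unfolding coord_norm_def by (intro member_le_sum) auto
next
  case False
  then show ?thesis
    unfolding coord_norm_def by (simp add: coord_outside sum_nonneg)
qed

lemma coord_norm_nonneg: "0 \<le> coord_norm v"
  by (simp add: coord_norm_def sum_nonneg)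

lemma coord_norm_scaleR: "coord_norm (r *\<^sub>R v) = \<bar>r\<bar> * coord_norm v"
  by (simp add: coord_norm_def coord_scaleR norm_mult sum_distrib_left)

text \<open>The unit sphere of the coordinate norm is compact and the norm of \<open>'v\<close> is
  positive on it; the constant is the reciprocal of its minimum there.\<close>

lemma coord_norm_bound:
  obtains C where "\<And>v. coord_norm v \<le> C * norm v"
proof -
  define S where "S = {x \<in> Cn n. (\<Sum>q\<in>{1..n}. cmod (x q)) = 1}"
  define box :: "(nat \<Rightarrow> complex) set" where
    "box = {x. \<forall>q. x q \<in> (if q \<in> {1..n} then cball 0 1 else {0})}"
  have "compact box"
    unfolding box_def by (rule compact_fun_box) auto
  moreover have "closed {x :: nat \<Rightarrow> complex. (\<Sum>q\<in>{1..n}. cmod (x q)) = 1}"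
    by (intro closed_Collect_eq continuous_on_sum continuous_on_norm
        continuous_on_product_coordinates continuous_on_const)
  moreover have "S = box \<inter> {x. (\<Sum>q\<in>{1..n}. cmod (x q)) = 1}"
  proof -
    have "x \<in> box" if "x \<in> S" for x
    proof -
      have "cmod (x q) \<le> 1" if "q \<in> {1..n}" for q
        using member_le_sum [of q "{1..n}" "\<lambda>q. cmod (x q)"] that \<open>x \<in> S\<close> by (simp add: S_def)
      then show ?thesis
        using that by (auto simp: S_def box_def Cn_def)
    qed
    moreover have "box \<subseteq> Cn n"
    proof
      fix x assume x: "x \<in> box"
      have "x q = 0" if "q \<notin> {1..n}" for q
        using spec [OF x [unfolded box_def mem_Collect_eq], of q] that by (auto split: if_splits)
      then show "x \<in> Cn n" by (simp add: Cn_def)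
    qed
    ultimately show ?thesis
      by (auto simp: S_def)
  qed
  ultimately have "compact S"
    by (metis compact_Int_closed)
  have contS: "continuous_on S (\<lambda>x. norm (vec_of x))"
    by (intro continuous_on_norm continuous_on_vec continuous_on_subset
        [OF continuous_on_product_coordinates]) auto
  have normal: "\<phi> ((1 / coord_norm v) *\<^sub>R v) \<in> S" if "coord_norm v \<noteq> 0" for v
    using coord_norm_scaleR [of "1 / coord_norm v" v] that coord_norm_nonneg [of v] coord_in_Cn
    unfolding S_def mem_Collect_eq coord_norm_def [symmetric] by simp
  show thesis
  \<comment> \<open>\<open>S\<close> is empty exactly in dimension zero, where
    \<open>coord_norm\<close> vanishes and every constant will do.\<close>
  proof (cases "S = {}")
    case True
    then have "coord_norm v = 0" for v
      using normal by blast
    then show thesis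
      using that [of 0] by simp
  next
    case False
    then obtain x0 where x0: "x0 \<in> S" "\<And>x. x \<in> S \<Longrightarrow> norm (vec_of x0) \<le> norm (vec_of x)"
      using continuous_attains_inf [OF \<open>compact S\<close> False contS] by blast
    have "vec_of x0 \<noteq> 0"
    proof
      assume "vec_of x0 = 0"
      then have "x0 q = 0" if "q \<in> {1..n}" for q
        using coord_vec [of x0 q] that by (simp add: coord_zero)
      then show False
        using x0 by (simp add: S_def)
    qed
    have "coord_norm v \<le> 1 / norm (vec_of x0) * norm v" for v
    proof (cases "coord_norm v = 0")
      case False
      then have pos: "0 < coord_norm v"
        using coord_norm_nonneg [of v] by simp
      have "norm (vec_of x0) \<le> norm v / coord_norm v"
        using x0(2) [OF normal [OF False]] pos by (simp add: vec_coord)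
      then show ?thesis
        using pos \<open>vec_of x0 \<noteq> 0\<close> by (simp add: field_simps)
    qed simp
    then show thesis
      by (rule that)
  qed
qed

lemma continuous_on_coord: "continuous_on S (\<lambda>v. \<phi> v q)"
proof -
  obtain C where C: "\<And>v. coord_norm v \<le> C * norm v"
    by (rule coord_norm_bound) blast
  have "bounded_linear (\<lambda>v. \<phi> v q)"
  proof (rule bounded_linear_intro)
    show "\<phi> (x + y) q = \<phi> x q + \<phi> y q" for x y by (rule coord_add)
    show "\<phi> (r *\<^sub>R x) q = r *\<^sub>R \<phi> x q" for r x by (simp add: coord_scaleR scaleR_conv_of_real)
    show "norm (\<phi> x q) \<le> norm x * C" for x
      using order_trans [OF cmod_coord_le C] by (simp add: mult.commute)
  qed
  then show ?thesis
    by (simp add: linear_continuous_on)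
qed

section \<open>Exponentials of operators in coordinates\<close>

lemma linear_diagonal:
  assumes "\<And>v q. q \<in> {1..n} \<Longrightarrow> \<phi> (A v) q = u q * \<phi> v q"
  shows "Vector_Spaces.linear smul smul A"
proof -
  have "A (v + w) = A v + A w" for v w
    by (rule vec_eqI) (simp add: assms coord_add algebra_simps)
  moreover have "A (smul c v) = smul c (A v)" for c v
    by (rule vec_eqI) (simp add: assms coord_smul algebra_simps)
  ultimately show ?thesis
    by unfold_locales (auto simp: scale_right_distrib scale_left_distrib)
qed

text \<open>\<open>op_exp\<close> is a series in the norm of \<open>'v\<close>. Its convergence is
  read off the coordinates and carried back by the continuity of linear combinations of the
  basis.\<close>

lemma op_exp_coord:
  assumes "\<And>q. q \<in> {1..n} \<Longrightarrow> (\<lambda>m. \<phi> ((A ^^ m) v) q / fact m) sums y q" "p \<in> {1..n}"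
  shows "\<phi> (op_exp A v) p = y p"
proof -
  have "(\<lambda>m. vec_of (\<lambda>q. \<phi> ((A ^^ m) v) q / fact m)) sums vec_of y"
    by (rule sums_vec) (use assms in auto)
  moreover have "vec_of (\<lambda>q. \<phi> ((A ^^ m) v) q / fact m) = (A ^^ m) v /\<^sub>R fact m" for m
    by (rule vec_eqI) (simp add: coord_vec coord_scaleR field_simps)
  ultimately have "op_exp A v = vec_of y"
    unfolding op_exp_def by (simp add: sums_iff)
  then show ?thesis
    using assms(2) by (simp add: coord_vec)
qed

lemma op_exp_diagonal:
  assumes "\<And>v q. q \<in> {1..n} \<Longrightarrow> \<phi> (A v) q = u q * \<phi> v q" "p \<in> {1..n}"
  shows "\<phi> (op_exp A v) p = exp (u p) * \<phi> v p"
proof (rule op_exp_coord [where y = "\<lambda>q. exp (u q) * \<phi> v q", OF _ assms(2)])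
  fix q assume q: "q \<in> {1..n}"
  have pow: "\<phi> ((A ^^ m) v) q = u q ^ m * \<phi> v q" for m
    by (induction m) (auto simp: assms(1) [OF q])
  have "(\<lambda>m. u q ^ m /\<^sub>R fact m * \<phi> v q) sums (exp (u q) * \<phi> v q)"
    by (intro sums_mult2 exp_converges)
  then show "(\<lambda>m. \<phi> ((A ^^ m) v) q / fact m) sums (exp (u q) * \<phi> v q)"
    unfolding pow by (simp add: scaleR_conv_of_real field_simps)
qed

text \<open>\<open>C\<close> is the sum of the coordinate norms of the columns of \<open>A\<close>.
  The bound makes the exponential series converge for operators that are not yet known to be
  diagonal.\<close>

lemma coord_norm_linear_bound:
  assumes A: "Vector_Spaces.linear smul smul A"
  obtains C where "0 \<le> C" "\<And>m v. coord_norm ((A ^^ m) v) \<le> C ^ m * coord_norm v"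
proof -
  interpret A: Vector_Spaces.linear smul smul A by (rule A)
  define C where "C = (\<Sum>q\<in>{1..n}. coord_norm (A (basis_vec q)))"
  have C0: "0 \<le> C"
    unfolding C_def by (intro sum_nonneg coord_norm_nonneg)
  have step: "coord_norm (A v) \<le> C * coord_norm v" for v
  proof -
    have "\<phi> (A v) p = (\<Sum>q\<in>{1..n}. \<phi> v q * \<phi> (A (basis_vec q)) p)" for p
    proof -
      have "A v = (\<Sum>q\<in>{1..n}. smul (\<phi> v q) (A (basis_vec q)))"
        by (subst basis_expand [of v]) (simp add: A.sum A.scale)
      then show ?thesis
        by (simp add: coord_sum coord_smul)
    qed
    then have "coord_norm (A v) \<le> (\<Sum>p\<in>{1..n}. \<Sum>q\<in>{1..n}. cmod (\<phi> v q) * cmod (\<phi> (A (basis_vec q)) p))"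
      unfolding coord_norm_def by (auto intro!: sum_mono sum_norm_le simp: norm_mult)
    also have "\<dots> = (\<Sum>q\<in>{1..n}. cmod (\<phi> v q) * coord_norm (A (basis_vec q)))"
      by (subst sum.swap) (simp add: coord_norm_def sum_distrib_left)
    also have "\<dots> \<le> (\<Sum>q\<in>{1..n}. coord_norm v * coord_norm (A (basis_vec q)))"
      by (intro sum_mono mult_right_mono cmod_coord_le coord_norm_nonneg)
    finally show ?thesis
      by (simp add: C_def sum_distrib_left mult.commute)
  qed
  have "coord_norm ((A ^^ m) v) \<le> C ^ m * coord_norm v" for m v
  proof (induction m)
    case (Suc m)
    have "coord_norm ((A ^^ Suc m) v) \<le> C * coord_norm ((A ^^ m) v)"
      using step by simp
    also have "\<dots> \<le> C * (C ^ m * coord_norm v)"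
      by (intro mult_left_mono Suc C0)
    finally show ?case by (simp add: mult.assoc)
  qed simp
  then show thesis
    using that C0 by blast
qed

lemma linear_scaled_power:
  assumes "Vector_Spaces.linear smul smul A"
  shows "((\<lambda>v. s *\<^sub>R A v) ^^ m) v = s ^ m *\<^sub>R (A ^^ m) v"
proof -
  interpret A: Vector_Spaces.linear smul smul A by (rule assms)
  have "A (r *\<^sub>R x) = r *\<^sub>R A x" for r x
    using A.scale [of "of_real r"] by (simp add: smul_of_real)
  then show ?thesis
    by (induction m) (auto simp: mult.commute)
qed

text \<open>The entry of \<open>A x\<close> is the derivative at \<open>s = 0\<close> of the same
  entry of \<open>exp (s A) x\<close>. This is how an element of the Lie algebra of a diagonal group
  is seen to be diagonal.\<close>

lemma linear_coefficient_eq_0: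
  assumes A: "Vector_Spaces.linear smul smul A"
    and vanish: "\<And>s. \<phi> (op_exp (\<lambda>v. s *\<^sub>R A v) x) p = 0"
    and "\<phi> x p = 0" "p \<in> {1..n}"
  shows "\<phi> (A x) p = 0"
proof -
  obtain C where C: "0 \<le> C" "\<And>m v. coord_norm ((A ^^ m) v) \<le> C ^ m * coord_norm v"
    using coord_norm_linear_bound [OF A] by blast
  define a where "a q m = \<phi> ((A ^^ m) x) q / fact m" for q m
  have summable: "summable (\<lambda>m. a q m * z ^ m)" for q z
  proof (rule summable_comparison_test')
    show "summable (\<lambda>m. (C * cmod z) ^ m /\<^sub>R fact m * coord_norm x)"
      by (intro summable_mult2 summable_exp_generic)
    fix m :: nat
    have "cmod (\<phi> ((A ^^ m) x) q) \<le> C ^ m * coord_norm x"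
      by (rule order_trans [OF cmod_coord_le C(2)])
    then have "cmod (\<phi> ((A ^^ m) x) q) * (cmod z ^ m / fact m)
        \<le> (C ^ m * coord_norm x) * (cmod z ^ m / fact m)"
      by (rule mult_right_mono) simp
    then show "norm (a q m * z ^ m) \<le> (C * cmod z) ^ m /\<^sub>R fact m * coord_norm x"
      by (simp add: a_def norm_mult norm_divide norm_power power_mult_distrib field_simps)
  qed
  have "(\<Sum>m. a p m * of_real s ^ m) = 0" for s :: real
  proof -
    have "\<phi> (op_exp (\<lambda>v. s *\<^sub>R A v) x) p = (\<Sum>m. a p m * of_real s ^ m)"
    proof (rule op_exp_coord [where y = "\<lambda>q. \<Sum>m. a q m * of_real s ^ m"])
      fix q
      have "(\<lambda>m. a q m * of_real s ^ m) sums (\<Sum>m. a q m * of_real s ^ m)"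
        using summable by (rule summable_sums)
      moreover have "a q m * of_real s ^ m = \<phi> (((\<lambda>v. s *\<^sub>R A v) ^^ m) x) q / fact m" for m
        by (simp add: a_def linear_scaled_power [OF A] coord_scaleR)
      ultimately show "(\<lambda>m. \<phi> (((\<lambda>v. s *\<^sub>R A v) ^^ m) x) q / fact m)
          sums (\<Sum>m. a q m * of_real s ^ m)"
        by simp
    qed (rule assms(4))
    then show ?thesis
      using vanish by simp
  qed
  \<comment> \<open>The power series of the entry has no constant term; \<open>f\<close> is that
    series divided by \<open>z\<close>, and its value at 0 is the entry of \<open>A x\<close>.
    Vanishing is known at real parameters only, so the limit is taken along
    \<open>1 / (k + 1)\<close>.\<close>
  define f where "f z = (\<Sum>m. a p (Suc m) * z ^ m)" for z
  have shift: "z * f z = (\<Sum>m. a p m * z ^ m)" and sums: "(\<lambda>m. a p (Suc m) * z ^ m) sums f z" for z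
  proof -
    have summ: "summable (\<lambda>m. a p (Suc m) * z ^ m)"
    proof (cases "z = 0")
      case True
      then show ?thesis
        by (simp add: summable_0_powser)
    next
      case False
      have "summable (\<lambda>m. a p (Suc m) * z ^ Suc m)"
        using summable_Suc_iff [of "\<lambda>m. a p m * z ^ m"] summable by blast
      then have "summable (\<lambda>m. inverse z * (a p (Suc m) * z ^ Suc m))"
        by (rule summable_mult)
      moreover have "inverse z * (a p (Suc m) * z ^ Suc m) = a p (Suc m) * z ^ m" for m
        using False by simp
      ultimately show ?thesis
        by (simp only:)
    qed
    then show "(\<lambda>m. a p (Suc m) * z ^ m) sums f z"
      unfolding f_def by (rule summable_sums)
    have "(\<Sum>m. a p m * z ^ m) = (\<Sum>m. a p (Suc m) * z ^ Suc m)"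
      using suminf_split_head [OF summable [of p z]] assms(3) by (simp add: a_def)
    also have "\<dots> = (\<Sum>m. z * (a p (Suc m) * z ^ m))"
      by (simp add: mult_ac)
    also have "\<dots> = z * f z"
      unfolding f_def using summ by (rule suminf_mult)
    finally show "z * f z = (\<Sum>m. a p m * z ^ m)" by simp
  qed
  have *: "f (of_real s) = 0" if "s \<noteq> 0" for s :: real
    using shift [of "of_real s"] \<open>\<And>s :: real. (\<Sum>m. a p m * of_real s ^ m) = 0\<close> [of s] that by simp
  have zero: "f (of_real (1 / real (Suc k))) = 0" for k
    by (rule *) simp
  have "(f \<longlongrightarrow> a p (Suc 0)) (at 0)"
    by (rule powser_limit_0 [of 1]) (use sums in auto)
  moreover have "filterlim (\<lambda>k. complex_of_real (1 / real (Suc k))) (at 0) sequentially"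
  proof -
    have "(\<lambda>k. complex_of_real (1 / real (Suc k))) \<longlonglongrightarrow> of_real 0"
      by (intro tendsto_of_real LIMSEQ_Suc lim_1_over_n)
    moreover have "complex_of_real (1 / real (Suc k)) \<noteq> 0" for k
      unfolding of_real_eq_0_iff by simp
    ultimately show ?thesis
      unfolding filterlim_at of_real_0 by (intro conjI always_eventually allI) auto
  qed
  ultimately have "(\<lambda>k. f (of_real (1 / real (Suc k)))) \<longlonglongrightarrow> a p (Suc 0)"
    by (rule filterlim_compose)
  then have "a p (Suc 0) = 0"
    unfolding zero by (simp add: LIMSEQ_const_iff)
  then show ?thesis
    by (simp add: a_def)
qed

end

section \<open>Tori, their Lie algebras and complexifications\<close>

lemma one_in_full_torus: "1 \<in> full_torus k"
  by (auto simp: full_torus_def)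

lemma mult_in_full_torus: "s \<in> full_torus k \<Longrightarrow> t \<in> full_torus k \<Longrightarrow> s * t \<in> full_torus k"
  by (auto simp: full_torus_def norm_mult)

lemma power_fun_apply: "(f ^ m) x = (f x) ^ m" for f :: "'a \<Rightarrow> 'b::monoid_mult"
  by (induction m) auto

lemma full_torus_cmod: "t \<in> full_torus k \<Longrightarrow> cmod (t q) = 1"
  unfolding full_torus_def by (cases "q \<in> {1..k}") auto

lemma full_torus_nonzero: "t \<in> full_torus k \<Longrightarrow> t q \<noteq> 0"
  using full_torus_cmod [of t k q] by auto

lemma full_torus_off: "t \<in> full_torus k \<Longrightarrow> q \<notin> {1..k} \<Longrightarrow> t q = 1"
  unfolding full_torus_def by blast

lemma power_in_full_torus: "t \<in> full_torus k \<Longrightarrow> t ^ m \<in> full_torus k"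
  by (induction m) (auto intro: mult_in_full_torus one_in_full_torus)

text \<open>The angle vanishes off \<open>{1..k}\<close>, so every real multiple of it again
  describes an element of the torus; roots and paths are obtained by scaling it.\<close>

lemma full_torus_log:
  assumes "t \<in> full_torus k"
  obtains \<theta> :: "nat \<Rightarrow> real" where "\<And>q. t q = cis (\<theta> q)" "\<And>q. q \<notin> {1..k} \<Longrightarrow> \<theta> q = 0"
proof
  show "t q = cis (Arg (t q))" for q
    using cis_Arg [OF full_torus_nonzero [OF assms, of q]] full_torus_cmod [OF assms, of q]
    by (simp add: sgn_div_norm)
  show "Arg (t q) = 0" if "q \<notin> {1..k}" for q
    using full_torus_off [OF assms that] by simp
qed

lemma full_torus_root:
  assumes "t \<in> full_torus k" "0 < m"
  obtains r where "r \<in> full_torus k" "r ^ m = t"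
proof -
  obtain \<theta> where \<theta>: "\<And>q. t q = cis (\<theta> q)" "\<And>q. q \<notin> {1..k} \<Longrightarrow> \<theta> q = 0"
    by (rule full_torus_log [OF assms(1)]) blast
  define r where "r q = cis (\<theta> q / m)" for q
  have "r \<in> full_torus k"
    by (auto simp: full_torus_def r_def \<theta>)
  moreover have "r ^ m = t"
  proof
    fix q
    have "(r ^ m) q = cis (real m * (\<theta> q / m))"
      unfolding power_fun_apply r_def by (rule Complex.DeMoivre)
    then show "(r ^ m) q = t q"
      using assms(2) by (simp add: \<theta>(1))
  qed
  ultimately show thesis by (rule that)
qed

lemma torus_mult_closed:
  assumes "is_torus mul T" "s \<in> T" "t \<in> T"
  shows "mul s t \<in> T"
proof -
  obtain k h where h: "bij_betw h (full_torus k) T"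
      "\<And>s t. s \<in> full_torus k \<Longrightarrow> t \<in> full_torus k \<Longrightarrow> h (s * t) = mul (h s) (h t)"
    using assms(1) unfolding is_torus_def by blast
  obtain s' t' where "s' \<in> full_torus k" "t' \<in> full_torus k" "s = h s'" "t = h t'"
    using h(1) assms(2,3) unfolding bij_betw_def by blast
  then show ?thesis
    using h mult_in_full_torus [of s' k t'] unfolding bij_betw_def by (metis imageI)
qed

lemma torus_commute:
  assumes "is_torus mul T" "s \<in> T" "t \<in> T"
  shows "mul s t = mul t s"
proof -
  obtain k h where h: "bij_betw h (full_torus k) T"
      "\<And>s t. s \<in> full_torus k \<Longrightarrow> t \<in> full_torus k \<Longrightarrow> h (s * t) = mul (h s) (h t)"
    using assms(1) unfolding is_torus_def by blast
  obtain s' t' where "s' \<in> full_torus k" "t' \<in> full_torus k" "s = h s'" "t = h t'"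
    using h(1) assms(2,3) unfolding bij_betw_def by blast
  then show ?thesis
    using h(2) by (metis mult.commute)
qed

lemma operator_torus_root:
  assumes "is_torus (\<circ>) T" "t \<in> T" "0 < m"
  obtains r where "r \<in> T" "r ^^ m = t"
proof -
  obtain k h where h: "bij_betw h (full_torus k) T"
      "\<And>s t. s \<in> full_torus k \<Longrightarrow> t \<in> full_torus k \<Longrightarrow> h (s * t) = h s \<circ> h t"
    using assms(1) unfolding is_torus_def by blast
  obtain t' where t': "t' \<in> full_torus k" "t = h t'"
    using h(1) assms(2) unfolding bij_betw_def by blast
  obtain r where r: "r \<in> full_torus k" "r ^ m = t'"
    using full_torus_root [OF t'(1) assms(3)] by blast
  \<comment> \<open>Positive exponents only: \<open>is_torus\<close> by itself makes
    \<open>h 1\<close> an idempotent operator, which does not yet say that it is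
    \<open>id\<close>.\<close>
  have "h (r ^ Suc i) = h r ^^ Suc i" for i
  proof (induction i)
    case (Suc i)
    have "h (r ^ Suc (Suc i)) = h r \<circ> h (r ^ Suc i)"
      unfolding power_Suc [of r "Suc i"] by (rule h(2) [OF r(1) power_in_full_torus [OF r(1)]])
    then show ?case
      by (simp only: Suc funpow.simps)
  qed simp
  from this [of "m - 1"] have "h r ^^ m = t"
    using assms(3) r(2) t'(2) by simp
  moreover have "h r \<in> T"
    using h(1) r(1) unfolding bij_betw_def by blast
  ultimately show thesis
    using that by blast
qed

lemma diagonal_torus_root:
  assumes "is_torus (*) T" "t \<in> T" "0 < m"
  obtains r :: "nat \<Rightarrow> complex" where "r \<in> T" "r ^ m = t"
proof -
  obtain k h where h: "bij_betw h (full_torus k) T"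
      "\<And>s t. s \<in> full_torus k \<Longrightarrow> t \<in> full_torus k \<Longrightarrow> h (s * t) = h s * h t"
    using assms(1) unfolding is_torus_def by blast
  obtain t' where t': "t' \<in> full_torus k" "t = h t'"
    using h(1) assms(2) unfolding bij_betw_def by blast
  obtain r where r: "r \<in> full_torus k" "r ^ m = t'"
    using full_torus_root [OF t'(1) assms(3)] by blast
  have "h (r ^ Suc i) = h r ^ Suc i" for i
  proof (induction i)
    case (Suc i)
    have "h (r ^ Suc (Suc i)) = h r * h (r ^ Suc i)"
      unfolding power_Suc [of r "Suc i"] by (rule h(2) [OF r(1) power_in_full_torus [OF r(1)]])
    then show ?case
      unfolding Suc power_Suc [of "h r" "Suc i"] .
  qed simp
  from this [of "m - 1"] have "h r ^ m = t"
    using assms(3) r(2) t'(2) by simp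
  moreover have "h r \<in> T"
    using h(1) r(1) unfolding bij_betw_def by blast
  ultimately show thesis
    using that by blast
qed

text \<open>The neutral element \<open>h 1\<close> is idempotent under pointwise multiplication, and
  an idempotent function without zeros is constantly 1.\<close>

lemma one_in_diagonal_torus:
  assumes "is_torus (*) T" "T \<subseteq> full_torus n"
  shows "1 \<in> T"
proof -
  obtain k h where h: "bij_betw h (full_torus k) T"
      "\<And>s t. s \<in> full_torus k \<Longrightarrow> t \<in> full_torus k \<Longrightarrow> h (s * t) = h s * h t"
    using assms(1) unfolding is_torus_def by blast
  have "h 1 \<in> T"
    using h(1) one_in_full_torus unfolding bij_betw_def by blast
  moreover have "h 1 = h 1 * h 1"
    using h(2) [OF one_in_full_torus one_in_full_torus] by simp
  then have "h 1 q = h 1 q * h 1 q" for q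
    by (metis times_fun_apply)
  then have "h 1 q = 1" for q
    using full_torus_nonzero [of "h 1" n q] \<open>h 1 \<in> T\<close> assms(2)
    by (metis mult_cancel_right1 subsetD)
  ultimately show ?thesis
    by (metis ext one_fun_apply)
qed

lemma power_in_diagonal_torus:
  assumes "is_torus (*) T" "T \<subseteq> full_torus n" "t \<in> T"
  shows "t ^ m \<in> T"
proof (induction m)
  case 0
  show ?case
    unfolding power_0 by (rule one_in_diagonal_torus [OF assms(1,2)])
next
  case (Suc m)
  show ?case
    unfolding power_Suc by (rule torus_mult_closed [OF assms(1,3) Suc])
qed

lemma inverse_in_diagonal_torus:
  assumes "is_torus (*) T" "T \<subseteq> full_torus n" "t \<in> T"
  shows "(\<lambda>q. inverse (t q)) \<in> T"
proof -
  obtain k h where h: "bij_betw h (full_torus k) T"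
      "\<And>s t. s \<in> full_torus k \<Longrightarrow> t \<in> full_torus k \<Longrightarrow> h (s * t) = h s * h t"
    using assms(1) unfolding is_torus_def by blast
  obtain t' where t': "t' \<in> full_torus k" "t = h t'"
    using h(1) assms(3) unfolding bij_betw_def by blast
  obtain e where e: "e \<in> full_torus k" "h e = 1"
    using h(1) one_in_diagonal_torus [OF assms(1,2)] unfolding bij_betw_def by (metis imageE)
  define s where "s q = e q / t' q" for q
  have s: "s \<in> full_torus k"
    using t'(1) e(1) unfolding full_torus_def s_def by (auto simp: norm_divide)
  have "s * t' = e"
    using full_torus_nonzero [OF t'(1)] by (auto simp: s_def)
  then have "h s * t = 1"
    using h(2) [OF s t'(1)] e(2) t'(2) by simp
  then have "h s q * t q = 1" for q
    by (metis one_fun_apply times_fun_apply)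
  then have "h s = (\<lambda>q. inverse (t q))"
    by (metis (mono_tags) inverse_unique mult.commute ext)
  moreover have "h s \<in> T"
    using h(1) s unfolding bij_betw_def by blast
  ultimately show ?thesis by simp
qed

lemma uncountable_pigeonhole:
  fixes f :: "real \<Rightarrow> 'a"
  assumes "0 < \<epsilon>" "countable J" "\<And>s. \<bar>s\<bar> < \<epsilon> \<Longrightarrow> f s \<in> J"
  obtains s s' where "\<bar>s\<bar> < \<epsilon>" "\<bar>s'\<bar> < \<epsilon>" "s \<noteq> s'" "f s = f s'"
proof -
  have "\<not> inj_on f {-\<epsilon><..<\<epsilon>}"
  proof
    assume "inj_on f {-\<epsilon><..<\<epsilon>}"
    moreover have "countable (f ` {-\<epsilon><..<\<epsilon>})"
      by (rule countable_subset [OF _ assms(2)]) (auto intro!: assms(3))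
    ultimately have "countable {-\<epsilon><..<\<epsilon>}"
      by (rule countable_image_inj_on [rotated])
    then show False
      using uncountable_open_interval [of "-\<epsilon>" \<epsilon>] assms(1) by simp
  qed
  then obtain s s' where "s \<in> {-\<epsilon><..<\<epsilon>}" "s' \<in> {-\<epsilon><..<\<epsilon>}" "s \<noteq> s'" "f s = f s'"
    unfolding inj_on_def by blast
  then show thesis
    by (intro that [of s s']) auto
qed

text \<open>
  The fibres of the exponential are countable, so two parameters on the line share their branch
  of the logarithm; their difference puts the direction of the line into the subspace.
\<close>

lemma exp_line_in_subspace:
  fixes L :: "(nat \<Rightarrow> complex) set"
  assumes diff: "\<And>u w. u \<in> L \<Longrightarrow> w \<in> L \<Longrightarrow> (\<lambda>q. u q - w q) \<in> L"
    and scale: "\<And>u r. u \<in> L \<Longrightarrow> (\<lambda>q. of_real r * u q) \<in> L"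
    and off: "\<And>u q. u \<in> L \<Longrightarrow> q \<notin> {1..n} \<Longrightarrow> u q = 0"
    and \<beta>: "\<And>j q. j \<in> J \<Longrightarrow> q \<notin> {1..n} \<Longrightarrow> \<beta> j q = 0"
    and J: "countable J" and \<epsilon>: "0 < \<epsilon>"
    and line: "\<And>s. \<bar>s\<bar> < \<epsilon> \<Longrightarrow>
      \<exists>j\<in>J. \<exists>u\<in>L. \<forall>q\<in>{1..n}. exp (\<alpha> j q + of_real s * \<beta> j q) = exp (u q)"
  shows "\<exists>j\<in>J. \<beta> j \<in> L"
proof -
  have "\<exists>j u m. j \<in> J \<and> u \<in> L \<and>
      (\<forall>q\<in>{1..n}. \<alpha> j q + of_real s * \<beta> j q = u q + of_real (of_int (2 * m q) * pi) * \<i>)"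
    if "\<bar>s\<bar> < \<epsilon>" for s
    using line [OF that] unfolding exp_eq by metis
  then obtain j u m where jum: "\<And>s. \<bar>s\<bar> < \<epsilon> \<Longrightarrow> j s \<in> J \<and> u s \<in> L \<and>
      (\<forall>q\<in>{1..n}. \<alpha> (j s) q + of_real s * \<beta> (j s) q = u s q + of_real (of_int (2 * m s q) * pi) * \<i>)"
    by metis
  \<comment> \<open>The branch is recorded as the finite list of its integers at
    \<open>1..n\<close>: lists of integers are countable, functions from \<open>nat\<close> to
    \<open>int\<close> are not.\<close>
  define f where "f s = (j s, map (m s) [1..<Suc n])" for s
  have "countable (J \<times> (UNIV :: int list set))"
    using J by (intro countable_SIGMA) auto
  then obtain s s' where s: "\<bar>s\<bar> < \<epsilon>" "\<bar>s'\<bar> < \<epsilon>" "s \<noteq> s'" "f s = f s'"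
    by (rule uncountable_pigeonhole [OF \<epsilon>, of _ f]) (use jum in \<open>auto simp: f_def\<close>)
  then have j: "j s' = j s" and m: "\<And>q. q \<in> {1..n} \<Longrightarrow> m s' q = m s q"
    by (simp_all add: f_def map_eq_conv del: upt_Suc)
  have "\<beta> (j s) q = of_real (1 / (s - s')) * (u s q - u s' q)" for q
  proof (cases "q \<in> {1..n}")
    case True
    have "of_real (s - s') * \<beta> (j s) q = u s q - u s' q"
    proof -
      have "\<alpha> (j s) q + of_real s * \<beta> (j s) q = u s q + of_real (of_int (2 * m s q) * pi) * \<i>"
        using jum [OF s(1)] True by blast
      moreover have "\<alpha> (j s) q + of_real s' * \<beta> (j s) q = u s' q + of_real (of_int (2 * m s q) * pi) * \<i>"
        using jum [OF s(2)] True m [OF True] j by metis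
      ultimately have "of_real s * \<beta> (j s) q - of_real s' * \<beta> (j s) q = u s q - u s' q"
        by (metis (no_types) add_diff_cancel_left add_diff_cancel_right)
      then show ?thesis
        by (simp add: left_diff_distrib)
    qed
    moreover have "of_real (s - s') \<noteq> (0::complex)"
      using s(3) by (simp only: of_real_eq_0_iff)
    ultimately show ?thesis
      by (simp add: field_simps del: of_real_diff)
  next
    case False
    then show ?thesis
      using \<beta> [of "j s" q] off [of "u s" q] off [of "u s'" q] jum [OF s(1)] jum [OF s(2)] by simp
  qed
  then have "\<beta> (j s) = (\<lambda>q. of_real (1 / (s - s')) * (u s q - u s' q))"
    by blast
  also have "\<dots> \<in> L"
    using jum [OF s(1)] jum [OF s(2)] by (intro scale diff) auto
  finally show ?thesis
    using jum [OF s(1)] by blast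
qed

section \<open>Lie algebras of diagonal tori and their complexifications\<close>

definition torus_lie :: "nat \<Rightarrow> (nat \<Rightarrow> complex) set \<Rightarrow> (nat \<Rightarrow> complex) set" where
  "torus_lie n T = {u. (\<forall>q. Re (u q) = 0) \<and> (\<forall>q. q \<notin> {1..n} \<longrightarrow> u q = 0) \<and>
     (\<forall>s::real. (\<lambda>q. exp (of_real s * u q)) \<in> T)}"

text \<open>The sum is direct: the members of \<open>torus_lie\<close> are imaginary, so the first
  summand is the imaginary part and the second the real part.\<close>

definition torus_lieC :: "nat \<Rightarrow> (nat \<Rightarrow> complex) set \<Rightarrow> (nat \<Rightarrow> complex) set" where
  "torus_lieC n T = {\<lambda>q. u q + \<i> * w q | u w. u \<in> torus_lie n T \<and> w \<in> torus_lie n T}"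

lemma exp_torus_lie: "u \<in> torus_lie n T \<Longrightarrow> (\<lambda>q. exp (u q)) \<in> T"
  by (auto simp: torus_lie_def dest!: spec [of _ "1::real"])

lemma torus_lie_scale: "u \<in> torus_lie n T \<Longrightarrow> (\<lambda>q. of_real r * u q) \<in> torus_lie n T"
proof -
  assume u: "u \<in> torus_lie n T"
  have "(\<lambda>q. exp (of_real s * (of_real r * u q))) \<in> T" for s
  proof -
    have "(\<lambda>q. exp (of_real (s * r) * u q)) \<in> T"
      using u by (simp only: torus_lie_def mem_Collect_eq)
    then show ?thesis by (simp add: mult.assoc)
  qed
  then show ?thesis
    using u by (simp add: torus_lie_def)
qed

lemma torus_lie_add:
  assumes "is_torus (*) T" "u \<in> torus_lie n T" "w \<in> torus_lie n T"
  shows "(\<lambda>q. u q + w q) \<in> torus_lie n T"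
proof -
  have "(\<lambda>q. exp (of_real s * (u q + w q))) \<in> T" for s :: real
  proof -
    have "(\<lambda>q. exp (of_real s * u q)) * (\<lambda>q. exp (of_real s * w q)) \<in> T"
      using assms(2,3) by (intro torus_mult_closed [OF assms(1)]) (auto simp: torus_lie_def)
    then show ?thesis
      by (simp add: times_fun_def distrib_left exp_add)
  qed
  then show ?thesis
    using assms(2,3) by (simp add: torus_lie_def)
qed

lemma torus_lie_zero:
  assumes "is_torus (*) T" "T \<subseteq> full_torus n"
  shows "(\<lambda>q. 0) \<in> torus_lie n T"
  using one_in_diagonal_torus [OF assms] by (auto simp: torus_lie_def one_fun_def)

lemma torus_lie_sum:
  assumes "is_torus (*) T" "T \<subseteq> full_torus n" "\<And>i. i \<in> I \<Longrightarrow> u i \<in> torus_lie n T"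
  shows "(\<lambda>q. \<Sum>i\<in>I. u i q) \<in> torus_lie n T"
  using assms(3)
  by (induction I rule: infinite_finite_induct)
    (auto intro: torus_lie_add [OF assms(1)] torus_lie_zero [OF assms(1,2)])

lemma torus_lieC_scale: "u \<in> torus_lieC n T \<Longrightarrow> (\<lambda>q. of_real r * u q) \<in> torus_lieC n T"
proof -
  assume "u \<in> torus_lieC n T"
  then obtain a b where "a \<in> torus_lie n T" "b \<in> torus_lie n T" "u = (\<lambda>q. a q + \<i> * b q)"
    by (auto simp: torus_lieC_def)
  then show ?thesis
    unfolding torus_lieC_def mem_Collect_eq
    by (intro exI [of _ "\<lambda>q. of_real r * a q"] exI [of _ "\<lambda>q. of_real r * b q"])
      (auto simp: torus_lie_scale algebra_simps)
qed

lemma torus_lieC_add: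
  assumes "is_torus (*) T" "u \<in> torus_lieC n T" "w \<in> torus_lieC n T"
  shows "(\<lambda>q. u q + w q) \<in> torus_lieC n T"
proof -
  obtain a b where "a \<in> torus_lie n T" "b \<in> torus_lie n T" "u = (\<lambda>q. a q + \<i> * b q)"
    using assms(2) by (auto simp: torus_lieC_def)
  moreover obtain c d where "c \<in> torus_lie n T" "d \<in> torus_lie n T" "w = (\<lambda>q. c q + \<i> * d q)"
    using assms(3) by (auto simp: torus_lieC_def)
  ultimately show ?thesis
    unfolding torus_lieC_def mem_Collect_eq
    by (intro exI [of _ "\<lambda>q. a q + c q"] exI [of _ "\<lambda>q. b q + d q"])
      (auto simp: torus_lie_add [OF assms(1)] algebra_simps)
qed

lemma torus_lieC_diff:
  assumes "is_torus (*) T" "u \<in> torus_lieC n T" "w \<in> torus_lieC n T"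
  shows "(\<lambda>q. u q - w q) \<in> torus_lieC n T"
  using torus_lieC_add [OF assms(1,2) torus_lieC_scale [OF assms(3), of "-1"]] by simp

lemma torus_lieC_off: "u \<in> torus_lieC n T \<Longrightarrow> q \<notin> {1..n} \<Longrightarrow> u q = 0"
  by (auto simp: torus_lieC_def torus_lie_def simp del: atLeastAtMost_iff)

text \<open>In \<open>a + \<i> b\<close> with \<open>a\<close> and \<open>b\<close> imaginary the
  second summand is the real part, so it has to vanish.\<close>

lemma torus_lieC_imaginary:
  assumes "u \<in> torus_lieC n T" "\<And>q. Re (u q) = 0"
  shows "u \<in> torus_lie n T"
proof -
  obtain a b where ab: "a \<in> torus_lie n T" "b \<in> torus_lie n T" "u = (\<lambda>q. a q + \<i> * b q)"
    using assms(1) by (auto simp: torus_lieC_def)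
  then have "b q = 0" for q
    using assms(2) [of q] by (auto simp: torus_lie_def complex_eq_iff)
  then have "u = a"
    by (simp add: ab(3))
  then show ?thesis
    using ab(1) by simp
qed

text \<open>The modulus of \<open>exp z\<close> is \<open>exp (Re z)\<close>. This leads from the
  complexified torus back to the torus for coefficients of modulus 1.\<close>

lemma torus_lieC_real_exp:
  assumes "u \<in> torus_lieC n T" "\<And>q. cmod (exp (u q)) = 1"
  shows "u \<in> torus_lie n T"
  using assms by (intro torus_lieC_imaginary) auto

text \<open>Here \<open>T\<close> consists of all diagonal operators with entries in
  \<open>S\<close>, which reduces its Lie algebra and its complexification to sets of functions. The
  situation arises from the weights of \<open>T\<close> and again from an arbitrary
  realization.\<close>

locale torus_coordinates = linear_coordinates smul n \<phi>
  for smul :: "complex \<Rightarrow> 'v::real_normed_vector \<Rightarrow> 'v" and n \<phi> +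
  fixes T :: "('v \<Rightarrow> 'v) set" and S :: "(nat \<Rightarrow> complex) set"
  assumes torus_S: "is_torus (*) S" and S_subset: "S \<subseteq> full_torus n"
    and T_eq: "T = {g. \<exists>t\<in>S. \<forall>v q. \<phi> (g v) q = t q * \<phi> v q}"
begin

lemma diagonal_coordI:
  assumes "\<And>v q. q \<in> {1..n} \<Longrightarrow> \<phi> (g v) q = u q * \<phi> v q"
  shows "\<phi> (g v) q = u q * \<phi> v q"
  using assms by (cases "q \<in> {1..n}") (auto simp: coord_outside)

lemma lie_algebra_iff:
  "A \<in> lie_algebra smul T \<longleftrightarrow> (\<exists>u\<in>torus_lie n S. \<forall>v q. \<phi> (A v) q = u q * \<phi> v q)"
proof
  assume A: "A \<in> lie_algebra smul T"
  then interpret A: Vector_Spaces.linear smul smul A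
    by (simp add: lie_algebra_def)
  have exp_in: "op_exp (\<lambda>v. s *\<^sub>R A v) \<in> T" for s
    using A by (simp add: lie_algebra_def)
  define u where "u q = (if q \<in> {1..n} then \<phi> (A (basis_vec q)) q else 0)" for q
  have A_basis: "\<phi> (A (basis_vec q)) p = (if p = q then u q else 0)" if "q \<in> {1..n}" "p \<in> {1..n}" for p q
  proof (cases "p = q")
    case False
    \<comment> \<open>Every \<open>exp (s A)\<close> is diagonal, so its off-diagonal entries vanish
      identically in \<open>s\<close>, and with them their derivatives at 0.\<close>
    have "\<phi> (A (basis_vec q)) p = 0"
    proof (rule linear_coefficient_eq_0 [where A = A and x = "basis_vec q"])
      show "Vector_Spaces.linear smul smul A" by (rule A.linear_axioms)
      fix s
      obtain t where "\<And>v q. \<phi> (op_exp (\<lambda>v. s *\<^sub>R A v) v) q = t q * \<phi> v q"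
        using exp_in [of s] unfolding T_eq by blast
      then show "\<phi> (op_exp (\<lambda>v. s *\<^sub>R A v) (basis_vec q)) p = 0"
        using False that by (simp add: coord_basis_vec)
    qed (use False that in \<open>auto simp: coord_basis_vec\<close>)
    then show ?thesis using False by simp
  qed (use that in \<open>auto simp: u_def\<close>)
  have diag: "\<phi> (A v) q = u q * \<phi> v q" if q: "q \<in> {1..n}" for v q
  proof -
    have "A v = (\<Sum>p\<in>{1..n}. smul (\<phi> v p) (A (basis_vec p)))"
      by (subst basis_expand [of v]) (simp add: A.sum A.scale)
    then have "\<phi> (A v) q = (\<Sum>p\<in>{1..n}. \<phi> v p * \<phi> (A (basis_vec p)) q)"
      by (simp add: coord_sum coord_smul)
    also have "\<dots> = (\<Sum>p\<in>{1..n}. if p = q then \<phi> v p * u p else 0)"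
      using q by (intro sum.cong refl) (simp add: A_basis del: atLeastAtMost_iff)
    also have "\<dots> = u q * \<phi> v q"
      using q by (simp add: sum.delta' mult.commute)
    finally show ?thesis .
  qed
  have exp_S: "(\<lambda>q. exp (of_real s * u q)) \<in> S" for s
  proof -
    obtain t where t: "t \<in> S" "\<And>v q. \<phi> (op_exp (\<lambda>v. s *\<^sub>R A v) v) q = t q * \<phi> v q"
      using exp_in [of s] unfolding T_eq by blast
    \<comment> \<open>Off \<open>{1..n}\<close> the default 0 of \<open>u\<close> turns into the
      default 1 of torus elements.\<close>
    have "t q = exp (of_real s * u q)" for q
    proof (cases "q \<in> {1..n}")
      case True
      have "\<phi> (op_exp (\<lambda>v. s *\<^sub>R A v) (basis_vec q)) q = exp (of_real s * u q) * \<phi> (basis_vec q) q"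
        by (rule op_exp_diagonal [OF _ True]) (simp add: coord_scaleR diag del: atLeastAtMost_iff)
      then show ?thesis
        using True t(2) by (simp add: coord_basis_vec)
    next
      case False
      then show ?thesis
        using full_torus_off [of t n q] t(1) S_subset by (auto simp: u_def)
    qed
    then have "t = (\<lambda>q. exp (of_real s * u q))" by blast
    then show ?thesis using t(1) by simp
  qed
  have "Re (u q) = 0" for q
    using full_torus_cmod [of "\<lambda>q. exp (of_real 1 * u q)" n q] exp_S [of 1] S_subset by auto
  then have "u \<in> torus_lie n S"
    using exp_S by (simp add: torus_lie_def u_def)
  then show "\<exists>u\<in>torus_lie n S. \<forall>v q. \<phi> (A v) q = u q * \<phi> v q"
    using diagonal_coordI [of A u, OF diag] by blast
next
  assume "\<exists>u\<in>torus_lie n S. \<forall>v q. \<phi> (A v) q = u q * \<phi> v q"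
  then obtain u where u: "u \<in> torus_lie n S" "\<And>v q. \<phi> (A v) q = u q * \<phi> v q" by blast
  have "op_exp (\<lambda>v. s *\<^sub>R A v) \<in> T" for s
  proof -
    have "\<phi> (op_exp (\<lambda>v. s *\<^sub>R A v) v) q = exp (of_real s * u q) * \<phi> v q" for v q
      by (rule diagonal_coordI, rule op_exp_diagonal) (auto simp: coord_scaleR u(2))
    moreover have "(\<lambda>q. exp (of_real s * u q)) \<in> S"
      using u(1) by (simp add: torus_lie_def)
    ultimately show ?thesis
      unfolding T_eq mem_Collect_eq by (intro bexI [of _ "\<lambda>q. exp (of_real s * u q)"]) auto
  qed
  then show "A \<in> lie_algebra smul T"
    using linear_diagonal [of A u] u(2) by (simp add: lie_algebra_def)
qed

lemma torus_complexification_iff: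
  "g \<in> torus_complexification smul T \<longleftrightarrow>
     (\<exists>u\<in>torus_lieC n S. \<forall>v q. \<phi> (g v) q = exp (u q) * \<phi> v q)"
proof
  assume "g \<in> torus_complexification smul T"
  then obtain A B where AB: "A \<in> lie_algebra smul T" "B \<in> lie_algebra smul T"
      "g = op_exp (\<lambda>v. A v + smul \<i> (B v))"
    by (auto simp: torus_complexification_def)
  obtain a where a: "a \<in> torus_lie n S" "\<And>v q. \<phi> (A v) q = a q * \<phi> v q"
    using AB(1) lie_algebra_iff by blast
  obtain b where b: "b \<in> torus_lie n S" "\<And>v q. \<phi> (B v) q = b q * \<phi> v q"
    using AB(2) lie_algebra_iff by blast
  have "\<phi> (g v) q = exp (a q + \<i> * b q) * \<phi> v q" for v q
    unfolding AB(3)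
    by (rule diagonal_coordI, rule op_exp_diagonal)
      (auto simp: coord_add coord_smul a(2) b(2) algebra_simps)
  moreover have "(\<lambda>q. a q + \<i> * b q) \<in> torus_lieC n S"
    using a(1) b(1) by (auto simp: torus_lieC_def)
  ultimately show "\<exists>u\<in>torus_lieC n S. \<forall>v q. \<phi> (g v) q = exp (u q) * \<phi> v q"
    by (intro bexI) auto
next
  assume "\<exists>u\<in>torus_lieC n S. \<forall>v q. \<phi> (g v) q = exp (u q) * \<phi> v q"
  then obtain a b where ab: "a \<in> torus_lie n S" "b \<in> torus_lie n S"
      "\<And>v q. \<phi> (g v) q = exp (a q + \<i> * b q) * \<phi> v q"
    by (auto simp: torus_lieC_def)
  define A where "A v = vec_of (\<lambda>q. a q * \<phi> v q)" for v
  define B where "B v = vec_of (\<lambda>q. b q * \<phi> v q)" for v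
  have A: "\<phi> (A v) q = a q * \<phi> v q" for v q
    by (auto simp: A_def coord_vec coord_outside)
  have B: "\<phi> (B v) q = b q * \<phi> v q" for v q
    by (auto simp: B_def coord_vec coord_outside)
  have "g = op_exp (\<lambda>v. A v + smul \<i> (B v))"
  proof (rule ext, rule vec_eqI)
    fix v q assume "q \<in> {1..n}"
    then have "\<phi> (op_exp (\<lambda>v. A v + smul \<i> (B v)) v) q = exp (a q + \<i> * b q) * \<phi> v q"
      by (intro op_exp_diagonal) (auto simp: coord_add coord_smul A B algebra_simps)
    then show "\<phi> (g v) q = \<phi> (op_exp (\<lambda>v. A v + smul \<i> (B v)) v) q"
      by (simp add: ab(3))
  qed
  moreover have "A \<in> lie_algebra smul T" "B \<in> lie_algebra smul T"
    unfolding lie_algebra_iff using ab A B by blast+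
  ultimately show "g \<in> torus_complexification smul T"
    unfolding torus_complexification_def by blast
qed

end

section \<open>Logarithmic coordinates inside an open set\<close>

context linear_coordinates
begin

text \<open>On the line \<open>v + s (1, ..., 1)\<close> each coordinate vanishes for at most one
  real \<open>s\<close>, so a small nonzero \<open>s\<close> avoids all coordinate
  hyperplanes.\<close>

lemma open_contains_nonzero_coords:
  assumes "open U" "U \<noteq> {}"
  obtains v where "v \<in> U" "\<And>q. q \<in> {1..n} \<Longrightarrow> \<phi> v q \<noteq> 0"
proof -
  obtain v where v: "v \<in> U" using assms(2) by blast
  define w where "w s = v + s *\<^sub>R vec_of (\<lambda>_. 1)" for s :: real
  have "(w \<longlongrightarrow> v + 0 *\<^sub>R vec_of (\<lambda>_. 1)) (at 0)"
    unfolding w_def by (intro tendsto_intros)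
  then have "\<forall>\<^sub>F s in at 0. w s \<in> U"
    using assms(1) v by (simp add: tendsto_def)
  moreover have "\<forall>\<^sub>F s in at 0. \<forall>q\<in>{1..n}. \<phi> (w s) q \<noteq> 0"
  proof (rule eventually_ball_finite [OF finite_atLeastAtMost], rule ballI)
    fix q assume q: "q \<in> {1..n}"
    have "\<forall>\<^sub>F s in at 0. s \<noteq> - Re (\<phi> v q)"
      by (rule eventually_neq_at_within)
    then show "\<forall>\<^sub>F s in at 0. \<phi> (w s) q \<noteq> 0"
      by eventually_elim (use q in \<open>auto simp: w_def coord_add coord_scaleR coord_vec complex_eq_iff\<close>)
  qed
  ultimately have "\<forall>\<^sub>F s in at (0::real). w s \<in> U \<and> (\<forall>q\<in>{1..n}. \<phi> (w s) q \<noteq> 0)"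
    by (rule eventually_conj)
  then obtain s where "w s \<in> U" "\<forall>q\<in>{1..n}. \<phi> (w s) q \<noteq> 0"
    using eventually_happens [of _ "at (0::real)"] by (auto simp: trivial_limit_at)
  then show thesis
    using that by blast
qed

text \<open>In the exponent a diagonal operator acts by translation. One base point
  \<open>\<omega>\<close> serves all directions \<open>\<beta>\<close>; only
  \<open>\<epsilon>\<close> depends on the direction.\<close>

lemma open_contains_exp_lines:
  assumes "open U" "U \<noteq> {}"
  obtains \<omega> where "\<And>\<beta>. \<exists>\<epsilon>>0. \<forall>s::real. \<bar>s\<bar> < \<epsilon> \<longrightarrow> vec_of (\<lambda>q. exp (\<omega> q + of_real s * \<beta> q)) \<in> U"
proof -
  obtain v where v: "v \<in> U" "\<And>q. q \<in> {1..n} \<Longrightarrow> \<phi> v q \<noteq> 0"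
    using open_contains_nonzero_coords [OF assms] by blast
  define \<omega> where "\<omega> q = Ln (\<phi> v q)" for q
  have "\<exists>\<epsilon>>0. \<forall>s::real. \<bar>s\<bar> < \<epsilon> \<longrightarrow> vec_of (\<lambda>q. exp (\<omega> q + of_real s * \<beta> q)) \<in> U" for \<beta>
  proof -
    define w where "w s = vec_of (\<lambda>q. exp (\<omega> q + of_real s * \<beta> q))" for s :: real
    have "continuous_on UNIV w"
      unfolding w_def by (rule continuous_on_vec) (intro continuous_intros)
    then have "open (w -` U)"
      using assms(1) by (simp add: continuous_on_open_vimage)
    moreover have "w 0 = v"
      by (rule vec_eqI) (use v(2) in \<open>auto simp: w_def coord_vec \<omega>_def\<close>)
    then have "0 \<in> w -` U"
      using v(1) by simp
    ultimately obtain \<epsilon> where "\<epsilon> > 0" "\<And>s. dist s 0 < \<epsilon> \<Longrightarrow> s \<in> w -` U"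
      unfolding open_dist by blast
    then show ?thesis
      by (intro exI [of _ \<epsilon>]) (auto simp: w_def)
  qed
  then show thesis by (rule that)
qed

end

section \<open>Weight bases\<close>

context fin_dim_complex_space
begin

lemma finite_basis:
  obtains B where "finite_dimensional_vector_space smul B"
proof -
  obtain S where S: "finite S" "span S = UNIV"
    using finite_spanning by blast
  obtain B where B: "B \<subseteq> S" "independent B" "S \<subseteq> span B"
    using maximal_independent_subset [of S] by blast
  have "span B = UNIV"
    using S(2) span_minimal [OF B(3) subspace_span] by auto
  then have "finite_dimensional_vector_space smul B"
    using B S(1) by unfold_locales (auto intro: finite_subset)
  then show thesis by (rule that)
qed

lemma funpow_in_invariant_set:
  assumes "\<And>y. y \<in> W \<Longrightarrow> g y \<in> W" "x \<in> W"
  shows "(g ^^ i) x \<in> W"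
  using assms by (induction i) auto

text \<open>Some nonzero polynomial in \<open>g\<close> kills \<open>x\<close>, because the powers
  of \<open>g\<close> applied to \<open>x\<close> live in finite dimension. For one of least degree,
  written \<open>(X - a) q\<close> with a root \<open>a\<close>, the vector \<open>q(g) x\<close> is
  nonzero and killed by \<open>g - a\<close>. It stays in \<open>W\<close> since \<open>W\<close> is
  invariant.\<close>

lemma eigenvector_exists:
  assumes g: "Vector_Spaces.linear smul smul g" and W: "subspace W"
    and inv: "\<And>y. y \<in> W \<Longrightarrow> g y \<in> W" and x: "x \<in> W" "x \<noteq> 0"
  obtains a y where "y \<in> W" "y \<noteq> 0" "g y = smul a y"
proof -
  interpret g: Vector_Spaces.linear smul smul g by (rule g)
  obtain B where "finite_dimensional_vector_space smul B" by (rule finite_basis)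
  then interpret fd: finite_dimensional_vector_space smul B .
  \<comment> \<open>This is the value \<open>p(g) x\<close>.\<close>
  define ev where "ev p = (\<Sum>i\<le>degree p. smul (coeff p i) ((g ^^ i) x))" for p
  have ev_upto: "ev p = (\<Sum>i\<le>N. smul (coeff p i) ((g ^^ i) x))" if "degree p \<le> N" for p N
    unfolding ev_def using that
    by (intro sum.mono_neutral_left) (auto simp: coeff_eq_0)
  have ev_in: "ev p \<in> W" for p
    unfolding ev_def by (intro subspace_sum W subspace_scale funpow_in_invariant_set inv x)
  have ev_linear_factor: "ev ([:-a, 1:] * q) = g (ev q) - smul a (ev q)" for a q
  proof -
    have deg: "degree ([:-a, 1:] * q) \<le> Suc (degree q)"
      using degree_mult_le [of "[:-a, 1:]" q] by simp
    have "coeff ([:-a, 1:] * q) i = coeff (pCons 0 q) i - a * coeff q i" for i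
      by simp
    then have "ev ([:-a, 1:] * q) =
        (\<Sum>i\<le>Suc (degree q). smul (coeff (pCons 0 q) i) ((g ^^ i) x)) -
        (\<Sum>i\<le>Suc (degree q). smul (a * coeff q i) ((g ^^ i) x))"
      unfolding ev_upto [OF deg] by (simp only: scale_left_diff_distrib sum_subtractf)
    also have "(\<Sum>i\<le>Suc (degree q). smul (a * coeff q i) ((g ^^ i) x)) = smul a (ev q)"
      unfolding ev_upto [of q "Suc (degree q)", OF le_SucI [OF order_refl]]
      by (simp only: scale_sum_right scale_scale)
    also have "(\<Sum>i\<le>Suc (degree q). smul (coeff (pCons 0 q) i) ((g ^^ i) x)) = g (ev q)"
      unfolding sum.atMost_Suc_shift ev_def g.sum g.scale by simp
    finally show ?thesis .
  qed
  have "\<exists>p. p \<noteq> 0 \<and> ev p = 0"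
  proof (rule ccontr)
    assume "\<nexists>p. p \<noteq> 0 \<and> ev p = 0"
    then have zero: "p = 0" if "ev p = 0" for p
      using that by blast
    define N where "N = dim UNIV"
    have combination: "c i = 0" if "(\<Sum>i\<le>N. smul (c i) ((g ^^ i) x)) = 0" "i \<le> N" for c i
    proof -
      define p where "p = (\<Sum>i\<le>N. monom (c i) i)"
      have coeff_p: "coeff p j = (if j \<le> N then c j else 0)" for j
        by (simp add: p_def coeff_sum sum.delta)
      then have "degree p \<le> N"
        by (intro degree_le) auto
      then have "ev p = 0"
        using that(1) by (simp add: ev_upto coeff_p)
      then show ?thesis
        using zero [of p] coeff_p [of i] that(2) by simp
    qed
    \<comment> \<open>\<open>independent\<close> speaks of a set, so repetitions among the powers
      must be excluded separately; a repetition would itself be a polynomial relation.\<close>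
    have inj: "inj_on (\<lambda>i. (g ^^ i) x) {..N}"
    proof (rule inj_onI, rule ccontr)
      fix i j assume ij: "i \<in> {..N}" "j \<in> {..N}" "(g ^^ i) x = (g ^^ j) x" "i \<noteq> j"
      have "(\<Sum>k\<le>N. smul (if k = i then 1 else if k = j then - 1 else 0) ((g ^^ k) x)) =
          (\<Sum>k\<le>N. if k = i then (g ^^ k) x else 0) - (\<Sum>k\<le>N. if k = j then (g ^^ k) x else 0)"
        unfolding sum_subtractf [symmetric] using ij(4) by (intro sum.cong) auto
      also have "\<dots> = 0"
        using ij by (simp add: sum.delta)
      finally show False
        using combination [of "\<lambda>k. if k = i then 1 else if k = j then - 1 else 0" i] ij(1) by simp
    qed
    have "independent ((\<lambda>i. (g ^^ i) x) ` {..N})"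
    proof (rule independent_if_scalars_zero)
      fix f y assume *: "(\<Sum>y\<in>(\<lambda>i. (g ^^ i) x) ` {..N}. smul (f y) y) = 0" "y \<in> (\<lambda>i. (g ^^ i) x) ` {..N}"
      then show "f y = 0"
        using combination [of "\<lambda>i. f ((g ^^ i) x)"] by (auto simp: sum.reindex [OF inj])
    qed simp
    then have "card ((\<lambda>i. (g ^^ i) x) ` {..N}) \<le> N"
      unfolding N_def by (intro fd.independent_card_le_dim) auto
    then show False
      by (simp add: card_image [OF inj])
  qed
  then obtain p where p: "p \<noteq> 0" "ev p = 0"
    and least: "\<And>q. q \<noteq> 0 \<Longrightarrow> ev q = 0 \<Longrightarrow> degree p \<le> degree q"
    using ex_has_least_nat [of "\<lambda>p. p \<noteq> 0 \<and> ev p = 0" _ degree] by blast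
  have "degree p \<noteq> 0"
  proof
    assume "degree p = 0"
    then obtain c where "p = [:c:]" by (rule degree_eq_zeroE)
    then show False
      using p x by (simp add: ev_def)
  qed
  then have "\<not> constant (poly p)"
    by (simp add: constant_degree)
  then obtain a where "poly p a = 0"
    using fundamental_theorem_of_algebra [of p] by blast
  then obtain q where q: "p = [:-a, 1:] * q"
    using poly_eq_0_iff_dvd [of p a] by (auto elim: dvdE)
  then have "q \<noteq> 0" using p(1) by auto
  then have "degree p = Suc (degree q)"
    unfolding q by (subst degree_mult_eq) auto
  then have "ev q \<noteq> 0"
    using least [of q] \<open>q \<noteq> 0\<close> by auto
  moreover have "g (ev q) = smul a (ev q)"
    using p(2) ev_linear_factor [of a q] q by simp
  ultimately show thesis
    using that ev_in by blast
qed

text \<open>The third assumption says that \<open>(g - a)\<^sup>2 x = 0\<close> implies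
  \<open>(g - a) x = 0\<close> (in the notation of matrices
  \<open>ker (g - a)^2 = ker (g - a)\<close>). Then \<open>W\<close> is the sum of the kernel and
  the image of \<open>g - a\<close> on \<open>W\<close>; both are invariant under the commuting
  family, and induction on the dimension applies to each.\<close>

lemma common_eigenvectors_span:
  assumes lin: "\<And>g. g \<in> S \<Longrightarrow> Vector_Spaces.linear smul smul g"
    and comm: "\<And>g h x. g \<in> S \<Longrightarrow> h \<in> S \<Longrightarrow> g (h x) = h (g x)"
    and semisimple: "\<And>g a x. g \<in> S \<Longrightarrow> g (g x - smul a x) = smul a (g x - smul a x) \<Longrightarrow> g x = smul a x"
    and W: "subspace W" "\<And>g x. g \<in> S \<Longrightarrow> x \<in> W \<Longrightarrow> g x \<in> W"
  shows "W \<subseteq> span {x. \<forall>g\<in>S. \<exists>a. g x = smul a x}"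
proof -
  obtain B where "finite_dimensional_vector_space smul B" by (rule finite_basis)
  then interpret fd: finite_dimensional_vector_space smul B .
  interpret pair: finite_dimensional_vector_space_pair_1 smul B smul by unfold_locales
  define E where "E = {x. \<forall>g\<in>S. \<exists>a. g x = smul a x}"
  have "W \<subseteq> span E"
    using W
  proof (induction "dim W" arbitrary: W rule: less_induct)
    case less
    show ?case
    \<comment> \<open>If all operators are scalar on \<open>W\<close>, every vector of
      \<open>W\<close> is a common eigenvector. This includes \<open>W = {0}\<close> and ends the
      recursion.\<close>
    proof (cases "\<forall>g\<in>S. \<exists>a. \<forall>x\<in>W. g x = smul a x")
      case True
      then have "W \<subseteq> E"
        unfolding E_def by blast
      then show ?thesis
        using span_superset by blast
    next
      case False
      then obtain g where g: "g \<in> S" "\<And>a. \<exists>x\<in>W. g x \<noteq> smul a x"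
        by blast
      interpret g: Vector_Spaces.linear smul smul g by (rule lin [OF g(1)])
      obtain x where "x \<in> W" "g x \<noteq> smul 0 x"
        using g(2) by blast
      then have "x \<noteq> 0" by auto
      then obtain a y where y: "y \<in> W" "y \<noteq> 0" "g y = smul a y"
        using eigenvector_exists [OF g.linear_axioms less.prems(1) less.prems(2) [OF g(1)] \<open>x \<in> W\<close>]
        by blast
      define N where "N x = g x - smul a x" for x
      have linN: "Vector_Spaces.linear smul smul N"
      proof -
        have "N (x + y) = N x + N y" for x y
          unfolding N_def g.add scale_right_distrib by simp
        moreover have "N (smul c x) = smul c (N x)" for c x
          unfolding N_def g.scale scale_right_diff_distrib scale_scale by (simp only: mult.commute)
        ultimately show ?thesis
          unfolding Vector_Spaces.linear_iff using vector_space_axioms by blast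
      qed
      interpret N: Vector_Spaces.linear smul smul N by (rule linN)
      have N_W: "N x \<in> W" if "x \<in> W" for x
        unfolding N_def
        by (rule subspace_diff [OF less.prems(1) less.prems(2) [OF g(1) that] subspace_scale [OF less.prems(1) that]])
      have N_comm: "h (N x) = N (h x)" if "h \<in> S" for h x
      proof -
        interpret h: Vector_Spaces.linear smul smul h by (rule lin [OF that])
        show ?thesis
          unfolding N_def by (simp add: h.diff h.scale comm [OF that g(1)])
      qed
      have N_N: "N x = 0" if "N (N x) = 0" for x
        using semisimple [OF g(1), of x a] that by (simp add: N_def)
      define K where "K = {x \<in> W. N x = 0}"
      define I where "I = N ` W"
      have sK: "subspace K"
        unfolding K_def by (intro subspaceI) (auto simp: N.zero N.add N.scale less.prems(1)
          intro: subspace_0 subspace_add subspace_scale)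
      have sI: "subspace I"
        unfolding I_def by (rule N.subspace_image [OF less.prems(1)])
      have KW: "K \<subset> W"
        using g(2) [of a] by (auto simp: K_def N_def)
      have IW: "I \<subset> W"
      proof -
        have "I \<subseteq> W" by (auto simp: I_def N_W)
        \<comment> \<open>If the eigenvector \<open>y\<close> were \<open>N x\<close>, then
          \<open>N (N x) = 0\<close> would give \<open>y = N x = 0\<close>. So the image is proper
          even before the decomposition is known.\<close>
        moreover have "y \<notin> I"
        proof
          assume "y \<in> I"
          then obtain x where "y = N x" by (auto simp: I_def)
          then show False
            using N_N [of x] y by (simp add: N_def)
        qed
        ultimately show ?thesis using y(1) by blast
      qed
      have dim_less: "dim U < dim W" if "subspace U" "U \<subset> W" for U
        using that less.prems(1) by (intro fd.dim_psubset) (simp add: span_eq_iff [THEN iffD2])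
      have "K \<subseteq> span E"
      proof (rule less.hyps [OF dim_less [OF sK KW] sK])
        fix h x assume "h \<in> S" "x \<in> K"
        then show "h x \<in> K"
          using less.prems(2) N_comm [of h x] lin [of h]
          by (auto simp: K_def module_hom.zero linear_iff_module_hom)
      qed
      moreover have "I \<subseteq> span E"
      proof (rule less.hyps [OF dim_less [OF sI IW] sI])
        fix h x assume "h \<in> S" "x \<in> I"
        then show "h x \<in> I"
          using less.prems(2) N_comm unfolding I_def by (metis imageE imageI)
      qed
      \<comment> \<open>\<open>N\<close> is injective on its image \<open>I\<close>, hence maps
        \<open>I\<close> onto itself by dimension; subtracting from \<open>w\<close> a preimage
        \<open>i\<close> of \<open>N w\<close> in \<open>I\<close> leaves an element of the
        kernel.\<close>
      moreover have "\<exists>k\<in>K. \<exists>i\<in>I. w = k + i" if w: "w \<in> W" for w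
      proof -
        have "inj_on N I"
        proof (rule inj_onI)
          fix u v assume uv: "u \<in> I" "v \<in> I" "N u = N v"
          then obtain z where "u - v = N z"
            unfolding I_def using N.diff by (metis imageE)
          moreover have "N (u - v) = 0"
            using uv(3) by (simp add: N.diff)
          ultimately have "u - v = 0"
            using N_N [of z] by simp
          then show "u = v" by simp
        qed
        then have "dim (N ` I) = dim I"
          using sI by (intro pair.dim_image_eq linN) (simp add: span_eq_iff [THEN iffD2])
        moreover have "N ` I \<subseteq> I"
          using N_W by (auto simp: I_def)
        ultimately have "N ` I = I"
          by (intro fd.subspace_dim_equal sI N.subspace_image) auto
        then obtain i where "i \<in> I" "N w = N i"
          using w by (metis I_def imageE imageI)
        moreover have "w - i \<in> K"
          using w IW \<open>i \<in> I\<close> \<open>N w = N i\<close> less.prems(1)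
          by (auto simp: K_def N.diff intro: subspace_diff)
        ultimately show ?thesis
          by (metis diff_add_cancel)
      qed
      ultimately show ?thesis
        by (metis subsetI subset_iff span_add)
    qed
  qed
  then show ?thesis by (simp add: E_def)
qed

lemma linear_smul: "Vector_Spaces.linear smul smul g \<Longrightarrow> g (smul a x) = smul a (g x)"
  by (simp add: Vector_Spaces.linear_iff)

lemma linear_add: "Vector_Spaces.linear smul smul g \<Longrightarrow> g (x + y) = g x + g y"
  by (simp add: Vector_Spaces.linear_iff)

text \<open>Continuity for pointwise convergence makes \<open>s \<mapsto> h s x\<close> continuous,
  so the orbit is a continuous image of a compact torus.\<close>

lemma torus_orbit_bounded:
  assumes "is_torus (\<circ>) T"
  obtains M where "\<And>t. t \<in> T \<Longrightarrow> norm (t (x::'v)) \<le> M"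
proof -
  obtain k h where h: "continuous_on (full_torus k) h" "bij_betw h (full_torus k) T"
    using assms unfolding is_torus_def by blast
  have "compact ((\<lambda>s. h s x) ` full_torus k)"
    by (rule compact_continuous_image [OF continuous_on_product_then_coordinatewise [OF h(1)] compact_full_torus])
  then obtain M where "\<forall>y\<in>(\<lambda>s. h s x) ` full_torus k. norm y \<le> M"
    using compact_imp_bounded bounded_iff by metis
  moreover have "T = h ` full_torus k"
    using h(2) by (simp add: bij_betw_def)
  ultimately show thesis
    using that by auto
qed

lemma eigenvalue_cmod_le_1:
  assumes T: "is_torus (\<circ>) T" "\<And>g. g \<in> T \<Longrightarrow> Vector_Spaces.linear smul smul g"
    and g: "\<And>i. g ^^ i \<in> T" "g z = smul a z" "z \<noteq> 0"
  shows "cmod a \<le> 1"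
proof (rule ccontr)
  assume "\<not> cmod a \<le> 1"
  then have a: "1 < cmod a" by simp
  obtain M1 where M1: "\<And>t. t \<in> T \<Longrightarrow> norm (t z) \<le> M1"
    using torus_orbit_bounded [OF T(1)] by blast
  obtain M2 where M2: "\<And>t. t \<in> T \<Longrightarrow> norm (t (smul \<i> z)) \<le> M2"
    using torus_orbit_bounded [OF T(1)] by blast
  have lin: "Vector_Spaces.linear smul smul g"
    using T(2) [OF g(1) [of 1]] by simp
  have pow: "(g ^^ i) z = smul (a ^ i) z" for i
    by (induction i) (auto simp: linear_smul [OF lin] g(2) mult.commute)
  have "cmod a ^ i * norm z \<le> M1 + M2" for i
  proof -
    \<comment> \<open>With a norm that is not complex-homogeneous, growth of \<open>a ^ i\<close> is
      measured backwards: \<open>z\<close> is recovered from the bounded vector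
      \<open>(g ^^ i) z\<close> by the small scalar \<open>inverse (a ^ i)\<close>.\<close>
    have "norm z = norm (smul (inverse (a ^ i)) ((g ^^ i) z))"
      using a unfolding pow scale_scale by (subst left_inverse) auto
    also have "\<dots> \<le> cmod (inverse (a ^ i)) * (norm ((g ^^ i) z) + norm (smul \<i> ((g ^^ i) z)))"
      by (rule norm_smul_le)
    also have "\<dots> = cmod (inverse (a ^ i)) * (norm ((g ^^ i) z) + norm ((g ^^ i) (smul \<i> z)))"
      by (simp add: linear_smul [OF T(2) [OF g(1)]])
    also have "\<dots> \<le> cmod (inverse (a ^ i)) * (M1 + M2)"
      by (intro mult_left_mono add_mono M1 M2 g(1)) auto
    finally have "norm z \<le> (M1 + M2) / cmod a ^ i"
      by (simp add: norm_inverse norm_power divide_inverse mult.commute)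
    moreover have "0 < cmod a ^ i"
      by (rule zero_less_power) (rule order_less_trans [OF zero_less_one a])
    ultimately show ?thesis
      using pos_le_divide_eq [of "cmod a ^ i" "norm z" "M1 + M2"] by (simp add: mult.commute)
  qed
  moreover obtain i where "(M1 + M2) / norm z < cmod a ^ i"
    using real_arch_pow [OF a] by blast
  ultimately show False
    using g(3) by (metis divide_less_eq not_le zero_less_norm_iff)
qed

text \<open>A Jordan block with eigenvalue \<open>a\<close> would give
  \<open>g^k x = a^k x + k a^(k-1) z\<close>. Since \<open>g\<close> and its inverse have bounded
  powers, \<open>a\<close> has modulus 1, and the second term grows linearly against the bounded
  orbit.\<close>

lemma torus_semisimple:
  assumes T: "is_torus (\<circ>) T" "\<And>g. g \<in> T \<Longrightarrow> Vector_Spaces.linear smul smul g" "id \<in> T"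
    and inv: "\<And>g. g \<in> T \<Longrightarrow> \<exists>g'\<in>T. g' \<circ> g = id"
    and g: "g \<in> T" "g (g x - smul a x) = smul a (g x - smul a x)"
  shows "g x = smul a x"
proof (rule ccontr)
  define z where "z = g x - smul a x"
  assume "g x \<noteq> smul a x"
  then have z: "z \<noteq> 0" "g z = smul a z"
    using g(2) by (auto simp: z_def)
  have pow_T: "g ^^ i \<in> T" if "g \<in> T" for g i
  proof (induction i)
    case 0
    show ?case unfolding funpow.simps by (rule T(3))
  next
    case (Suc i)
    show ?case unfolding funpow.simps by (rule torus_mult_closed [OF T(1) that Suc])
  qed
  obtain g' where g': "g' \<in> T" "g' \<circ> g = id"
    using inv [OF g(1)] by blast
  have g'_g: "g' (g y) = y" for y
    using g'(2) by (metis comp_apply id_apply)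
  have "a \<noteq> 0"
  proof
    assume "a = 0"
    then have "g' (g z) = 0"
      using linear_smul [OF T(2) [OF g'(1)], of 0 0] by (simp add: z(2))
    then show False
      using z(1) g'_g by simp
  qed
  have "g' z = smul (inverse a) z"
  proof -
    have "z = smul a (g' z)"
      using g'_g [of z] by (simp add: z(2) linear_smul [OF T(2) [OF g'(1)]])
    then have "smul (inverse a) z = smul (inverse a) (smul a (g' z))"
      by simp
    then show ?thesis
      using \<open>a \<noteq> 0\<close> by simp
  qed
  then have "cmod (inverse a) \<le> 1"
    by (intro eigenvalue_cmod_le_1 [OF T(1,2), where g = g' and z = z] pow_T g'(1) z(1)) auto
  moreover have "cmod a \<le> 1"
    by (intro eigenvalue_cmod_le_1 [OF T(1,2), where g = g and z = z] pow_T g(1) z) auto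
  ultimately have a1: "cmod a = 1"
    using \<open>a \<noteq> 0\<close> one_le_inverse [of "cmod a"] by (simp add: norm_inverse)
  have lin: "Vector_Spaces.linear smul smul g" by (rule T(2) [OF g(1)])
  \<comment> \<open>Stated for \<open>Suc i\<close> so that the exponent \<open>k - 1\<close> in the
    Jordan formula is the natural number \<open>i\<close>.\<close>
  have pow: "(g ^^ Suc i) x = smul (a ^ Suc i) x + smul (of_nat (Suc i) * a ^ i) z" for i
  proof (induction i)
    case 0
    then show ?case by (simp add: z_def)
  next
    case (Suc i)
    have "(g ^^ Suc (Suc i)) x = g ((g ^^ Suc i) x)"
      by simp
    also have "\<dots> = smul (a ^ Suc i) (g x) + smul (of_nat (Suc i) * a ^ i) (smul a z)"
      unfolding Suc linear_add [OF lin] linear_smul [OF lin] z(2) ..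
    also have "g x = smul a x + z"
      by (simp add: z_def)
    also have "smul (a ^ Suc i) (smul a x + z) + smul (of_nat (Suc i) * a ^ i) (smul a z)
        = smul (a ^ Suc (Suc i)) x + (smul (a ^ Suc i) z + smul (of_nat (Suc i) * a ^ i * a) z)"
      by (simp add: scale_right_distrib mult.commute add.assoc)
    also have "smul (a ^ Suc i) z + smul (of_nat (Suc i) * a ^ i * a) z = smul (of_nat (Suc (Suc i)) * a ^ Suc i) z"
      by (subst scale_left_distrib [symmetric]) (simp add: algebra_simps)
    finally show ?case .
  qed
  obtain M1 where M1: "\<And>t. t \<in> T \<Longrightarrow> norm (t x) \<le> M1"
    using torus_orbit_bounded [OF T(1)] by blast
  obtain M2 where M2: "\<And>t. t \<in> T \<Longrightarrow> norm (t (smul \<i> x)) \<le> M2"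
    using torus_orbit_bounded [OF T(1)] by blast
  have bound: "real (Suc i) * norm z \<le> M1 + M2 + norm (smul a x)" for i
  proof -
    have "smul (inverse (a ^ i)) ((g ^^ Suc i) x) = smul a x + smul (of_nat (Suc i)) z"
    proof -
      have "inverse (a ^ i) * a ^ Suc i = a" "inverse (a ^ i) * (of_nat (Suc i) * a ^ i) = of_nat (Suc i)"
        using \<open>a \<noteq> 0\<close> by (simp_all add: field_simps)
      then show ?thesis
        unfolding pow scale_right_distrib scale_scale by (simp only:)
    qed
    moreover have "smul (of_nat (Suc i)) z = real (Suc i) *\<^sub>R z"
      using smul_of_real [of "real (Suc i)" z] by simp
    ultimately have "real (Suc i) *\<^sub>R z = smul (inverse (a ^ i)) ((g ^^ Suc i) x) - smul a x"
      by simp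
    then have "norm (real (Suc i) *\<^sub>R z) \<le> norm (smul (inverse (a ^ i)) ((g ^^ Suc i) x)) + norm (smul a x)"
      using norm_triangle_ineq4 by metis
    then have "real (Suc i) * norm z \<le> norm (smul (inverse (a ^ i)) ((g ^^ Suc i) x)) + norm (smul a x)"
      unfolding norm_scaleR by simp
    also have "norm (smul (inverse (a ^ i)) ((g ^^ Suc i) x)) \<le>
        cmod (inverse (a ^ i)) * (norm ((g ^^ Suc i) x) + norm (smul \<i> ((g ^^ Suc i) x)))"
      by (rule norm_smul_le)
    also have "\<dots> = norm ((g ^^ Suc i) x) + norm ((g ^^ Suc i) (smul \<i> x))"
      unfolding linear_smul [OF T(2) [OF pow_T [OF g(1)]]] by (simp add: norm_inverse norm_power a1)
    also have "\<dots> \<le> M1 + M2"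
      by (intro add_mono M1 M2 pow_T g(1))
    finally show ?thesis by simp
  qed
  obtain i where "(M1 + M2 + norm (smul a x)) / norm z < real i"
    using reals_Archimedean2 by blast
  then have "(M1 + M2 + norm (smul a x)) / norm z < real (Suc i)"
    by simp
  then show False
    using bound [of i] z(1) by (metis divide_less_eq not_le zero_less_norm_iff)
qed

text \<open>A basis can be selected inside the spanning set \<open>E\<close>; every operator for
  which all vectors of \<open>E\<close> are eigenvectors is diagonal in it.\<close>

lemma basis_coordinates:
  assumes E: "span E = UNIV"
  obtains n \<phi> where "linear_coordinates smul n \<phi>"
    "\<And>g. Vector_Spaces.linear smul smul g \<Longrightarrow> (\<And>x. x \<in> E \<Longrightarrow> \<exists>a. g x = smul a x) \<Longrightarrow>
       \<exists>t. \<forall>v q. \<phi> (g v) q = t q * \<phi> v q"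
proof -
  obtain B where B: "B \<subseteq> E" "independent B" "E \<subseteq> span B"
    using maximal_independent_subset [of E] by blast
  have span_B: "span B = UNIV"
    using E span_minimal [OF B(3) subspace_span] by auto
  obtain B' where "finite_dimensional_vector_space smul B'" by (rule finite_basis)
  then interpret fd: finite_dimensional_vector_space smul B' .
  have "finite B" by (rule fd.finiteI_independent [OF B(2)])
  then obtain b where b: "bij_betw b {1..card B} B"
    using ex_bij_betw_nat_finite_1 by blast
  define n where "n = card B"
  have b: "bij_betw b {1..n} B" using b by (simp add: n_def)
  define \<phi> where "\<phi> v q = (if q \<in> {1..n} then representation B v (b q) else 0)" for v q
  have in_span: "v \<in> span B" for v by (simp add: span_B)
  have expand: "v = (\<Sum>q\<in>{1..n}. smul (\<phi> v q) (b q))" for v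
  proof -
    have "v = (\<Sum>y\<in>B. smul (representation B v y) y)"
      using sum_representation_eq [OF B(2) in_span \<open>finite B\<close> order_refl] by simp
    also have "\<dots> = (\<Sum>q\<in>{1..n}. smul (representation B v (b q)) (b q))"
      by (rule sum.reindex_bij_betw [OF b, symmetric])
    also have "\<dots> = (\<Sum>q\<in>{1..n}. smul (\<phi> v q) (b q))"
      by (rule sum.cong) (auto simp: \<phi>_def)
    finally show ?thesis .
  qed
  have b_in: "b q \<in> B" if "q \<in> {1..n}" for q
    using b that by (auto simp: bij_betw_def)
  have coords_sum: "\<phi> (\<Sum>q\<in>{1..n}. smul (x q) (b q)) p = x p" if "p \<in> {1..n}" for x p
  proof -
    have "\<phi> (\<Sum>q\<in>{1..n}. smul (x q) (b q)) p = (\<Sum>q\<in>{1..n}. x q * representation B (b q) (b p))"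
      using that by (simp add: \<phi>_def representation_sum [OF B(2) in_span] representation_scale [OF B(2) in_span])
    also have "\<dots> = (\<Sum>q\<in>{1..n}. if q = p then x q else 0)"
    proof (rule sum.cong [OF refl])
      fix q assume q: "q \<in> {1..n}"
      then have "b q = b p \<longleftrightarrow> q = p"
        using inj_on_eq_iff [OF bij_betw_imp_inj_on [OF b] _ that] by blast
      then show "x q * representation B (b q) (b p) = (if q = p then x q else 0)"
        using representation_basis [OF B(2) b_in [OF q]] by auto
    qed
    also have "\<dots> = x p"
      using that by (simp add: sum.delta)
    finally show ?thesis .
  qed
  have \<phi>_add: "\<phi> (v + w) q = \<phi> v q + \<phi> w q" for v w q
    by (simp add: \<phi>_def representation_add [OF B(2) in_span in_span])
  have \<phi>_scale: "\<phi> (smul c v) q = c * \<phi> v q" for c v q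
    by (simp add: \<phi>_def representation_scale [OF B(2) in_span])
  have vs: "vector_space (\<lambda>c (x :: nat \<Rightarrow> complex) q. c * x q)"
    by unfold_locales (auto simp: fun_eq_iff algebra_simps)
  have "linear_coordinates smul n \<phi>"
  proof (intro linear_coordinates.intro linear_coordinates_axioms.intro)
    show "fin_dim_complex_space smul" by (rule fin_dim_complex_space_axioms)
    show "Vector_Spaces.linear smul (\<lambda>c x q. c * x q) \<phi>"
      unfolding Vector_Spaces.linear_iff
      using vector_space_axioms vs by (simp add: fun_eq_iff \<phi>_add \<phi>_scale)
    show "bij_betw \<phi> UNIV (Cn n)"
    proof (rule bij_betwI')
      show "\<phi> v = \<phi> w \<longleftrightarrow> v = w" for v w
        using expand by metis
      show "\<phi> v \<in> Cn n" for v
        by (simp add: Cn_def \<phi>_def)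
      fix x assume x: "x \<in> Cn n"
      have "x = \<phi> (\<Sum>q\<in>{1..n}. smul (x q) (b q))"
      proof
        fix p
        show "x p = \<phi> (\<Sum>q\<in>{1..n}. smul (x q) (b q)) p"
          using coords_sum [of p x] x by (cases "p \<in> {1..n}") (auto simp: Cn_def \<phi>_def)
      qed
      then show "\<exists>v\<in>UNIV. x = \<phi> v" by blast
    qed
  qed
  moreover have "\<exists>t. \<forall>v q. \<phi> (g v) q = t q * \<phi> v q"
    if g: "Vector_Spaces.linear smul smul g" "\<And>x. x \<in> E \<Longrightarrow> \<exists>a. g x = smul a x" for g
  proof -
    interpret g: Vector_Spaces.linear smul smul g by (rule g(1))
    obtain a where a: "\<And>x. x \<in> E \<Longrightarrow> g x = smul (a x) x"
      using g(2) by metis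
    have "\<phi> (g v) q = a (b q) * \<phi> v q" for v q
    proof (cases "q \<in> {1..n}")
      case True
      have "g v = (\<Sum>q\<in>{1..n}. smul (a (b q) * \<phi> v q) (b q))"
        by (subst expand [of v], unfold g.sum g.scale, rule sum.cong)
          (use a b_in B(1) in \<open>auto simp: mult.commute subset_iff\<close>)
      then show ?thesis
        using coords_sum [OF True, of "\<lambda>q. a (b q) * \<phi> v q"] by simp
    qed (simp add: \<phi>_def del: atLeastAtMost_iff)
    then show ?thesis by (intro exI [of _ "\<lambda>q. a (b q)"]) auto
  qed
  ultimately show thesis
    by (rule that)
qed

lemma torus_coordinates_exist:
  assumes T: "is_torus (\<circ>) T" "\<And>g. g \<in> T \<Longrightarrow> Vector_Spaces.linear smul smul g" "id \<in> T"
    and inv: "\<And>g. g \<in> T \<Longrightarrow> \<exists>g'\<in>T. g' \<circ> g = id"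
  obtains n \<phi> where "linear_coordinates smul n \<phi>"
    "\<And>g. g \<in> T \<Longrightarrow> \<exists>t. \<forall>v q. \<phi> (g v) q = t q * \<phi> v q"
proof -
  define E where "E = {x. \<forall>g\<in>T. \<exists>a. g x = smul a x}"
  have "UNIV \<subseteq> span E"
    unfolding E_def
  proof (rule common_eigenvectors_span)
    show "g (h x) = h (g x)" if "g \<in> T" "h \<in> T" for g h x
      using torus_commute [OF T(1) that] by (metis comp_apply)
    show "g x = smul a x" if "g \<in> T" "g (g x - smul a x) = smul a (g x - smul a x)" for g a x
      by (rule torus_semisimple [of T g x a]) (assumption | rule T inv that)+
    show "Vector_Spaces.linear smul smul g" if "g \<in> T" for g
      by (rule T(2) [OF that])
  qed auto
  then have "span E = UNIV" by blast
  then obtain n \<phi> where "linear_coordinates smul n \<phi>"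
    "\<And>g. Vector_Spaces.linear smul smul g \<Longrightarrow> (\<And>x. x \<in> E \<Longrightarrow> \<exists>a. g x = smul a x) \<Longrightarrow>
       \<exists>t. \<forall>v q. \<phi> (g v) q = t q * \<phi> v q"
    by (rule basis_coordinates) blast
  then show thesis
    using that T(2) unfolding E_def by blast
qed

end

section \<open>Realizations by monomial operators\<close>

text \<open>Lagrange's theorem expressed by iteration of functions, for use with both the
  permutations and the finite operator group.\<close>

lemma finite_composition_group_exponent:
  assumes "group M" "finite (carrier M)" "\<And>x y. x \<otimes>\<^bsub>M\<^esub> y = x \<circ> y" "\<one>\<^bsub>M\<^esub> = id" "x \<in> carrier M"
  shows "x ^^ card (carrier M) = id"
proof -
  interpret group M by (rule assms(1))
  have pow: "x [^]\<^bsub>M\<^esub> (k::nat) = x ^^ k" for k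
  proof (induction k)
    case (Suc k)
    have "x [^]\<^bsub>M\<^esub> Suc k = (x ^^ k) \<circ> x"
      by (simp add: assms(3) Suc)
    then show ?case
      by (metis funpow_Suc_right)
  qed (simp only: nat_pow_0 assms(4) funpow.simps)
  show ?thesis
    using pow_order_eq_1 [OF assms(5)] unfolding Coset.order_def assms(4) pow .
qed

section \<open>Permutation groups, their orbits on indices and the torus of orbit products 1\<close>

locale permutation_group =
  fixes n :: nat and P :: "(nat \<Rightarrow> nat) set"
  assumes subgroup_P: "subgroup P (sym_group n)"
begin

lemma P_permutes: "\<sigma> \<in> P \<Longrightarrow> \<sigma> permutes {1..n}"
  using subgroup.subset [OF subgroup_P] by (auto simp: sym_group_def)

lemma P_id: "id \<in> P"
  using subgroup.one_closed [OF subgroup_P] by (simp only: sym_group_def monoid.simps)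

lemma P_comp: "\<sigma> \<in> P \<Longrightarrow> \<tau> \<in> P \<Longrightarrow> \<sigma> \<circ> \<tau> \<in> P"
  using subgroup.m_closed [OF subgroup_P] by (simp only: sym_group_def monoid.simps)

lemma P_inv: "\<sigma> \<in> P \<Longrightarrow> inv_into UNIV \<sigma> \<in> P"
  using subgroup.m_inv_closed [OF subgroup_P, of \<sigma>] sym_group_inv_equality [of \<sigma> n]
    subgroup.subset [OF subgroup_P] by auto

lemma P_funpow: "\<sigma> \<in> P \<Longrightarrow> \<sigma> ^^ k \<in> P"
proof (induction k)
  case 0
  show ?case unfolding funpow.simps by (rule P_id)
next
  case (Suc k)
  then show ?case unfolding funpow.simps by (intro P_comp)
qed

lemma finite_P: "finite P"
proof (rule finite_subset)
  show "P \<subseteq> {\<sigma>. \<sigma> permutes {1..n}}" using P_permutes by blast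
  show "finite {\<sigma>. \<sigma> permutes {1..n}}" by (rule finite_permutations) simp
qed

lemma P_exponent: "\<sigma> \<in> P \<Longrightarrow> \<sigma> ^^ card P = id"
  using finite_composition_group_exponent
    [of "sym_group n\<lparr>carrier := P\<rparr>", OF subgroup.subgroup_is_group [OF subgroup_P sym_group_is_group]]
  by (simp add: finite_P sym_group_def)

definition index_orbit :: "nat \<Rightarrow> nat set" where
  "index_orbit q = {\<sigma> q | \<sigma>. \<sigma> \<in> P}"

lemma index_orbits_eq: "index_orbits n P = index_orbit ` {1..n}"
  by (auto simp: index_orbits_def orbits_def orbit_def index_orbit_def)

lemma self_in_index_orbit: "q \<in> index_orbit q"
  unfolding index_orbit_def using P_id by (metis (mono_tags, lifting) id_apply mem_Collect_eq)

lemma image_in_index_orbit: "\<sigma> \<in> P \<Longrightarrow> \<sigma> q \<in> index_orbit q"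
  unfolding index_orbit_def by blast

lemma index_orbit_subset: "q \<in> {1..n} \<Longrightarrow> index_orbit q \<subseteq> {1..n}"
  unfolding index_orbit_def using permutes_in_image [OF P_permutes, THEN iffD2] by (auto simp only:)

lemma index_orbit_image: "\<sigma> \<in> P \<Longrightarrow> index_orbit (\<sigma> q) = index_orbit q"
proof (intro equalityI subsetI)
  assume \<sigma>: "\<sigma> \<in> P"
  fix x
  show "x \<in> index_orbit q" if "x \<in> index_orbit (\<sigma> q)"
  proof -
    obtain \<tau> where "\<tau> \<in> P" "x = (\<tau> \<circ> \<sigma>) q"
      using \<open>x \<in> index_orbit (\<sigma> q)\<close> by (auto simp: index_orbit_def)
    then show ?thesis
      using P_comp [OF _ \<sigma>] image_in_index_orbit by metis
  qed
  show "x \<in> index_orbit (\<sigma> q)" if "x \<in> index_orbit q"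
  proof -
    obtain \<tau> where \<tau>: "\<tau> \<in> P" "x = \<tau> q"
      using \<open>x \<in> index_orbit q\<close> by (auto simp: index_orbit_def)
    have "x = (\<tau> \<circ> inv_into UNIV \<sigma>) (\<sigma> q)"
      using \<tau>(2) permutes_inverses(2) [OF P_permutes [OF \<sigma>]] by simp
    then show ?thesis
      using P_comp [OF \<tau>(1) P_inv [OF \<sigma>]] image_in_index_orbit by metis
  qed
qed

lemma index_orbit_eq: "p \<in> index_orbit q \<Longrightarrow> index_orbit p = index_orbit q"
proof -
  assume "p \<in> index_orbit q"
  then obtain \<sigma> where "\<sigma> \<in> P" "p = \<sigma> q" by (auto simp: index_orbit_def)
  then show ?thesis using index_orbit_image by simp
qed

lemma finite_index_orbit: "q \<in> {1..n} \<Longrightarrow> finite (index_orbit q)"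
  using finite_subset [OF index_orbit_subset] by blast

end

lemma T0_block_iff:
  assumes "finite K" "K \<noteq> {}"
  shows "t \<in> T0_block K \<longleftrightarrow> (\<forall>q\<in>K. cmod (t q) = 1) \<and> (\<forall>q. q \<notin> K \<longrightarrow> t q = 1) \<and> (\<Prod>q\<in>K. t q) = 1"
proof (intro iffI conjI)
  assume "t \<in> T0_block K"
  then obtain u where u: "u \<in> t0_block K" "t = (\<lambda>q. exp (u q))"
    by (auto simp: T0_block_def)
  then show "\<forall>q\<in>K. cmod (t q) = 1" "\<forall>q. q \<notin> K \<longrightarrow> t q = 1"
    by (auto simp: t0_block_def)
  show "(\<Prod>q\<in>K. t q) = 1"
    using u assms(1) exp_sum [of K u] by (simp add: t0_block_def)
next
  assume t: "(\<forall>q\<in>K. cmod (t q) = 1) \<and> (\<forall>q. q \<notin> K \<longrightarrow> t q = 1) \<and> (\<Prod>q\<in>K. t q) = 1"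
  define a where "a q = \<i> * of_real (Arg (t q))" for q
  have exp_a: "exp (a q) = t q" for q
  proof -
    have "cmod (t q) = 1" using t by (cases "q \<in> K") auto
    moreover have "t q \<noteq> 0" using \<open>cmod (t q) = 1\<close> by auto
    ultimately show ?thesis
      using cis_Arg [of "t q"] by (simp add: a_def cis_conv_exp sgn_div_norm)
  qed
  have "exp (\<Sum>q\<in>K. a q) = exp 0"
    using t assms(1) by (simp add: exp_sum exp_a)
  then obtain m where m: "(\<Sum>q\<in>K. a q) = of_real (of_int (2 * m) * pi) * \<i>"
    unfolding exp_eq by auto
  obtain r where r: "r \<in> K" using assms(2) by blast
  \<comment> \<open>The arguments add up to a multiple of \<open>2 * pi\<close>. Removing it at the
    single index \<open>r\<close> makes the sum zero without changing any exponential.\<close>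
  define u where "u q = a q - (if q = r then of_real (of_int (2 * m) * pi) * \<i> else 0)" for q
  have "(\<Sum>q\<in>K. u q) = 0"
    using r assms(1) by (simp add: u_def sum_subtractf sum.delta m)
  moreover have "Re (u q) = 0" for q
    by (simp add: u_def a_def)
  moreover have "u q = 0" if "q \<notin> K" for q
    using that r t by (auto simp: u_def a_def)
  ultimately have "u \<in> t0_block K"
    by (simp add: t0_block_def)
  moreover have "exp (u q) = exp (a q)" for q
    unfolding exp_eq u_def by (intro exI [of _ "if q = r then - m else 0"]) simp
  then have "t = (\<lambda>q. exp (u q))"
    by (simp add: exp_a)
  ultimately show "t \<in> T0_block K"
    by (auto simp: T0_block_def)
qed

context permutation_group
begin

text \<open>Orbit products replace logarithms from here on: membership becomes a multiplicative
  condition, compatible with powers and quotients.\<close>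

lemma T0_iff: "t \<in> T0 n P \<longleftrightarrow> t \<in> full_torus n \<and> (\<forall>q\<in>{1..n}. (\<Prod>p\<in>index_orbit q. t p) = 1)"
proof -
  have block: "(\<lambda>p. if p \<in> index_orbit q then t p else 1) \<in> T0_block (index_orbit q) \<longleftrightarrow>
      (\<forall>p\<in>index_orbit q. cmod (t p) = 1) \<and> (\<Prod>p\<in>index_orbit q. t p) = 1" if "q \<in> {1..n}" for q
  proof -
    have "(\<Prod>p\<in>index_orbit q. if p \<in> index_orbit q then t p else 1) = (\<Prod>p\<in>index_orbit q. t p)"
      by (rule prod.cong) auto
    then show ?thesis
      using self_in_index_orbit [of q] by (subst T0_block_iff [OF finite_index_orbit [OF that]]) auto
  qed
  have "(\<forall>q\<in>{1..n}. \<forall>p\<in>index_orbit q. cmod (t p) = 1) \<longleftrightarrow> (\<forall>q\<in>{1..n}. cmod (t q) = 1)"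
    using self_in_index_orbit index_orbit_subset by blast
  then show ?thesis
    unfolding T0_def full_torus_def index_orbits_eq mem_Collect_eq ball_simps(9)
    using block by blast
qed

end

context linear_coordinates
begin

definition monomial_coords :: "(nat \<Rightarrow> nat) \<Rightarrow> (nat \<Rightarrow> complex) \<Rightarrow> ('v \<Rightarrow> 'v) \<Rightarrow> bool" where
  "monomial_coords \<sigma> t g \<longleftrightarrow> (\<forall>v p. \<phi> (g v) (\<sigma> p) = t p * \<phi> v p)"

definition monomial_op :: "(nat \<Rightarrow> nat) \<Rightarrow> (nat \<Rightarrow> complex) \<Rightarrow> 'v \<Rightarrow> 'v" where
  "monomial_op \<sigma> t v = vec_of (\<lambda>q. t (inv_into UNIV \<sigma> q) * \<phi> v (inv_into UNIV \<sigma> q))"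

lemma monomial_op:
  assumes "\<sigma> permutes {1..n}"
  shows "monomial_coords \<sigma> t (monomial_op \<sigma> t)"
  unfolding monomial_coords_def monomial_op_def coord_vec
  using permutes_in_image [OF assms] permutes_inverses(2) [OF assms]
  by (auto simp: coord_outside simp del: atLeastAtMost_iff)

lemma monomial_coords_inject:
  assumes "\<sigma> permutes {1..n}" "monomial_coords \<sigma> t g" "monomial_coords \<sigma> t g'"
  shows "g = g'"
proof (rule ext, rule vec_eqI)
  fix v q
  have "q = \<sigma> (inv_into UNIV \<sigma> q)"
    using permutes_inverses(1) [OF assms(1)] by simp
  then show "\<phi> (g v) q = \<phi> (g' v) q"
    using assms(2,3) unfolding monomial_coords_def by metis
qed

lemma monomial_coords_comp:
  "monomial_coords \<sigma> t g \<Longrightarrow> monomial_coords \<tau> s h \<Longrightarrow> monomial_coords (\<sigma> \<circ> \<tau>) (\<lambda>p. t (\<tau> p) * s p) (g \<circ> h)"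
  by (simp add: monomial_coords_def mult.assoc)

lemma monomial_coords_unique:
  assumes "monomial_coords \<sigma> t g" "monomial_coords \<sigma>' t' g"
    "\<sigma> permutes {1..n}" "\<sigma>' permutes {1..n}" "t \<in> full_torus n" "t' \<in> full_torus n"
  shows "\<sigma> = \<sigma>'" "t = t'"
proof -
  have "\<sigma>' p = \<sigma> p \<and> t' p = t p" if p: "p \<in> {1..n}" for p
  proof -
    have e: "\<phi> (g (basis_vec p)) (\<sigma> r) = t r * (if r = p then 1 else 0)"
        "\<phi> (g (basis_vec p)) (\<sigma>' r) = t' r * (if r = p then 1 else 0)" for r
      using assms(1,2) coord_basis_vec [OF p] unfolding monomial_coords_def by simp_all
    \<comment> \<open>Both descriptions are compared at coordinate \<open>\<sigma> p\<close> of the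
      image of \<open>basis_vec p\<close>, which is nonzero; \<open>r\<close> is the index from
      which the second description fills that coordinate.\<close>
    define r where "r = inv_into UNIV \<sigma>' (\<sigma> p)"
    have r: "\<sigma>' r = \<sigma> p"
      using permutes_inverses(1) [OF assms(4)] by (simp add: r_def)
    have "t p = t' r * (if r = p then 1 else 0)"
      using e(1) [of p] e(2) [of r] r by simp
    then have "r = p" "t p = t' p"
      using full_torus_nonzero [OF assms(5), of p] by (auto split: if_splits)
    then show ?thesis
      using r by simp
  qed
  then show "\<sigma> = \<sigma>'" "t = t'"
    using assms(3-6) full_torus_off unfolding permutes_def by (metis ext)+
qed

end

text \<open>The data of \<open>realized_by\<close> without \<open>T0 n P \<subseteq> S\<close>.
  Existence is shown by entering the locale first and deriving this inclusion inside it.\<close>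

locale realization = linear_coordinates smul n \<phi> + permutation_group n P
  for smul :: "complex \<Rightarrow> 'v::real_normed_vector \<Rightarrow> 'v" and n \<phi> P +
  fixes S :: "(nat \<Rightarrow> complex) set" and G :: "('v \<Rightarrow> 'v) set"
  assumes torus_S: "is_torus (*) S" and S_subset: "S \<subseteq> full_torus n"
    and S_perm: "\<And>\<sigma>. \<sigma> \<in> P \<Longrightarrow> perm_op \<sigma> ` S \<subseteq> S"
    and G_iff: "\<And>g. g \<in> G \<longleftrightarrow> (\<exists>\<sigma>\<in>P. \<exists>t\<in>S. monomial_coords \<sigma> t g)"

context linear_coordinates
begin

lemma perm_op_conv_monomial_coords:
  assumes "\<sigma> permutes {1..n}"
  shows "\<phi> \<circ> g = (perm_op \<sigma> \<circ> (*) t) \<circ> \<phi> \<longleftrightarrow> monomial_coords \<sigma> t g"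
proof
  assume "\<phi> \<circ> g = (perm_op \<sigma> \<circ> (*) t) \<circ> \<phi>"
  then have "\<phi> (g v) q = t (inv_into UNIV \<sigma> q) * \<phi> v (inv_into UNIV \<sigma> q)" for v q
    by (auto simp: perm_op_def fun_eq_iff)
  then show "monomial_coords \<sigma> t g"
    using permutes_inverses(2) [OF assms] by (simp add: monomial_coords_def)
next
  assume *: "monomial_coords \<sigma> t g"
  show "\<phi> \<circ> g = (perm_op \<sigma> \<circ> (*) t) \<circ> \<phi>"
  proof (intro ext)
    fix v q
    have "\<phi> (g v) (\<sigma> (inv_into UNIV \<sigma> q)) = t (inv_into UNIV \<sigma> q) * \<phi> v (inv_into UNIV \<sigma> q)"
      using * by (simp add: monomial_coords_def)
    then show "(\<phi> \<circ> g) v q = (perm_op \<sigma> \<circ> (*) t \<circ> \<phi>) v q"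
      using permutes_inverses(1) [OF assms] by (simp add: perm_op_def)
  qed
qed

end

lemma realized_by_iff:
  assumes "fin_dim_complex_space smul"
  shows "realized_by smul G n P S \<longleftrightarrow> T0 n P \<subseteq> S \<and> (\<exists>\<phi>. realization smul n \<phi> P S G)"
proof
  assume r: "realized_by smul G n P S"
  then obtain \<phi> where \<phi>: "Vector_Spaces.linear smul (\<lambda>c x q. c * x q) \<phi>" "bij_betw \<phi> UNIV (Cn n)"
      "G = {g. \<exists>h \<in> group_E P S. \<phi> \<circ> g = h \<circ> \<phi>}"
    unfolding realized_by_def by blast
  have E: "construction_E n P S"
    using r by (simp add: realized_by_def)
  interpret linear_coordinates smul n \<phi>
    by (intro linear_coordinates.intro linear_coordinates_axioms.intro assms \<phi>)
  interpret permutation_group n P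
    using E by (intro permutation_group.intro) (simp add: construction_E_def)
  have "g \<in> G \<longleftrightarrow> (\<exists>\<sigma>\<in>P. \<exists>t\<in>S. monomial_coords \<sigma> t g)" for g
    unfolding \<phi>(3) group_E_def using perm_op_conv_monomial_coords [OF P_permutes] by blast
  then have "realization smul n \<phi> P S G"
    using E by (intro realization.intro realization_axioms.intro linear_coordinates_axioms
        permutation_group_axioms) (auto simp: construction_E_def)
  then show "T0 n P \<subseteq> S \<and> (\<exists>\<phi>. realization smul n \<phi> P S G)"
    using E by (auto simp: construction_E_def)
next
  assume *: "T0 n P \<subseteq> S \<and> (\<exists>\<phi>. realization smul n \<phi> P S G)"
  then obtain \<phi> where "realization smul n \<phi> P S G" by blast
  then interpret realization smul n \<phi> P S G .
  have "construction_E n P S"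
    using * torus_S S_subset S_perm subgroup_P by (simp add: construction_E_def)
  moreover have "G = {g. \<exists>h \<in> group_E P S. \<phi> \<circ> g = h \<circ> \<phi>}"
    unfolding group_E_def set_eq_iff G_iff using perm_op_conv_monomial_coords [OF P_permutes] by blast
  ultimately show "realized_by smul G n P S"
    unfolding realized_by_def using linear_coord bij_coord by blast
qed

context realization
begin

lemma S_comp: "\<sigma> \<in> P \<Longrightarrow> t \<in> S \<Longrightarrow> t \<circ> \<sigma> \<in> S"
  using S_perm [OF P_inv, of \<sigma>] permutes_inv_inv [OF P_permutes, of \<sigma>]
  by (auto simp: perm_op_def)

lemma S_mult: "s \<in> S \<Longrightarrow> t \<in> S \<Longrightarrow> s * t \<in> S"
  by (rule torus_mult_closed [OF torus_S])

lemma S_full: "t \<in> S \<Longrightarrow> t \<in> full_torus n"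
  using S_subset by blast

lemma monomial_funpow:
  assumes "\<sigma> \<in> P" "t \<in> S" "monomial_coords \<sigma> t g"
  shows "\<exists>s\<in>S. monomial_coords (\<sigma> ^^ k) s (g ^^ k)"
proof (induction k)
  case 0
  have "monomial_coords (\<sigma> ^^ 0) 1 (g ^^ 0)"
    by (simp add: monomial_coords_def)
  then show ?case
    using one_in_diagonal_torus [OF torus_S S_subset] by blast
next
  case (Suc k)
  then obtain s where s: "s \<in> S" "monomial_coords (\<sigma> ^^ k) s (g ^^ k)" by blast
  have "monomial_coords (\<sigma> ^^ Suc k) (\<lambda>p. t ((\<sigma> ^^ k) p) * s p) (g ^^ Suc k)"
    unfolding funpow.simps by (rule monomial_coords_comp [OF assms(3) s(2)])
  moreover have "(\<lambda>p. t ((\<sigma> ^^ k) p) * s p) = (t \<circ> (\<sigma> ^^ k)) * s"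
    by (simp add: fun_eq_iff)
  ultimately show ?case
    using S_mult [OF S_comp [OF P_funpow [OF assms(1)] assms(2)] s(1)] by metis
qed

lemma diagonal_funpow:
  assumes "monomial_coords id t g"
  shows "monomial_coords id (t ^ k) (g ^^ k)"
proof (induction k)
  case (Suc k)
  from monomial_coords_comp [OF assms this] show ?case
    unfolding power_Suc times_fun_def funpow.simps by (simp only: id_comp id_apply)
qed (simp add: monomial_coords_def)

end

section \<open>Semidirect products of operator groups\<close>

locale semidirect_operators =
  fixes smul :: "complex \<Rightarrow> 'v::real_normed_vector \<Rightarrow> 'v" and G T F :: "('v \<Rightarrow> 'v) set"
  assumes semidirect: "semidirect_product (GL smul) G T F" and finite_F: "finite F"
begin

lemma normal_T: "T \<lhd> GL smul\<lparr>carrier := G\<rparr>"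
  and subgroup_F: "subgroup F (GL smul\<lparr>carrier := G\<rparr>)"
  and subgroup_G: "subgroup G (GL smul)"
  and G_product: "G = F <#>\<^bsub>GL smul\<^esub> T"
  using semidirect unfolding semidirect_product_def by blast+

lemmas subgroup_T = normal_imp_subgroup [OF normal_T]

lemma GL_mult: "x \<otimes>\<^bsub>GL smul\<lparr>carrier := H\<rparr>\<^esub> y = x \<circ> y"
  and GL_one: "\<one>\<^bsub>GL smul\<lparr>carrier := H\<rparr>\<^esub> = id"
  by (simp_all add: GL_def)

interpretation T: normal T "GL smul\<lparr>carrier := G\<rparr>"
  by (rule normal_T)

lemma G_linear: "g \<in> G \<Longrightarrow> Vector_Spaces.linear smul smul g" and G_bij: "g \<in> G \<Longrightarrow> bij g"
  using subgroup.subset [OF subgroup_G] by (auto simp: GL_def)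

lemma F_subset: "F \<subseteq> G"
  using subgroup.subset [OF subgroup_F] by simp

lemma T_subset: "T \<subseteq> G"
  using subgroup.subset [OF subgroup_T] by simp

lemma F_id: "id \<in> F"
  using subgroup.one_closed [OF subgroup_F] by (simp only: GL_one)

lemma T_id: "id \<in> T"
  using subgroup.one_closed [OF subgroup_T] by (simp only: GL_one)

lemma F_comp: "a \<in> F \<Longrightarrow> b \<in> F \<Longrightarrow> a \<circ> b \<in> F"
  using subgroup.m_closed [OF subgroup_F] by (simp only: GL_mult)

lemma T_comp: "a \<in> T \<Longrightarrow> b \<in> T \<Longrightarrow> a \<circ> b \<in> T"
  using subgroup.m_closed [OF subgroup_T] by (simp only: GL_mult)

lemma T_left_inverse: "g \<in> T \<Longrightarrow> \<exists>g'\<in>T. g' \<circ> g = id"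
  using subgroup.m_inv_closed [OF subgroup_T] T.l_inv subgroup.subset [OF subgroup_T]
  unfolding GL_mult GL_one by blast

lemma F_left_inverse: "f \<in> F \<Longrightarrow> \<exists>f'\<in>F. f' \<circ> f = id"
  using subgroup.m_inv_closed [OF subgroup_F] T.l_inv subgroup.subset [OF subgroup_F]
  unfolding GL_mult GL_one by blast

lemma G_iff: "g \<in> G \<longleftrightarrow> (\<exists>f\<in>F. \<exists>t\<in>T. g = f \<circ> t)"
  by (subst G_product) (auto simp: set_mult_def GL_def)

lemma T_normal: "g \<in> G \<Longrightarrow> t \<in> T \<Longrightarrow> \<exists>t'\<in>T. t \<circ> g = g \<circ> t'"
proof -
  assume "g \<in> G" "t \<in> T"
  then have "T #>\<^bsub>GL smul\<lparr>carrier := G\<rparr>\<^esub> g = g <#\<^bsub>GL smul\<lparr>carrier := G\<rparr>\<^esub> T"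
    using T.coset_eq by simp
  then have "t \<circ> g \<in> g <#\<^bsub>GL smul\<lparr>carrier := G\<rparr>\<^esub> T"
    using \<open>t \<in> T\<close> unfolding r_coset_def GL_mult by blast
  then show ?thesis
    unfolding l_coset_def GL_mult by blast
qed

lemma T_normal': "g \<in> G \<Longrightarrow> t \<in> T \<Longrightarrow> \<exists>t'\<in>T. g \<circ> t = t' \<circ> g"
proof -
  assume "g \<in> G" "t \<in> T"
  then have "T #>\<^bsub>GL smul\<lparr>carrier := G\<rparr>\<^esub> g = g <#\<^bsub>GL smul\<lparr>carrier := G\<rparr>\<^esub> T"
    using T.coset_eq by simp
  then have "g \<circ> t \<in> T #>\<^bsub>GL smul\<lparr>carrier := G\<rparr>\<^esub> g"
    using \<open>t \<in> T\<close> unfolding l_coset_def GL_mult by blast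
  then show ?thesis
    unfolding r_coset_def GL_mult by blast
qed

lemma F_exponent: "f \<in> F \<Longrightarrow> f ^^ card F = id"
  using finite_composition_group_exponent [of "GL smul\<lparr>carrier := F\<rparr>" f, OF _ _ GL_mult GL_one]
    finite_F subgroup.subgroup_is_group [OF subgroup_F T.is_group] by simp

text \<open>Modulo the normal subgroup \<open>T\<close> the element equals its
  \<open>F\<close>-part, whose power of order \<open>card F\<close> is trivial. The quotient is
  replaced by moving all factors from \<open>F\<close> to the left.\<close>

lemma power_in_T:
  assumes "x \<in> G"
  shows "x ^^ card F \<in> T"
proof -
  obtain f \<tau> where f: "f \<in> F" "\<tau> \<in> T" "x = f \<circ> \<tau>"
    using assms G_iff by blast
  have F_pow: "f ^^ k \<in> F" for k
  proof (induction k)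
    case 0
    show ?case unfolding funpow.simps by (rule F_id)
  next
    case (Suc k)
    show ?case unfolding funpow.simps by (rule F_comp [OF f(1) Suc])
  qed
  have "\<exists>\<tau>'\<in>T. x ^^ k = (f ^^ k) \<circ> \<tau>'" for k
  proof (induction k)
    case 0
    have "x ^^ 0 = (f ^^ 0) \<circ> id"
      by simp
    then show ?case
      using T_id by blast
  next
    case (Suc k)
    then obtain \<tau>' where \<tau>': "\<tau>' \<in> T" "x ^^ k = (f ^^ k) \<circ> \<tau>'" by blast
    obtain \<tau>'' where \<tau>'': "\<tau>'' \<in> T" "\<tau> \<circ> (f ^^ k) = (f ^^ k) \<circ> \<tau>''"
      using T_normal [of "f ^^ k" \<tau>] F_pow F_subset f(2) by blast
    have "x ^^ Suc k = f \<circ> (\<tau> \<circ> (f ^^ k)) \<circ> \<tau>'"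
    proof -
      have "x ^^ Suc k = x \<circ> ((f ^^ k) \<circ> \<tau>')"
        unfolding funpow.simps \<tau>'(2) ..
      then show ?thesis
        unfolding f(3) by (simp only: comp_assoc)
    qed
    also have "\<dots> = (f ^^ Suc k) \<circ> (\<tau>'' \<circ> \<tau>')"
      unfolding \<tau>''(2) funpow.simps by (simp only: comp_assoc)
    finally show ?case
      using T_comp [OF \<tau>''(1) \<tau>'(1)] by blast
  qed
  then obtain \<tau>' where "\<tau>' \<in> T" "x ^^ card F = (f ^^ card F) \<circ> \<tau>'" by blast
  then show ?thesis
    unfolding F_exponent [OF f(1)] id_comp by simp
qed

end

text \<open>
  Both tori are divisible and have finite index in \<open>G\<close>, so each contains a power of every element
  of the other, that is, every element of the other.
\<close>

lemma (in realization) torus_coordinates: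
  assumes "semidirect_operators smul G T F" and T: "is_torus (\<circ>) T"
  shows "torus_coordinates smul n \<phi> T S"
proof -
  interpret sd: semidirect_operators smul G T F by (rule assms(1))
  have mono_id: "monomial_coords id t g \<longleftrightarrow> (\<forall>v q. \<phi> (g v) q = t q * \<phi> v q)" for t g
    by (simp add: monomial_coords_def)
  have card_P: "0 < card P"
    using P_id finite_P by (auto simp: card_gt_0_iff)
  have card_F: "0 < card F"
    using sd.F_id sd.finite_F by (auto simp: card_gt_0_iff)
  have "\<exists>t\<in>S. monomial_coords id t g" if g: "g \<in> T" for g
  proof -
    \<comment> \<open>The permutation of a root of order \<open>card P\<close> becomes trivial in
      the power \<open>g\<close>, which is therefore diagonal.\<close>
    obtain r where r: "r \<in> T" "r ^^ card P = g"
      using operator_torus_root [OF T g card_P] by blast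
    then obtain \<sigma> t where \<sigma>: "\<sigma> \<in> P" "t \<in> S" "monomial_coords \<sigma> t r"
      using sd.T_subset G_iff by blast
    then show ?thesis
      using monomial_funpow [OF \<sigma>, of "card P"] r(2) P_exponent by metis
  qed
  moreover have "g \<in> T" if t: "t \<in> S" "monomial_coords id t g" for t g
  proof -
    obtain r where r: "r \<in> S" "r ^ card F = t"
      using diagonal_torus_root [OF torus_S t(1) card_F] by blast
    have R: "monomial_coords id r (monomial_op id r)"
      by (rule monomial_op [OF permutes_id])
    then have "monomial_op id r \<in> G"
      using G_iff P_id r(1) by blast
    then have "monomial_op id r ^^ card F \<in> T"
      by (rule sd.power_in_T)
    moreover have "monomial_op id r ^^ card F = g"
      using monomial_coords_inject [OF permutes_id diagonal_funpow [OF R]] t(2) r(2) by metis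
    ultimately show ?thesis by simp
  qed
  ultimately have "T = {g. \<exists>t\<in>S. monomial_coords id t g}" by blast
  then show ?thesis
    unfolding mono_id
    by (intro torus_coordinates.intro torus_coordinates_axioms.intro linear_coordinates_axioms
        torus_S S_subset)
qed

section \<open>Open orbits, centers and irreducibility\<close>

lemma op_orbit_product:
  "op_orbit (F <#>\<^bsub>GL smul\<^esub> H) v = {f (h v) | f h. f \<in> F \<and> h \<in> H}"
  unfolding op_orbit_def set_mult_def GL_def by force

text \<open>\<open>\<i> Im u\<close> and \<open>- \<i> Re u\<close> are both imaginary, and
  \<open>u\<close> is the first plus \<open>\<i>\<close> times the second.\<close>

lemma torus_lieC_full_torus:
  assumes "\<And>q. q \<notin> {1..n} \<Longrightarrow> u q = 0"
  shows "u \<in> torus_lieC n (full_torus n)"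
proof -
  have imaginary: "a \<in> torus_lie n (full_torus n)"
    if "\<And>q. Re (a q) = 0" "\<And>q. q \<notin> {1..n} \<Longrightarrow> a q = 0" for a
    using that by (simp add: torus_lie_def full_torus_def)
  have "u = (\<lambda>q. \<i> * of_real (Im (u q)) + \<i> * (- \<i> * of_real (Re (u q))))"
    by (simp add: fun_eq_iff complex_eq_iff)
  moreover have "(\<lambda>q. \<i> * of_real (Im (u q))) \<in> torus_lie n (full_torus n)"
    "(\<lambda>q. - \<i> * of_real (Re (u q))) \<in> torus_lie n (full_torus n)"
    by (rule imaginary; use assms in simp)+
  ultimately show ?thesis
    unfolding torus_lieC_def mem_Collect_eq
    by (intro exI [of _ "\<lambda>q. \<i> * of_real (Im (u q))"] exI [of _ "\<lambda>q. - \<i> * of_real (Re (u q))"] conjI)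
qed

context realization
begin

text \<open>The orbit of the all-ones vector is the set of vectors without vanishing coordinate:
  logarithms reach all of it, and monomial operators never leave it.\<close>

lemma open_orbit_if_full_torus:
  assumes sd: "semidirect_operators smul G T F" and T: "is_torus (\<circ>) T" and S: "S = full_torus n"
  shows "open (op_orbit (F <#>\<^bsub>GL smul\<^esub> torus_complexification smul T) (vec_of (\<lambda>_. 1)))"
proof -
  interpret sd: semidirect_operators smul G T F by (rule sd)
  interpret torus_coordinates smul n \<phi> T S by (rule torus_coordinates [OF sd T])
  have "op_orbit (F <#>\<^bsub>GL smul\<^esub> torus_complexification smul T) (vec_of (\<lambda>_. 1)) =
      (\<Inter>q\<in>{1..n}. {w. \<phi> w q \<noteq> 0})"
  proof (intro equalityI subsetI)
    fix w assume "w \<in> op_orbit (F <#>\<^bsub>GL smul\<^esub> torus_complexification smul T) (vec_of (\<lambda>_. 1))"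
    then obtain f h where fh: "f \<in> F" "h \<in> torus_complexification smul T" "w = f (h (vec_of (\<lambda>_. 1)))"
      unfolding op_orbit_product by blast
    obtain u where u: "\<And>v q. \<phi> (h v) q = exp (u q) * \<phi> v q"
      using fh(2) torus_complexification_iff by blast
    obtain \<sigma> t where \<sigma>: "\<sigma> \<in> P" "t \<in> S" "monomial_coords \<sigma> t f"
      using fh(1) sd.F_subset G_iff by blast
    have "\<phi> w q \<noteq> 0" if q: "q \<in> {1..n}" for q
    proof -
      define p where "p = inv_into UNIV \<sigma> q"
      have p: "\<sigma> p = q"
        using permutes_inverses(1) [OF P_permutes [OF \<sigma>(1)]] by (simp add: p_def)
      then have "p \<in> {1..n}"
        using permutes_in_image [OF P_permutes [OF \<sigma>(1)], of p] q by simp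
      moreover have "\<phi> w (\<sigma> p) = t p * (exp (u p) * \<phi> (vec_of (\<lambda>_. 1)) p)"
        using \<sigma>(3) u unfolding monomial_coords_def fh(3) by simp
      ultimately show ?thesis
        using full_torus_nonzero [OF S_full [OF \<sigma>(2)], of p] p by (simp add: coord_vec)
    qed
    then show "w \<in> (\<Inter>q\<in>{1..n}. {w. \<phi> w q \<noteq> 0})" by blast
  next
    fix w assume w: "w \<in> (\<Inter>q\<in>{1..n}. {w. \<phi> w q \<noteq> 0})"
    define u where "u q = (if q \<in> {1..n} then Ln (\<phi> w q) else 0)" for q
    have "u \<in> torus_lieC n S"
      unfolding S by (rule torus_lieC_full_torus) (auto simp: u_def)
    define h where "h v = vec_of (\<lambda>q. exp (u q) * \<phi> v q)" for v
    have "\<phi> (h v) q = exp (u q) * \<phi> v q" for v q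
      by (auto simp: h_def coord_vec coord_outside)
    then have "h \<in> torus_complexification smul T"
      unfolding torus_complexification_iff using \<open>u \<in> torus_lieC n S\<close> by blast
    moreover have "w = id (h (vec_of (\<lambda>_. 1)))"
      by (rule vec_eqI) (use w in \<open>auto simp: h_def coord_vec u_def\<close>)
    ultimately show "w \<in> op_orbit (F <#>\<^bsub>GL smul\<^esub> torus_complexification smul T) (vec_of (\<lambda>_. 1))"
      unfolding op_orbit_product using sd.F_id by blast
  qed
  moreover have "open (\<Inter>q\<in>{1..n}. {w. \<phi> w q \<noteq> 0})"
    by (intro open_INT ballI open_Collect_neq continuous_on_coord continuous_on_const) simp
  ultimately show ?thesis by simp
qed

text \<open>For given \<open>t\<close> the segment runs in the direction of its logarithm. Different
  points of the segment may need different elements of \<open>F\<close>; these form the finite index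
  set of the counting argument, which selects a single one.\<close>

lemma full_torus_if_open_orbit:
  assumes sd: "semidirect_operators smul G T F" and T: "is_torus (\<circ>) T"
    and "open": "open (op_orbit (F <#>\<^bsub>GL smul\<^esub> torus_complexification smul T) v)" (is "open ?U")
  shows "S = full_torus n"
proof (intro equalityI S_subset subsetI)
  interpret sd: semidirect_operators smul G T F by (rule sd)
  interpret torus_coordinates smul n \<phi> T S by (rule torus_coordinates [OF sd T])
  fix t assume "t \<in> full_torus n"
  then obtain \<theta> where \<theta>: "\<And>q. t q = cis (\<theta> q)" "\<And>q. q \<notin> {1..n} \<Longrightarrow> \<theta> q = 0"
    by (rule full_torus_log) blast
  define \<beta> where "\<beta> q = \<i> * of_real (\<theta> q)" for q
  have "\<exists>\<sigma> s. \<sigma> \<in> P \<and> s \<in> S \<and> monomial_coords \<sigma> s f" if "f \<in> F" for f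
    using that sd.F_subset G_iff by blast
  then obtain \<sigma> s where \<sigma>: "\<And>f. f \<in> F \<Longrightarrow> \<sigma> f \<in> P \<and> s f \<in> S \<and> monomial_coords (\<sigma> f) (s f) f"
    by metis
  have "id \<in> torus_complexification smul T"
  proof -
    have "(\<lambda>q. 0 + \<i> * 0) \<in> torus_lieC n S"
      unfolding torus_lieC_def mem_Collect_eq using torus_lie_zero [OF torus_S S_subset]
      by (intro exI [of _ "\<lambda>q. 0"] conjI refl)
    then show ?thesis
      unfolding torus_complexification_iff by (intro bexI) auto
  qed
  then have "?U \<noteq> {}"
    unfolding op_orbit_product using sd.F_id by blast
  then obtain \<omega> where \<omega>: "\<And>\<beta>. \<exists>\<epsilon>>0. \<forall>s::real. \<bar>s\<bar> < \<epsilon> \<longrightarrow> vec_of (\<lambda>q. exp (\<omega> q + of_real s * \<beta> q)) \<in> ?U"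
    by (rule open_contains_exp_lines [OF "open"]) blast
  then obtain \<epsilon> where \<epsilon>: "0 < \<epsilon>" "\<And>x::real. \<bar>x\<bar> < \<epsilon> \<Longrightarrow> vec_of (\<lambda>q. exp (\<omega> q + of_real x * \<beta> q)) \<in> ?U"
    by blast
  \<comment> \<open>This is what remains of the exponent at index \<open>\<sigma> f q\<close> after
    the coefficient of \<open>f\<close> and the vector \<open>v\<close> are divided out. The
    logarithm is a true one wherever it is used: a point of the segment has no zero coordinate, so
    \<open>s f q * \<phi> v q\<close> is nonzero.\<close>
  define \<alpha> where "\<alpha> f q = \<omega> (\<sigma> f q) - Ln (s f q * \<phi> v q)" for f q
  have "\<exists>f\<in>F. (\<lambda>q. \<beta> (\<sigma> f q)) \<in> torus_lieC n S"
  proof (rule exp_line_in_subspace [where J = F and \<alpha> = \<alpha> and \<beta> = "\<lambda>f q. \<beta> (\<sigma> f q)" and \<epsilon> = \<epsilon>])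
    show "\<beta> (\<sigma> f q) = 0" if "f \<in> F" "q \<notin> {1..n}" for f q
      using permutes_not_in [OF P_permutes, of "\<sigma> f" q] \<sigma> [OF that(1)] that(2) \<theta>(2) [of q]
      by (simp add: \<beta>_def del: atLeastAtMost_iff)
    fix x :: real assume "\<bar>x\<bar> < \<epsilon>"
    then obtain f h where fh: "f \<in> F" "h \<in> torus_complexification smul T"
        "vec_of (\<lambda>q. exp (\<omega> q + of_real x * \<beta> q)) = f (h v)"
      using \<epsilon>(2) unfolding op_orbit_product by blast
    obtain u where u: "u \<in> torus_lieC n S" "\<And>v q. \<phi> (h v) q = exp (u q) * \<phi> v q"
      using fh(2) torus_complexification_iff by blast
    have "exp (\<alpha> f q + of_real x * \<beta> (\<sigma> f q)) = exp (u q)" if q: "q \<in> {1..n}" for q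
    proof -
      have "\<sigma> f q \<in> {1..n}"
        using permutes_in_image [OF P_permutes, of "\<sigma> f" q] \<sigma> [OF fh(1)] q by blast
      then have "exp (\<omega> (\<sigma> f q) + of_real x * \<beta> (\<sigma> f q)) = \<phi> (f (h v)) (\<sigma> f q)"
        unfolding fh(3) [symmetric] coord_vec by simp
      also have "\<dots> = s f q * \<phi> v q * exp (u q)"
        using \<sigma> [OF fh(1)] u(2) by (simp add: monomial_coords_def)
      finally have *: "exp (\<omega> (\<sigma> f q) + of_real x * \<beta> (\<sigma> f q)) = s f q * \<phi> v q * exp (u q)" .
      then have "s f q * \<phi> v q \<noteq> 0"
        by (metis exp_not_eq_zero mult_eq_0_iff)
      then show ?thesis
        using * by (simp add: \<alpha>_def exp_add exp_diff field_simps)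
    qed
    then show "\<exists>f\<in>F. \<exists>u\<in>torus_lieC n S. \<forall>q\<in>{1..n}. exp (\<alpha> f q + of_real x * \<beta> (\<sigma> f q)) = exp (u q)"
      using fh(1) u(1) by blast
  qed (use torus_lieC_diff [OF torus_S] torus_lieC_scale torus_lieC_off sd.finite_F \<epsilon>(1) in
      \<open>auto intro: countable_finite simp del: atLeastAtMost_iff\<close>)
  then obtain f where f: "f \<in> F" "(\<lambda>q. \<beta> (\<sigma> f q)) \<in> torus_lieC n S" by blast
  then have "(\<lambda>q. \<beta> (\<sigma> f q)) \<in> torus_lie n S"
    by (intro torus_lieC_imaginary) (auto simp: \<beta>_def)
  then have "(\<lambda>q. exp (\<beta> (\<sigma> f q))) \<in> S"
    by (rule exp_torus_lie)
  \<comment> \<open>The argument yields \<open>t\<close> only up to the permutation of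
    \<open>f\<close>; invariance of \<open>S\<close> removes it.\<close>
  then have "(\<lambda>q. exp (\<beta> (\<sigma> f q))) \<circ> inv_into UNIV (\<sigma> f) \<in> S"
    using S_comp [OF P_inv] \<sigma> [OF f(1)] by blast
  moreover have "(\<lambda>q. exp (\<beta> (\<sigma> f q))) \<circ> inv_into UNIV (\<sigma> f) = t"
    using permutes_inverses(1) [OF P_permutes, of "\<sigma> f"] \<sigma> [OF f(1)]
    by (simp add: fun_eq_iff \<beta>_def \<theta>(1) cis_conv_exp)
  ultimately show "t \<in> S" by simp
qed

text \<open>The pure permutations belong to \<open>G\<close>, and commuting with them makes the
  coefficients of a central element constant on orbits. An orbit product equal to 1 then says that
  each coefficient is a root of unity, so there are finitely many choices.\<close>

lemma center_finite_if_T0: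
  assumes S: "S = T0 n P"
  shows "finite (center_of (GL smul) G)"
proof -
  \<comment> \<open>The factorial of \<open>n\<close> is a common multiple of all orbit
    lengths.\<close>
  define R where "R = {z :: complex. z ^ fact n = 1}"
  define C where "C = {c \<in> full_torus n. \<forall>q\<in>{1..n}. c q \<in> R}"
  have "finite R"
    unfolding R_def by (rule finite_roots_unity) simp
  have "finite C"
  proof (rule finite_subset)
    show "C \<subseteq> {c. \<forall>q. (q \<in> {1..n} \<longrightarrow> c q \<in> R) \<and> (q \<notin> {1..n} \<longrightarrow> c q = 1)}"
      by (auto simp: C_def full_torus_def)
    show "finite {c. \<forall>q. (q \<in> {1..n} \<longrightarrow> c q \<in> R) \<and> (q \<notin> {1..n} \<longrightarrow> c q = 1)}"
      by (rule finite_set_of_finite_funs) (use \<open>finite R\<close> in auto)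
  qed
  have "center_of (GL smul) G \<subseteq> (\<lambda>(\<sigma>, t). monomial_op \<sigma> t) ` (P \<times> C)"
  proof
    fix z assume z: "z \<in> center_of (GL smul) G"
    then obtain \<sigma> t where \<sigma>: "\<sigma> \<in> P" "t \<in> S" "monomial_coords \<sigma> t z"
      using G_iff unfolding center_of_def by blast
    have t: "t \<in> full_torus n" by (rule S_full [OF \<sigma>(2)])
    have inv: "t (\<tau> p) = t p" if \<tau>: "\<tau> \<in> P" for \<tau> p
    proof -
      have m: "monomial_coords \<tau> 1 (monomial_op \<tau> 1)"
        by (rule monomial_op [OF P_permutes [OF \<tau>]])
      then have "monomial_op \<tau> 1 \<in> G"
        using G_iff \<tau> one_in_diagonal_torus [OF torus_S S_subset] by blast
      then have "z \<circ> monomial_op \<tau> 1 = monomial_op \<tau> 1 \<circ> z"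
        using z by (simp add: center_of_def GL_def)
      then have "monomial_coords (\<tau> \<circ> \<sigma>) (\<lambda>p. 1 (\<sigma> p) * t p) (z \<circ> monomial_op \<tau> 1)"
        using monomial_coords_comp [OF m \<sigma>(3)] by simp
      then have "(\<lambda>p. t (\<tau> p) * 1 p) = (\<lambda>p. 1 (\<sigma> p) * t p)"
        using monomial_coords_unique(2) [OF monomial_coords_comp [OF \<sigma>(3) m]]
          P_permutes [OF P_comp [OF \<sigma>(1) \<tau>]] P_permutes [OF P_comp [OF \<tau> \<sigma>(1)]]
          S_full [OF S_comp [OF \<tau> \<sigma>(2)]] t
        by (simp add: comp_def)
      then show ?thesis
        by (auto dest: fun_cong [of _ _ p])
    qed
    have "t q ^ fact n = 1" if q: "q \<in> {1..n}" for q
    proof -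
      have "(\<Prod>p\<in>index_orbit q. t p) = 1"
        using \<sigma>(2) q unfolding S T0_iff by blast
      moreover have "(\<Prod>p\<in>index_orbit q. t p) = (\<Prod>p\<in>index_orbit q. t q)"
        by (rule prod.cong) (auto simp: index_orbit_def inv)
      ultimately have "t q ^ card (index_orbit q) = 1" by simp
      moreover have "card (index_orbit q) dvd fact n"
      proof (rule dvd_fact)
        show "1 \<le> card (index_orbit q)"
          using finite_index_orbit [OF q] self_in_index_orbit [of q] by (auto simp: Suc_le_eq card_gt_0_iff)
        show "card (index_orbit q) \<le> n"
          using card_mono [OF finite_atLeastAtMost index_orbit_subset [OF q]] by simp
      qed
      ultimately show ?thesis
        by (metis dvd_def power_mult power_one)
    qed
    then have "t \<in> C"
      using t by (simp add: C_def R_def)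
    moreover have "z = monomial_op \<sigma> t"
      using monomial_coords_inject [OF P_permutes [OF \<sigma>(1)] \<sigma>(3)] monomial_op P_permutes [OF \<sigma>(1)] by blast
    ultimately show "z \<in> (\<lambda>(\<sigma>, t). monomial_op \<sigma> t) ` (P \<times> C)"
      using \<sigma>(1) by force
  qed
  then show ?thesis
    by (rule finite_subset) (simp add: finite_P \<open>finite C\<close>)
qed

lemma T0_if_center_finite:
  assumes T0: "T0 n P \<subseteq> S" and fin: "finite (center_of (GL smul) G)"
  shows "S = T0 n P"
proof (intro equalityI T0 subsetI)
  \<comment> \<open>The invariant elements of \<open>S\<close>; as diagonal operators they commute
    with every monomial operator of \<open>G\<close>.\<close>
  define C where "C = {c \<in> S. \<forall>\<sigma>\<in>P. c \<circ> \<sigma> = c}"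
  have "monomial_op id ` C \<subseteq> center_of (GL smul) G"
  proof safe
    fix c assume c: "c \<in> C"
    have m: "monomial_coords id c (monomial_op id c)"
      by (rule monomial_op [OF permutes_id])
    have "monomial_op id c \<circ> g = g \<circ> monomial_op id c" if g: "g \<in> G" for g
    proof -
      obtain \<sigma> t where \<sigma>: "\<sigma> \<in> P" "t \<in> S" "monomial_coords \<sigma> t g"
        using g G_iff by blast
      have "monomial_coords \<sigma> (\<lambda>p. c (\<sigma> p) * t p) (monomial_op id c \<circ> g)"
        using monomial_coords_comp [OF m \<sigma>(3)] by (simp only: id_comp)
      moreover have "monomial_coords \<sigma> (\<lambda>p. t p * c p) (g \<circ> monomial_op id c)"
        using monomial_coords_comp [OF \<sigma>(3) m] by (simp only: comp_id id_apply)
      moreover have "(\<lambda>p. c (\<sigma> p) * t p) = (\<lambda>p. t p * c p)"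
      proof -
        have "c (\<sigma> p) = c p" for p
          using c \<sigma>(1) by (metis (mono_tags, lifting) C_def comp_apply mem_Collect_eq)
        then show ?thesis by (simp add: mult.commute)
      qed
      ultimately show ?thesis
        using monomial_coords_inject [OF P_permutes [OF \<sigma>(1)]] by metis
    qed
    moreover have "monomial_op id c \<in> G"
      using G_iff P_id m c unfolding C_def by blast
    ultimately show "monomial_op id c \<in> center_of (GL smul) G"
      by (simp add: center_of_def GL_def)
  qed
  moreover have "inj_on (monomial_op id) C"
  proof (rule inj_onI)
    fix c d assume "c \<in> C" "d \<in> C" "monomial_op id c = monomial_op id d"
    then show "c = d"
      using monomial_coords_unique(2) [of id c "monomial_op id c" id d] monomial_op [OF permutes_id]
        S_full permutes_id unfolding C_def by (metis (mono_tags, lifting) mem_Collect_eq)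
  qed
  ultimately have "finite C"
    using fin finite_subset finite_imageD by metis
  \<comment> \<open>Among the powers of \<open>c\<close> with exponents \<open>0..card C\<close> two
    coincide, so \<open>c\<close> has an order at most \<open>card C\<close>, which divides this
    factorial.\<close>
  define m where "m = (fact (card C) :: nat)"
  have exponent: "c ^ m = 1" if c: "c \<in> C" for c
  proof -
    have "c ^ i \<in> C" for i
      using c power_in_diagonal_torus [OF torus_S S_subset, of c i]
      by (auto simp: C_def fun_eq_iff power_fun_apply)
    then have "(\<lambda>i. c ^ i) ` {0..card C} \<subseteq> C" by blast
    then have "\<not> inj_on (\<lambda>i. c ^ i) {0..card C}"
      using card_inj_on_le [of "\<lambda>i. c ^ i" "{0..card C}" C] \<open>finite C\<close> by fastforce
    then obtain i j where ij: "i < j" "j \<le> card C" "c ^ i = c ^ j"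
      unfolding inj_on_def by (metis atLeastAtMost_iff linorder_neqE_nat)
    have "c q ^ (j - i) = 1" for q
    proof -
      have "c q ^ i * c q ^ (j - i) = c q ^ i * 1"
        unfolding power_add [symmetric] using fun_cong [OF ij(3), of q] ij(1) by (simp add: power_fun_apply)
      moreover have "c q \<noteq> 0"
        using full_torus_nonzero [OF S_full] c by (simp add: C_def)
      ultimately show ?thesis by simp
    qed
    moreover have "j - i dvd m"
      unfolding m_def by (rule dvd_fact) (use ij in auto)
    ultimately have "c q ^ m = 1" for q
      by (metis dvd_def power_mult power_one)
    then show ?thesis
      by (simp add: fun_eq_iff power_fun_apply)
  qed
  fix t assume t: "t \<in> S"
  \<comment> \<open>The root is taken before the passage to an invariant element: orbit products of
    \<open>t\<close> are then powers with exponent \<open>m\<close> of those of \<open>r\<close>,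
    and \<open>m\<close> kills every invariant element.\<close>
  obtain r where r: "r \<in> S" "r ^ m = t"
    using diagonal_torus_root [OF torus_S t, of m] by (auto simp: m_def)
  \<comment> \<open>A root of order \<open>card K\<close> of the product over \<open>K\<close>. The
    function that takes this constant value on each orbit has the same orbit products as
    \<open>r\<close>, so it differs from \<open>r\<close> by an element of
    \<open>T0 n P\<close>.\<close>
  define c where "c K = cis (Arg (\<Prod>p\<in>K. r p) / card K)" for K
  define z where "z q = (if q \<in> {1..n} then c (index_orbit q) else 1)" for q
  have z_orbit: "(\<Prod>p\<in>index_orbit q. z p) = (\<Prod>p\<in>index_orbit q. r p)" and
    z_const: "\<And>p. p \<in> index_orbit q \<Longrightarrow> z p = z q" if q: "q \<in> {1..n}" for q
  proof -
    show zc: "z p = z q" if "p \<in> index_orbit q" for p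
      using index_orbit_subset [OF q] index_orbit_eq [OF that] q that by (auto simp: z_def)
    have card: "0 < card (index_orbit q)"
      using finite_index_orbit [OF q] self_in_index_orbit [of q] by (auto simp: card_gt_0_iff)
    have unit: "cmod (\<Prod>p\<in>index_orbit q. r p) = 1"
      using full_torus_cmod [OF S_full [OF r(1)]] by (simp add: prod_norm [symmetric])
    then have nz: "(\<Prod>p\<in>index_orbit q. r p) \<noteq> 0" by force
    have "(\<Prod>p\<in>index_orbit q. z p) = z q ^ card (index_orbit q)"
      using prod.cong [OF refl zc] by simp
    also have "\<dots> = cis (Arg (\<Prod>p\<in>index_orbit q. r p))"
      using q card by (simp add: z_def c_def Complex.DeMoivre)
    also have "\<dots> = (\<Prod>p\<in>index_orbit q. r p)"
      using cis_Arg [OF nz] unit by (simp add: sgn_div_norm)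
    finally show "(\<Prod>p\<in>index_orbit q. z p) = (\<Prod>p\<in>index_orbit q. r p)" .
  qed
  have "z \<in> full_torus n"
    by (auto simp: full_torus_def z_def c_def)
  have "(\<lambda>q. z q / r q) \<in> T0 n P"
    unfolding T0_iff
  proof (intro conjI ballI)
    show "(\<lambda>q. z q / r q) \<in> full_torus n"
      using \<open>z \<in> full_torus n\<close> S_full [OF r(1)] by (auto simp: full_torus_def norm_divide)
    fix q assume q: "q \<in> {1..n}"
    have "(\<Prod>p\<in>index_orbit q. r p) \<noteq> 0"
      using full_torus_nonzero [OF S_full [OF r(1)]] finite_index_orbit [OF q] by simp
    then show "(\<Prod>p\<in>index_orbit q. z p / r p) = 1"
      by (simp add: prod_dividef z_orbit [OF q])
  qed
  then have "r * (\<lambda>q. z q / r q) \<in> S"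
    using S_mult [OF r(1)] T0 by blast
  moreover have "r * (\<lambda>q. z q / r q) = z"
    using full_torus_nonzero [OF S_full [OF r(1)]] by (simp add: fun_eq_iff)
  ultimately have "z \<in> S" by simp
  moreover have "z \<circ> \<sigma> = z" if "\<sigma> \<in> P" for \<sigma>
  proof
    fix q
    show "(z \<circ> \<sigma>) q = z q"
      using z_const [of q] image_in_index_orbit [OF that, of q] permutes_not_in [OF P_permutes [OF that], of q]
      by (cases "q \<in> {1..n}") (auto simp del: atLeastAtMost_iff)
  qed
  ultimately have "z ^ m = 1"
    by (intro exponent) (simp add: C_def)
  then have zm: "z q ^ m = 1" for q
    by (metis one_fun_apply power_fun_apply)
  show "t \<in> T0 n P"
    unfolding T0_iff
  proof (intro conjI ballI)
    show "t \<in> full_torus n" by (rule S_full [OF t])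
    fix q assume q: "q \<in> {1..n}"
    have "(\<Prod>p\<in>index_orbit q. t p) = (\<Prod>p\<in>index_orbit q. r p) ^ m"
      by (simp add: r(2) [symmetric] power_fun_apply prod_power_distrib)
    also have "\<dots> = (\<Prod>p\<in>index_orbit q. z p ^ m)"
      by (simp add: z_orbit [OF q, symmetric] prod_power_distrib)
    also have "\<dots> = 1"
      by (simp add: zm)
    finally show "(\<Prod>p\<in>index_orbit q. t p) = 1" .
  qed
qed

text \<open>The vectors supported on one orbit of indices form a nonzero invariant subspace.\<close>

lemma irreducible_transitive:
  assumes irr: "irreducible_on smul G" and q: "q \<in> {1..n}"
  shows "index_orbit q = {1..n}"
proof -
  define W where "W = {v. \<forall>p. p \<notin> index_orbit q \<longrightarrow> \<phi> v p = 0}"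
  have "subspace W"
    by (rule subspaceI) (auto simp: W_def coord_zero coord_add coord_smul)
  moreover have "g ` W \<subseteq> W" if "g \<in> G" for g
  proof safe
    fix v assume v: "v \<in> W"
    obtain \<sigma> t where \<sigma>: "\<sigma> \<in> P" "t \<in> S" "monomial_coords \<sigma> t g"
      using \<open>g \<in> G\<close> G_iff by blast
    have "\<phi> (g v) p = 0" if p: "p \<notin> index_orbit q" for p
    proof -
      define r where "r = inv_into UNIV \<sigma> p"
      have r: "\<sigma> r = p"
        using permutes_inverses(1) [OF P_permutes [OF \<sigma>(1)]] by (simp add: r_def)
      have "r \<notin> index_orbit q"
        using p image_in_index_orbit [OF \<sigma>(1), of r] index_orbit_eq [of r q] r by auto
      then have "\<phi> (g v) (\<sigma> r) = 0"
        using v \<sigma>(3) by (simp add: W_def monomial_coords_def)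
      then show ?thesis by (simp add: r)
    qed
    then show "g v \<in> W" by (simp add: W_def)
  qed
  ultimately have "W = {0} \<or> W = UNIV"
    using irr unfolding irreducible_on_def by blast
  moreover have "basis_vec q \<in> W"
    using self_in_index_orbit [of q] by (auto simp: W_def coord_basis_vec [OF q])
  moreover have "basis_vec q \<noteq> 0"
    using coord_basis_vec [OF q, of q] coord_zero [of q] by auto
  ultimately have W: "W = UNIV" by blast
  have "p \<in> index_orbit q" if p: "p \<in> {1..n}" for p
  proof (rule ccontr)
    assume "p \<notin> index_orbit q"
    then have "\<phi> (basis_vec p) p = 0"
      using W unfolding W_def by blast
    then show False
      by (simp add: coord_basis_vec [OF p])
  qed
  then show ?thesis
    using index_orbit_subset [OF q] by blast
qed

text \<open>
  The torus is connected, so if the product of coordinates is not constantly 1 on it, the image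
  contains an arc of the circle at 1, hence the whole circle.
\<close>

lemma product_surjective:
  assumes t: "t \<in> S" "(\<Prod>q\<in>{1..n}. t q) \<noteq> 1" and w: "cmod w = 1"
  obtains s where "s \<in> S" "(\<Prod>q\<in>{1..n}. s q) = w"
proof -
  define \<Delta> where "\<Delta> s = (\<Prod>q\<in>{1..n}. s q)" for s :: "nat \<Rightarrow> complex"
  have \<Delta>_cmod: "cmod (\<Delta> s) = 1" if "s \<in> S" for s
    using full_torus_cmod [OF S_full [OF that]] by (simp add: \<Delta>_def prod_norm [symmetric])
  obtain k h where h: "continuous_on (full_torus k) h" "bij_betw h (full_torus k) S"
      "\<And>s t. s \<in> full_torus k \<Longrightarrow> t \<in> full_torus k \<Longrightarrow> h (s * t) = h s * h t"
    using torus_S unfolding is_torus_def by blast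
  have h_S: "h s \<in> S" if "s \<in> full_torus k" for s
    using h(2) that by (auto simp: bij_betw_def)
  obtain t' where t': "t' \<in> full_torus k" "h t' = t"
    using h(2) t(1) unfolding bij_betw_def by (metis imageE)
  obtain \<theta> where \<theta>: "\<And>q. t' q = cis (\<theta> q)" "\<And>q. q \<notin> {1..k} \<Longrightarrow> \<theta> q = 0"
    by (rule full_torus_log [OF t'(1)]) blast
  \<comment> \<open>A path in the parametrizing torus from 1 to \<open>t'\<close>; scaling the
    angles replaces an appeal to connectedness.\<close>
  define \<gamma> where "\<gamma> x q = cis (x * \<theta> q)" for x q
  have \<gamma>: "\<gamma> x \<in> full_torus k" for x
    using \<theta>(2) by (simp add: full_torus_def \<gamma>_def)
  have "continuous_on UNIV \<gamma>"
    unfolding \<gamma>_def cis_conv_exp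
    by (rule continuous_on_coordinatewise_then_product) (intro continuous_intros)
  then have "continuous_on UNIV (\<lambda>x. h (\<gamma> x))"
    by (rule continuous_on_compose2 [OF h(1)]) (use \<gamma> in auto)
  then have cont: "continuous_on UNIV (\<lambda>x. Re (\<Delta> (h (\<gamma> x))))"
    unfolding \<Delta>_def
    by (rule continuous_on_Re [OF continuous_on_prod [OF continuous_on_product_then_coordinatewise]])
  have "\<gamma> 1 = t'"
    by (simp add: \<gamma>_def \<theta>(1) fun_eq_iff)
  have "\<gamma> 0 = 1"
    by (simp add: \<gamma>_def fun_eq_iff)
  have "h 1 = 1"
  proof -
    have "h 1 = h 1 * h 1"
      using h(3) [OF one_in_full_torus one_in_full_torus] by simp
    then have "h 1 q = h 1 q * h 1 q" for q
      by (metis times_fun_apply)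
    then have "h 1 q = 1" for q
      using full_torus_nonzero [OF S_full [OF h_S [OF one_in_full_torus]]] by (metis mult_cancel_right1)
    then show ?thesis by (simp add: fun_eq_iff)
  qed
  define a where "a = Re (\<Delta> t)"
  have "a < 1"
  proof (rule ccontr)
    assume "\<not> a < 1"
    moreover have "a \<le> cmod (\<Delta> t)" "(cmod (\<Delta> t))\<^sup>2 = a\<^sup>2 + (Im (\<Delta> t))\<^sup>2"
      unfolding a_def by (rule complex_Re_le_cmod) (rule cmod_power2)
    ultimately have "a = 1" "Im (\<Delta> t) = 0"
      using \<Delta>_cmod [OF t(1)] by auto
    then have "\<Delta> t = 1"
      by (simp add: a_def complex_eq_iff)
    then show False
      using t(2) by (simp add: \<Delta>_def)
  qed
  \<comment> \<open>The angle of \<open>w\<close> is divided by \<open>N + 1\<close> so finely that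
    its cosine exceeds \<open>a\<close>. The real part along the path goes from 1 to
    \<open>a\<close> and therefore takes this cosine as a value.\<close>
  define \<psi> where "\<psi> = Arg w"
  have "(\<lambda>N. cos (\<psi> / real (Suc N))) \<longlonglongrightarrow> cos 0"
    by (intro tendsto_cos LIMSEQ_Suc lim_const_over_n)
  then have "\<forall>\<^sub>F N in sequentially. a < cos (\<psi> / real (Suc N))"
    using \<open>a < 1\<close> by (auto intro: order_tendstoD)
  then obtain N where N: "a < cos (\<psi> / real (Suc N))"
    using eventually_happens' [OF sequentially_bot] by blast
  have "\<exists>x\<ge>0. x \<le> 1 \<and> Re (\<Delta> (h (\<gamma> x))) = cos (\<psi> / real (Suc N))"
  proof (rule IVT2')
    show "Re (\<Delta> (h (\<gamma> 1))) \<le> cos (\<psi> / real (Suc N))"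
      using N by (simp add: \<open>\<gamma> 1 = t'\<close> t'(2) a_def)
    show "cos (\<psi> / real (Suc N)) \<le> Re (\<Delta> (h (\<gamma> 0)))"
      unfolding \<open>\<gamma> 0 = 1\<close> \<open>h 1 = 1\<close> by (simp add: \<Delta>_def del: of_nat_Suc)
  qed (use continuous_on_subset [OF cont] in auto)
  then obtain x where x: "Re (\<Delta> (h (\<gamma> x))) = cos (\<psi> / real (Suc N))" by blast
  have hx: "h (\<gamma> x) \<in> S" by (rule h_S [OF \<gamma>])
  have "\<exists>y\<in>S. \<Delta> y = cis (\<psi> / real (Suc N))"
  proof -
    \<comment> \<open>On the unit circle the real part determines a point up to conjugation, and in
      the conjugate case the inverse torus element has the desired product. Its power of exponent
      \<open>Suc N\<close> then reaches \<open>w\<close>.\<close>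
    have "(Im (\<Delta> (h (\<gamma> x))))\<^sup>2 = (sin (\<psi> / real (Suc N)))\<^sup>2"
      using cmod_power2 [of "\<Delta> (h (\<gamma> x))"] \<Delta>_cmod [OF hx] x
        sin_squared_eq [of "\<psi> / real (Suc N)"] by (simp del: of_nat_Suc)
    then consider "Im (\<Delta> (h (\<gamma> x))) = sin (\<psi> / real (Suc N))" | "Im (\<Delta> (h (\<gamma> x))) = - sin (\<psi> / real (Suc N))"
      unfolding power2_eq_iff by blast
    then show ?thesis
    proof cases
      case 1
      then have "\<Delta> (h (\<gamma> x)) = cis (\<psi> / real (Suc N))"
        using x by (simp add: complex_eq_iff del: of_nat_Suc)
      then show ?thesis using hx by blast
    next
      case 2
      then have "\<Delta> (h (\<gamma> x)) = cnj (cis (\<psi> / real (Suc N)))"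
        using x by (simp add: complex_eq_iff del: of_nat_Suc)
      moreover have "\<Delta> (\<lambda>q. inverse (h (\<gamma> x) q)) = inverse (\<Delta> (h (\<gamma> x)))"
        unfolding \<Delta>_def using prod_inversef [of "h (\<gamma> x)" "{1..n}"] by (simp add: comp_def)
      ultimately have "\<Delta> (\<lambda>q. inverse (h (\<gamma> x) q)) = cis (\<psi> / real (Suc N))"
        by (simp add: cis_cnj del: of_nat_Suc)
      then show ?thesis
        using inverse_in_diagonal_torus [OF torus_S S_subset hx] by blast
    qed
  qed
  then obtain y where y: "y \<in> S" "\<Delta> y = cis (\<psi> / real (Suc N))" by blast
  have "\<Delta> (y ^ Suc N) = \<Delta> y ^ Suc N"
    unfolding \<Delta>_def power_fun_apply by (rule prod_power_distrib [symmetric])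
  also have "\<dots> = cis \<psi>"
    unfolding y(2) Complex.DeMoivre by (simp del: of_nat_Suc)
  also have "\<dots> = w"
    using w cis_Arg [of w] by (cases "w = 0") (auto simp: \<psi>_def sgn_div_norm)
  finally show thesis
    using that power_in_diagonal_torus [OF torus_S S_subset y(1)] unfolding \<Delta>_def by blast
qed

text \<open>With a single orbit, \<open>T0 n P\<close> is the kernel of the product of coordinates
  on the full torus, so a group between the two is determined by its image under the
  product.\<close>

lemma full_torus_or_T0_if_irreducible:
  assumes irr: "irreducible_on smul G" and T0: "T0 n P \<subseteq> S"
  shows "S = full_torus n \<or> S = T0 n P"
proof (rule disjCI)
  assume "S \<noteq> T0 n P"
  then obtain t where t: "t \<in> S" "t \<notin> T0 n P" using T0 by blast
  then have "(\<Prod>q\<in>{1..n}. t q) \<noteq> 1"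
    using irreducible_transitive [OF irr] S_full unfolding T0_iff by metis
  show "S = full_torus n"
  proof (intro equalityI S_subset subsetI)
    fix x assume x: "x \<in> full_torus n"
    have "cmod (\<Prod>q\<in>{1..n}. x q) = 1"
      using full_torus_cmod [OF x] by (simp add: prod_norm [symmetric])
    then obtain s where s: "s \<in> S" "(\<Prod>q\<in>{1..n}. s q) = (\<Prod>q\<in>{1..n}. x q)"
      using product_surjective [OF t(1) \<open>(\<Prod>q\<in>{1..n}. t q) \<noteq> 1\<close>] by blast
    have "(\<lambda>q. x q / s q) \<in> T0 n P"
      unfolding T0_iff
    proof (intro conjI ballI)
      show "(\<lambda>q. x q / s q) \<in> full_torus n"
        using x S_full [OF s(1)] by (auto simp: full_torus_def norm_divide)
      fix q assume "q \<in> {1..n}"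
      have "(\<Prod>p\<in>{1..n}. x p) \<noteq> 0"
        using full_torus_nonzero [OF x] by simp
      then show "(\<Prod>p\<in>index_orbit q. x p / s p) = 1"
        unfolding irreducible_transitive [OF irr \<open>q \<in> {1..n}\<close>] prod_dividef s(2) by simp
    qed
    then have "s * (\<lambda>q. x q / s q) \<in> S"
      using S_mult [OF s(1)] T0 by blast
    moreover have "s * (\<lambda>q. x q / s q) = x"
      using full_torus_nonzero [OF S_full [OF s(1)]] by (simp add: fun_eq_iff)
    ultimately show "x \<in> S" by simp
  qed
qed

end

section \<open>Existence of a realization\<close>

context linear_coordinates
begin

lemma coord_norm_smul: "coord_norm (smul a v) = cmod a * coord_norm v"
  by (simp add: coord_norm_def coord_smul norm_mult sum_distrib_left)

lemma coord_norm_basis_vec: "p \<in> {1..n} \<Longrightarrow> coord_norm (basis_vec p) = 1"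
proof -
  assume p: "p \<in> {1..n}"
  have "coord_norm (basis_vec p) = (\<Sum>q\<in>{1..n}. if q = p then 1 else 0)"
    unfolding coord_norm_def by (rule sum.cong) (auto simp: coord_basis_vec [OF p])
  then show ?thesis
    using p by (simp add: sum.delta)
qed

lemma coord_linear_expand:
  assumes "Vector_Spaces.linear smul smul g"
  shows "\<phi> (g v) q = (\<Sum>p\<in>{1..n}. \<phi> v p * \<phi> (g (basis_vec p)) q)"
proof -
  interpret g: Vector_Spaces.linear smul smul g by (rule assms)
  have "g v = (\<Sum>p\<in>{1..n}. smul (\<phi> v p) (g (basis_vec p)))"
    by (subst basis_expand [of v]) (simp add: g.sum g.scale)
  then show ?thesis
    by (simp add: coord_sum coord_smul)
qed

lemma monomial_coords_basis_vec:
  assumes "\<sigma> permutes {1..n}" "monomial_coords \<sigma> c g" "p \<in> {1..n}"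
  shows "g (basis_vec p) = smul (c p) (basis_vec (\<sigma> p))"
proof (rule vec_eqI)
  fix q assume "q \<in> {1..n}"
  define r where "r = inv_into UNIV \<sigma> q"
  have r: "q = \<sigma> r"
    using permutes_inverses(1) [OF assms(1)] by (simp add: r_def)
  have \<sigma>p: "\<sigma> p \<in> {1..n}"
    using permutes_in_image [OF assms(1)] assms(3) by blast
  have "\<phi> (g (basis_vec p)) (\<sigma> r) = c r * (if r = p then 1 else 0)"
    using assms(2) by (simp add: monomial_coords_def coord_basis_vec [OF assms(3)])
  moreover have "\<sigma> r = \<sigma> p \<longleftrightarrow> r = p"
    using permutes_inj [OF assms(1)] by (auto simp: inj_def)
  ultimately show "\<phi> (g (basis_vec p)) q = \<phi> (smul (c p) (basis_vec (\<sigma> p))) q"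
    by (auto simp: r coord_smul coord_basis_vec [OF \<sigma>p])
qed

text \<open>The orbit of a cyclic vector would otherwise lie in a proper hyperplane.\<close>

lemma cyclic_weights_distinct:
  assumes diag: "\<And>g. g \<in> T \<Longrightarrow> \<exists>t. \<forall>v q. \<phi> (g v) q = t q * \<phi> v q"
    and cyclic: "span (op_orbit T v) = UNIV"
    and pq: "p \<in> {1..n}" "q \<in> {1..n}"
    and same: "\<And>g. g \<in> T \<Longrightarrow> \<phi> (g (basis_vec p)) p = \<phi> (g (basis_vec q)) q"
  shows "p = q"
proof (rule ccontr)
  assume "p \<noteq> q"
  have hyperplane: "a * \<phi> w p + b * \<phi> w q = 0" if "a * \<phi> v p + b * \<phi> v q = 0" for a b w
  proof -
    have "subspace {w. a * \<phi> w p + b * \<phi> w q = 0}"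
    proof (rule subspaceI, unfold mem_Collect_eq)
      show "a * \<phi> 0 p + b * \<phi> 0 q = 0" by (simp add: coord_zero)
      show "a * \<phi> (x + y) p + b * \<phi> (x + y) q = 0"
        if "a * \<phi> x p + b * \<phi> x q = 0" "a * \<phi> y p + b * \<phi> y q = 0" for x y
      proof -
        have "a * \<phi> (x + y) p + b * \<phi> (x + y) q = (a * \<phi> x p + b * \<phi> x q) + (a * \<phi> y p + b * \<phi> y q)"
          by (simp add: coord_add algebra_simps)
        then show ?thesis using that by simp
      qed
      show "a * \<phi> (smul c x) p + b * \<phi> (smul c x) q = 0" if "a * \<phi> x p + b * \<phi> x q = 0" for c x
      proof -
        have "a * \<phi> (smul c x) p + b * \<phi> (smul c x) q = c * (a * \<phi> x p + b * \<phi> x q)"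
          by (simp add: coord_smul algebra_simps)
        then show ?thesis using that by simp
      qed
    qed
    moreover have "op_orbit T v \<subseteq> {w. a * \<phi> w p + b * \<phi> w q = 0}"
    proof
      fix w assume "w \<in> op_orbit T v"
      then obtain g where g: "g \<in> T" "w = g v" by (auto simp: op_orbit_def)
      obtain t where t: "\<And>v q. \<phi> (g v) q = t q * \<phi> v q"
        using diag [OF g(1)] by blast
      have "t p = t q"
        using same [OF g(1)] pq by (simp add: t coord_basis_vec)
      then have "a * \<phi> w p + b * \<phi> w q = t q * (a * \<phi> v p + b * \<phi> v q)"
        by (simp add: g(2) t algebra_simps)
      then show "w \<in> {w. a * \<phi> w p + b * \<phi> w q = 0}"
        using that by simp
    qed
    ultimately have "span (op_orbit T v) \<subseteq> {w. a * \<phi> w p + b * \<phi> w q = 0}"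
      by (rule span_minimal [rotated])
    then show ?thesis
      using cyclic by auto
  qed
  \<comment> \<open>Two functionals that vanish at \<open>v\<close> are used: the one with
    coefficients \<open>\<phi> v q\<close> and \<open>- \<phi> v p\<close>, evaluated at
    \<open>basis_vec p\<close>, gives \<open>\<phi> v q = 0\<close>; then coordinate
    \<open>q\<close> itself vanishes at \<open>v\<close>, hence everywhere.\<close>
  have "\<phi> v q * \<phi> (basis_vec p) p + (- \<phi> v p) * \<phi> (basis_vec p) q = 0"
    by (rule hyperplane) simp
  then have vq: "\<phi> v q = 0"
    using pq \<open>p \<noteq> q\<close> by (simp add: coord_basis_vec)
  have "0 * \<phi> (basis_vec q) p + 1 * \<phi> (basis_vec q) q = 0"
    by (rule hyperplane) (simp add: vq)
  then show False
    using pq by (simp add: coord_basis_vec)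
qed

text \<open>The relation \<open>t \<circ> g = g \<circ> t'\<close> makes the image of a weight
  vector a weight vector: at every index where it is nonzero, \<open>t\<close> has the entry that
  \<open>t'\<close> has at the original index. Distinct weights leave only one such index.\<close>

lemma normalizer_monomial:
  assumes diag: "\<And>g. g \<in> T \<Longrightarrow> \<exists>t. \<forall>v q. \<phi> (g v) q = t q * \<phi> v q"
    and distinct: "\<And>p q. p \<in> {1..n} \<Longrightarrow> q \<in> {1..n} \<Longrightarrow>
      (\<And>g. g \<in> T \<Longrightarrow> \<phi> (g (basis_vec p)) p = \<phi> (g (basis_vec q)) q) \<Longrightarrow> p = q"
    and g: "Vector_Spaces.linear smul smul g" "inj g"
    and normal: "\<And>t. t \<in> T \<Longrightarrow> \<exists>t'\<in>T. t \<circ> g = g \<circ> t'"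
  obtains \<sigma> c where "\<sigma> permutes {1..n}" "\<And>p. c p \<noteq> 0" "monomial_coords \<sigma> c g"
proof -
  interpret g: Vector_Spaces.linear smul smul g by (rule g(1))
  have ex1: "\<exists>p\<in>{1..n}. \<phi> (g (basis_vec q)) p \<noteq> 0" if q: "q \<in> {1..n}" for q
  proof (rule ccontr)
    assume "\<not> (\<exists>p\<in>{1..n}. \<phi> (g (basis_vec q)) p \<noteq> 0)"
    then have "g (basis_vec q) = g 0"
      by (intro vec_eqI) (simp add: g.zero coord_zero)
    then have "basis_vec q = 0"
      by (rule injD [OF g(2)])
    then show False
      using coord_basis_vec [OF q, of q] by (simp add: coord_zero)
  qed
  then obtain s where s: "\<And>q. q \<in> {1..n} \<Longrightarrow> s q \<in> {1..n} \<and> \<phi> (g (basis_vec q)) (s q) \<noteq> 0"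
    by metis
  have unique: "p = s q" if q: "q \<in> {1..n}" and p: "p \<in> {1..n}" "\<phi> (g (basis_vec q)) p \<noteq> 0" for p q
  proof (rule distinct)
    show "p \<in> {1..n}" "s q \<in> {1..n}" using p s [OF q] by auto
    fix t assume "t \<in> T"
    obtain t' where t': "t' \<in> T" "t \<circ> g = g \<circ> t'"
      using normal [OF \<open>t \<in> T\<close>] by blast
    obtain a where a: "\<And>v q. \<phi> (t v) q = a q * \<phi> v q" using diag [OF \<open>t \<in> T\<close>] by blast
    obtain b where b: "\<And>v q. \<phi> (t' v) q = b q * \<phi> v q" using diag [OF t'(1)] by blast
    have t'q: "t' (basis_vec q) = smul (b q) (basis_vec q)"
      by (rule vec_eqI) (simp add: b coord_smul coord_basis_vec [OF q])
    have "\<phi> (t (g (basis_vec q))) r = \<phi> (g (t' (basis_vec q))) r" for r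
      using t'(2) by (metis comp_apply)
    then have "a r * \<phi> (g (basis_vec q)) r = b q * \<phi> (g (basis_vec q)) r" for r
      by (simp add: a t'q g.scale coord_smul)
    then have "a p = b q" "a (s q) = b q"
      using p(2) s [OF q] by auto
    then show "\<phi> (t (basis_vec p)) p = \<phi> (t (basis_vec (s q))) (s q)"
      using coord_basis_vec [OF p(1)] coord_basis_vec [of "s q"] s [OF q] by (simp add: a)
  qed
  define \<sigma> where "\<sigma> q = (if q \<in> {1..n} then s q else q)" for q
  define c where "c q = (if q \<in> {1..n} then \<phi> (g (basis_vec q)) (s q) else 1)" for q
  have gb: "g (basis_vec q) = smul (c q) (basis_vec (s q))" if q: "q \<in> {1..n}" for q
  proof (rule vec_eqI)
    fix p assume p: "p \<in> {1..n}"
    have sq: "s q \<in> {1..n}" using s [OF q] by blast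
    show "\<phi> (g (basis_vec q)) p = \<phi> (smul (c q) (basis_vec (s q))) p"
    proof (cases "p = s q")
      case True
      then show ?thesis
        using q by (simp add: coord_smul coord_basis_vec [OF sq] c_def del: atLeastAtMost_iff)
    next
      case False
      then have "\<phi> (g (basis_vec q)) p = 0"
        using unique [OF q p] by blast
      then show ?thesis
        using False by (simp add: coord_smul coord_basis_vec [OF sq])
    qed
  qed
  have "inj_on s {1..n}"
  proof (rule inj_onI)
    fix p q assume pq: "p \<in> {1..n}" "q \<in> {1..n}" "s p = s q"
    \<comment> \<open>Crossing the coefficients produces equal images, so injectivity of
      \<open>g\<close> applies without division.\<close>
    have "g (smul (c q) (basis_vec p)) = g (smul (c p) (basis_vec q))"
      unfolding g.scale gb [OF pq(1)] gb [OF pq(2)] pq(3) scale_scale by (simp only: mult.commute)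
    then have "smul (c q) (basis_vec p) = smul (c p) (basis_vec q)"
      using g(2) by (simp add: inj_eq)
    then have "c q * \<phi> (basis_vec p) p = c p * \<phi> (basis_vec q) p"
      by (metis coord_smul)
    moreover have "c q \<noteq> 0"
      using s [OF pq(2)] pq(2) by (simp add: c_def del: atLeastAtMost_iff)
    ultimately show "p = q"
      unfolding coord_basis_vec [OF pq(1)] coord_basis_vec [OF pq(2)] by (cases "p = q") simp_all
  qed
  then have "bij_betw s {1..n} {1..n}"
    using s by (intro bij_betw_imageI endo_inj_surj) auto
  then have "bij_betw \<sigma> {1..n} {1..n}"
    by (rule bij_betw_cong [THEN iffD1, rotated]) (simp add: \<sigma>_def)
  then have \<sigma>: "\<sigma> permutes {1..n}"
    by (rule bij_imp_permutes) (simp add: \<sigma>_def del: atLeastAtMost_iff)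
  have "monomial_coords \<sigma> c g"
    unfolding monomial_coords_def
  proof (intro allI)
    fix v p
    show "\<phi> (g v) (\<sigma> p) = c p * \<phi> v p"
    proof (cases "p \<in> {1..n}")
      case True
      have "\<phi> (g v) (\<sigma> p) = (\<Sum>q\<in>{1..n}. \<phi> v q * \<phi> (g (basis_vec q)) (\<sigma> p))"
        by (rule coord_linear_expand [OF g(1)])
      also have "\<dots> = (\<Sum>q\<in>{1..n}. if q = p then c p * \<phi> v p else 0)"
      proof (rule sum.cong [OF refl])
        fix q assume q: "q \<in> {1..n}"
        have "s p = s q \<longleftrightarrow> q = p"
          using \<open>inj_on s {1..n}\<close> q True by (auto dest: inj_onD)
        then show "\<phi> v q * \<phi> (g (basis_vec q)) (\<sigma> p) = (if q = p then c p * \<phi> v p else 0)"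
          using True s [OF q] by (simp add: gb [OF q] coord_smul coord_basis_vec \<sigma>_def del: atLeastAtMost_iff)
      qed
      also have "\<dots> = c p * \<phi> v p"
        using True by (simp add: sum.delta)
      finally show ?thesis .
    next
      case False
      then show ?thesis
        by (simp add: coord_outside \<sigma>_def del: atLeastAtMost_iff)
    qed
  qed
  moreover have "c p \<noteq> 0" for p
    using s [of p] by (simp add: c_def del: atLeastAtMost_iff)
  ultimately show thesis
    using that \<sigma> by blast
qed

lemma rescaled_coordinates:
  assumes r: "\<And>q. r q \<noteq> 0"
  shows "linear_coordinates smul n (\<lambda>v q. r q * \<phi> v q)"
proof (intro linear_coordinates.intro linear_coordinates_axioms.intro fin_dim_complex_space_axioms)
  show "Vector_Spaces.linear smul (\<lambda>c x q. c * x q) (\<lambda>v q. r q * \<phi> v q)"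
    using linear_coord unfolding Vector_Spaces.linear_iff
    by (simp add: fun_eq_iff coord_add coord_smul algebra_simps)
  show "bij_betw (\<lambda>v q. r q * \<phi> v q) UNIV (Cn n)"
  proof (rule bij_betwI')
    show "(\<lambda>q. r q * \<phi> v q) = (\<lambda>q. r q * \<phi> w q) \<longleftrightarrow> v = w" for v w
      using r coord_inject [of v w] by (auto simp: fun_eq_iff)
    show "(\<lambda>q. r q * \<phi> v q) \<in> Cn n" for v
      using coord_outside by (simp add: Cn_def del: atLeastAtMost_iff)
    fix x assume "x \<in> Cn n"
    then have "x = (\<lambda>q. r q * \<phi> (vec_of (\<lambda>q. x q / r q)) q)"
      using r by (auto simp: Cn_def coord_vec fun_eq_iff)
    then show "\<exists>v\<in>UNIV. x = (\<lambda>q. r q * \<phi> v q)" by blast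
  qed
qed

text \<open>
  Rescaling the weight vectors by the averaged lengths of their images makes the finite group
  unitary; this replaces the choice of an invariant Hermitian form.
\<close>

lemma unitary_rescaling:
  assumes fin: "finite F" and id: "id \<in> F"
    and comp: "\<And>f g. f \<in> F \<Longrightarrow> g \<in> F \<Longrightarrow> f \<circ> g \<in> F"
    and lin: "\<And>f. f \<in> F \<Longrightarrow> Vector_Spaces.linear smul smul f" and bij: "\<And>f. f \<in> F \<Longrightarrow> bij f"
    and mono: "\<And>f. f \<in> F \<Longrightarrow> \<exists>\<sigma> c. \<sigma> permutes {1..n} \<and> (\<forall>p. c p \<noteq> 0) \<and> monomial_coords \<sigma> c f"
  obtains r where "\<forall>q. r q \<noteq> 0"
    "\<forall>f\<in>F. \<exists>\<sigma> c. \<sigma> permutes {1..n} \<and> c \<in> full_torus n \<and>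
       (\<forall>v p. r (\<sigma> p) * \<phi> (f v) (\<sigma> p) = c p * (r p * \<phi> v p))"
proof -
  define R where "R p = (if p \<in> {1..n} then \<Sum>f\<in>F. coord_norm (f (basis_vec p)) else 1)" for p
  have R_pos: "0 < R p" for p
  proof (cases "p \<in> {1..n}")
    case True
    have "coord_norm (id (basis_vec p)) \<le> (\<Sum>f\<in>F. coord_norm (f (basis_vec p)))"
      by (rule member_le_sum [OF id]) (simp_all add: coord_norm_nonneg fin)
    then show ?thesis
      using True by (simp add: R_def coord_norm_basis_vec del: atLeastAtMost_iff)
  qed (auto simp: R_def)
  have "\<exists>\<sigma> c. \<sigma> permutes {1..n} \<and> c \<in> full_torus n \<and>
       (\<forall>v p. of_real (R (\<sigma> p)) * \<phi> (g v) (\<sigma> p) = c p * (of_real (R p) * \<phi> v p))" if g: "g \<in> F" for g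
  proof -
    obtain \<sigma> c where \<sigma>: "\<sigma> permutes {1..n}" "\<And>p. c p \<noteq> 0" "monomial_coords \<sigma> c g"
      using mono [OF g] by blast
    \<comment> \<open>The sum defining \<open>R p\<close> is invariant under
      \<open>f \<mapsto> f \<circ> g\<close>, and \<open>g\<close> sends \<open>basis_vec p\<close>
      to \<open>c p\<close> times \<open>basis_vec (\<sigma> p)\<close>. Hence the rescaled
      coefficient has modulus 1.\<close>
    have R_eq: "R (\<sigma> p) * cmod (c p) = R p" if p: "p \<in> {1..n}" for p
    proof -
      have \<sigma>p: "\<sigma> p \<in> {1..n}"
        using permutes_in_image [OF \<sigma>(1)] p by blast
      have inj: "inj_on (\<lambda>f. f \<circ> g) F"
        using bij_is_surj [OF bij [OF g]] by (auto simp: inj_on_def fun_eq_iff surj_def) metis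
      have "(\<lambda>f. f \<circ> g) ` F \<subseteq> F" using comp g by blast
      then have img: "(\<lambda>f. f \<circ> g) ` F = F"
        using endo_inj_surj [OF fin _ inj] by simp
      have "R p = (\<Sum>f\<in>(\<lambda>f. f \<circ> g) ` F. coord_norm (f (basis_vec p)))"
        using p by (simp add: R_def img del: atLeastAtMost_iff)
      also have "\<dots> = (\<Sum>f\<in>F. coord_norm (f (g (basis_vec p))))"
        by (subst sum.reindex [OF inj]) simp
      also have "\<dots> = (\<Sum>f\<in>F. cmod (c p) * coord_norm (f (basis_vec (\<sigma> p))))"
        by (rule sum.cong [OF refl])
          (simp add: monomial_coords_basis_vec [OF \<sigma>(1,3) p] linear_smul [OF lin] coord_norm_smul)
      also have "\<dots> = R (\<sigma> p) * cmod (c p)"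
        using \<sigma>p by (simp add: R_def sum_distrib_left [symmetric] mult.commute del: atLeastAtMost_iff)
      finally show ?thesis by simp
    qed
    define d where "d p = (if p \<in> {1..n} then of_real (R (\<sigma> p)) * c p / of_real (R p) else 1)" for p
    have "d \<in> full_torus n"
      unfolding full_torus_def
    proof (intro CollectI conjI ballI allI impI)
      fix p assume p: "p \<in> {1..n}"
      have "cmod (d p) = R (\<sigma> p) * cmod (c p) / R p"
        using p R_pos [of p] R_pos [of "\<sigma> p"] by (simp add: d_def norm_mult norm_divide del: atLeastAtMost_iff)
      then show "cmod (d p) = 1"
        using R_eq [OF p] R_pos [of p] by simp
    next
      fix p assume "p \<notin> {1..n}"
      then show "d p = 1" by (simp add: d_def del: atLeastAtMost_iff)
    qed
    moreover have "of_real (R (\<sigma> p)) * \<phi> (g v) (\<sigma> p) = d p * (of_real (R p) * \<phi> v p)" for v p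
    proof (cases "p \<in> {1..n}")
      case True
      have "\<phi> (g v) (\<sigma> p) = c p * \<phi> v p"
        using \<sigma>(3) by (simp add: monomial_coords_def)
      then show ?thesis
        using True R_pos [of p] by (simp add: d_def del: atLeastAtMost_iff)
    next
      case False
      then show ?thesis
        using permutes_not_in [OF \<sigma>(1) False] by (simp add: coord_outside del: atLeastAtMost_iff)
    qed
    ultimately show ?thesis
      using \<sigma>(1) by blast
  qed
  moreover have "complex_of_real (R q) \<noteq> 0" for q
    using R_pos [of q] by simp
  ultimately show thesis
    using that [of "\<lambda>q. of_real (R q)"] by blast
qed

section \<open>The weights of an operator torus as a diagonal torus\<close>

definition weight :: "('v \<Rightarrow> 'v) \<Rightarrow> nat \<Rightarrow> complex" where
  "weight g q = (if q \<in> {1..n} then \<phi> (g (basis_vec q)) q else 1)"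

text \<open>Bounded powers of an element and of its inverse put the weights on the unit circle.
  Composing a parametrization of \<open>T\<close> with \<open>weight\<close> parametrizes the
  diagonal torus, continuously because evaluation at a basis vector and coordinates are
  continuous.\<close>

lemma torus_coordinates_weights:
  assumes T: "is_torus (\<circ>) T" "\<And>g. g \<in> T \<Longrightarrow> Vector_Spaces.linear smul smul g" "id \<in> T"
    and inv: "\<And>g. g \<in> T \<Longrightarrow> \<exists>g'\<in>T. g' \<circ> g = id"
    and diag: "\<And>g. g \<in> T \<Longrightarrow> \<exists>t. \<forall>v q. \<phi> (g v) q = t q * \<phi> v q"
  shows "torus_coordinates smul n \<phi> T (weight ` T)"
proof (intro torus_coordinates.intro torus_coordinates_axioms.intro linear_coordinates_axioms)
  have wt: "\<phi> (g v) q = weight g q * \<phi> v q" if g: "g \<in> T" for g v q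
  proof (cases "q \<in> {1..n}")
    case True
    obtain t where t: "\<And>v q. \<phi> (g v) q = t q * \<phi> v q" using diag [OF g] by blast
    then have "weight g q = t q"
      using True by (simp add: weight_def coord_basis_vec)
    then show ?thesis by (simp add: t)
  qed (simp add: coord_outside del: atLeastAtMost_iff)
  have wt_inj: "g = g'" if "g \<in> T" "\<And>v q. \<phi> (g' v) q = weight g q * \<phi> v q" for g g'
    by (rule ext, rule vec_eqI) (simp add: that wt)
  have wt_comp: "weight (g \<circ> g') = weight g * weight g'" if "g \<in> T" "g' \<in> T" for g g'
  proof
    fix q
    show "weight (g \<circ> g') q = (weight g * weight g') q"
    proof (cases "q \<in> {1..n}")
      case True
      have "weight (g \<circ> g') q = \<phi> (g (g' (basis_vec q))) q"
        using True by (simp add: weight_def del: atLeastAtMost_iff)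
      also have "\<dots> = weight g q * (weight g' q * \<phi> (basis_vec q) q)"
        by (simp only: wt [OF that(1)] wt [OF that(2)])
      finally show ?thesis
        by (simp add: coord_basis_vec [OF True])
    qed (simp add: weight_def del: atLeastAtMost_iff)
  qed
  have pow_T: "g ^^ i \<in> T" if "g \<in> T" for g i
  proof (induction i)
    case 0
    show ?case unfolding funpow.simps by (rule T(3))
  next
    case (Suc i)
    show ?case unfolding funpow.simps by (rule torus_mult_closed [OF T(1) that Suc])
  qed
  have le1: "cmod (weight g q) \<le> 1" if g: "g \<in> T" for g q
  proof (cases "q \<in> {1..n}")
    case True
    have "g (basis_vec q) = smul (weight g q) (basis_vec q)"
    proof (rule vec_eqI)
      fix p
      show "\<phi> (g (basis_vec q)) p = \<phi> (smul (weight g q) (basis_vec q)) p"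
        unfolding wt [OF g] coord_smul coord_basis_vec [OF True] by simp
    qed
    moreover have "basis_vec q \<noteq> 0"
      using coord_basis_vec [OF True, of q] coord_zero [of q] by auto
    ultimately show ?thesis
      using eigenvalue_cmod_le_1 [of T g "basis_vec q" "weight g q"] T(1,2) pow_T [OF g] by blast
  qed (simp add: weight_def del: atLeastAtMost_iff)
  have weight_cmod: "cmod (weight g q) = 1" if g: "g \<in> T" for g q
  proof -
    obtain g' where g': "g' \<in> T" "g' \<circ> g = id" using inv [OF g] by blast
    have "weight g' q * weight g q = weight id q"
      using wt_comp [OF g'(1) g] g'(2) by simp
    also have "weight id q = 1"
      by (simp add: weight_def coord_basis_vec)
    finally have "cmod (weight g' q) * cmod (weight g q) = 1"
      by (metis norm_mult norm_one)
    moreover have "cmod (weight g' q) * cmod (weight g q) \<le> 1 * cmod (weight g q)"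
      by (intro mult_right_mono le1 g'(1)) simp
    ultimately show ?thesis
      using le1 [OF g, of q] by simp
  qed
  show "weight ` T \<subseteq> full_torus n"
  proof (rule image_subsetI)
    fix g assume "g \<in> T"
    moreover have "weight g q = 1" if "q \<notin> {1..n}" for q
      using that by (simp add: weight_def del: atLeastAtMost_iff)
    ultimately show "weight g \<in> full_torus n"
      unfolding full_torus_def using weight_cmod by blast
  qed
  show "T = {g. \<exists>t\<in>weight ` T. \<forall>v q. \<phi> (g v) q = t q * \<phi> v q}"
    using wt wt_inj by blast
  obtain k h where h: "continuous_on (full_torus k) h" "bij_betw h (full_torus k) T"
      "\<And>s t. s \<in> full_torus k \<Longrightarrow> t \<in> full_torus k \<Longrightarrow> h (s * t) = h s \<circ> h t"
    using T(1) unfolding is_torus_def by blast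
  have h_T: "h s \<in> T" if "s \<in> full_torus k" for s
    using h(2) that by (auto simp: bij_betw_def)
  have "continuous_on (full_torus k) (\<lambda>s. weight (h s))"
  proof (rule continuous_on_coordinatewise_then_product)
    fix q
    have "continuous_on (full_torus k) (\<lambda>s. \<phi> (h s (basis_vec q)) q)"
      by (rule continuous_on_compose2 [OF continuous_on_coord [of UNIV]
            continuous_on_product_then_coordinatewise [OF h(1)]]) simp
    then show "continuous_on (full_torus k) (\<lambda>s. weight (h s) q)"
      unfolding weight_def by (cases "q \<in> {1..n}") (simp_all del: atLeastAtMost_iff)
  qed
  moreover have "bij_betw (\<lambda>s. weight (h s)) (full_torus k) (weight ` T)"
  proof -
    have "inj_on weight T"
      using wt wt_inj by (metis inj_onI)
    then have "bij_betw weight T (weight ` T)"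
      by (rule inj_on_imp_bij_betw)
    then show ?thesis
      using bij_betw_trans [OF h(2)] by (simp add: comp_def)
  qed
  moreover have "weight (h (s * t)) = weight (h s) * weight (h t)" if "s \<in> full_torus k" "t \<in> full_torus k" for s t
    using h(3) [OF that] wt_comp [OF h_T [OF that(1)] h_T [OF that(2)]] by simp
  ultimately show "is_torus (*) (weight ` T)"
    unfolding is_torus_def by (intro exI [of _ k] exI [of _ "\<lambda>s. weight (h s)"]) blast
qed

end

context torus_coordinates
begin

text \<open>The direction of a segment yields the first conclusion for every \<open>\<beta>\<close>,
  its starting point yields the second. At the start the exponent still contains
  \<open>\<omega> \<circ> \<sigma>\<inverse> - \<omega>\<close>, but that is itself a difference
  covered by the first conclusion.\<close>

lemma generic_orbit_condition:
  assumes generic: "generically (\<lambda>v. op_orbit G v \<subseteq> op_orbit (torus_complexification smul T) v)"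
    and g: "g \<in> G" "\<sigma> permutes {1..n}" "c \<in> full_torus n" "monomial_coords \<sigma> c g"
  shows "(\<And>q. q \<notin> {1..n} \<Longrightarrow> \<beta> q = 0) \<Longrightarrow> (\<lambda>q. \<beta> (inv_into UNIV \<sigma> q) - \<beta> q) \<in> torus_lieC n S"
    and "c \<circ> inv_into UNIV \<sigma> \<in> S"
proof -
  define \<pi> where "\<pi> = inv_into UNIV \<sigma>"
  have \<sigma>\<pi>: "\<sigma> (\<pi> q) = q" for q
    using permutes_inverses(1) [OF g(2)] by (simp add: \<pi>_def)
  have \<pi>: "\<pi> permutes {1..n}"
    unfolding \<pi>_def by (rule permutes_inv [OF g(2)])
  have \<pi>_off: "\<pi> q = q" if "q \<notin> {1..n}" for q
    by (rule permutes_not_in [OF \<pi> that])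
  have \<pi>_in: "\<pi> q \<in> {1..n}" if "q \<in> {1..n}" for q
    using permutes_in_image [OF \<pi>] that by blast
  obtain U where U: "open U" "closure U = UNIV"
      "\<And>v. v \<in> U \<Longrightarrow> op_orbit G v \<subseteq> op_orbit (torus_complexification smul T) v"
    using generic unfolding generically_def by blast
  have "U \<noteq> {}"
    using U(2) by auto
  obtain \<omega> where \<omega>: "\<And>\<beta>. \<exists>\<epsilon>>0. \<forall>s::real. \<bar>s\<bar> < \<epsilon> \<longrightarrow> vec_of (\<lambda>q. exp (\<omega> q + of_real s * \<beta> q)) \<in> U"
    by (rule open_contains_exp_lines [OF U(1) \<open>U \<noteq> {}\<close>]) blast
  define \<alpha> where "\<alpha> q = Ln (c (\<pi> q)) + \<omega> (\<pi> q) - \<omega> q" for q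
  have line: "\<exists>u\<in>torus_lieC n S. \<forall>q\<in>{1..n}. exp (\<alpha> q + of_real x * (\<beta> (\<pi> q) - \<beta> q)) = exp (u q)"
    if x: "vec_of (\<lambda>q. exp (\<omega> q + of_real x * \<beta> q)) \<in> U" for x :: real and \<beta>
  proof -
    define v where "v = vec_of (\<lambda>q. exp (\<omega> q + of_real x * \<beta> q))"
    have "g v \<in> op_orbit (torus_complexification smul T) v"
      using U(3) [OF x] g(1) unfolding v_def op_orbit_def by blast
    then obtain h where h: "h \<in> torus_complexification smul T" "g v = h v"
      unfolding op_orbit_def by blast
    then obtain u where u: "u \<in> torus_lieC n S" "\<And>v q. \<phi> (h v) q = exp (u q) * \<phi> v q"
      using torus_complexification_iff by blast
    have "exp (\<alpha> q + of_real x * (\<beta> (\<pi> q) - \<beta> q)) = exp (u q)" if q: "q \<in> {1..n}" for q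
    proof -
      have v: "\<phi> v r = exp (\<omega> r + of_real x * \<beta> r)" if "r \<in> {1..n}" for r
        using that by (simp add: v_def coord_vec)
      have "c (\<pi> q) * \<phi> v (\<pi> q) = \<phi> (g v) q"
        using g(4) \<sigma>\<pi> [of q] unfolding monomial_coords_def by metis
      also have "\<dots> = exp (u q) * \<phi> v q"
        by (simp add: h(2) u(2))
      finally have "c (\<pi> q) * exp (\<omega> (\<pi> q) + of_real x * \<beta> (\<pi> q)) = exp (u q) * exp (\<omega> q + of_real x * \<beta> q)"
        unfolding v [OF q] v [OF \<pi>_in [OF q]] .
      moreover have "exp (\<alpha> q + of_real x * (\<beta> (\<pi> q) - \<beta> q)) =
          c (\<pi> q) * exp (\<omega> (\<pi> q) + of_real x * \<beta> (\<pi> q)) / exp (\<omega> q + of_real x * \<beta> q)"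
      proof -
        have "\<alpha> q + of_real x * (\<beta> (\<pi> q) - \<beta> q) =
            Ln (c (\<pi> q)) + (\<omega> (\<pi> q) + of_real x * \<beta> (\<pi> q)) - (\<omega> q + of_real x * \<beta> q)"
          by (simp add: \<alpha>_def algebra_simps)
        moreover have "exp (Ln (c (\<pi> q))) = c (\<pi> q)"
          using full_torus_nonzero [OF g(3)] by simp
        ultimately show ?thesis
          by (simp only: exp_diff exp_add)
      qed
      ultimately show ?thesis by simp
    qed
    then show ?thesis using u(1) by blast
  qed
  show dir: "(\<lambda>q. \<beta> (inv_into UNIV \<sigma> q) - \<beta> q) \<in> torus_lieC n S"
    if \<beta>: "\<And>q. q \<notin> {1..n} \<Longrightarrow> \<beta> q = 0" for \<beta>
  proof -
    obtain \<epsilon> where \<epsilon>: "0 < \<epsilon>" "\<And>x::real. \<bar>x\<bar> < \<epsilon> \<Longrightarrow> vec_of (\<lambda>q. exp (\<omega> q + of_real x * \<beta> q)) \<in> U"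
      using \<omega> [of \<beta>] by blast
    \<comment> \<open>Only one operator is involved, so the index set of the counting argument is a
      singleton.\<close>
    have "\<exists>j\<in>{()}. (\<lambda>q. \<beta> (\<pi> q) - \<beta> q) \<in> torus_lieC n S"
    proof (rule exp_line_in_subspace [where \<alpha> = "\<lambda>_. \<alpha>" and \<beta> = "\<lambda>_ q. \<beta> (\<pi> q) - \<beta> q" and \<epsilon> = \<epsilon> and n = n])
      show "\<beta> (\<pi> q) - \<beta> q = 0" if "q \<notin> {1..n}" for q
        by (simp add: \<pi>_off [OF that])
      show "\<exists>j\<in>{()}. \<exists>u\<in>torus_lieC n S. \<forall>q\<in>{1..n}. exp (\<alpha> q + of_real x * (\<beta> (\<pi> q) - \<beta> q)) = exp (u q)"
        if "\<bar>x\<bar> < \<epsilon>" for x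
        using line [OF \<epsilon>(2) [OF that]] by blast
    qed (use torus_lieC_diff [OF torus_S] torus_lieC_scale torus_lieC_off \<epsilon>(1) in
        \<open>auto simp del: atLeastAtMost_iff\<close>)
    then show ?thesis by (simp add: \<pi>_def)
  qed
  have "vec_of (\<lambda>q. exp (\<omega> q + of_real 0 * 0)) \<in> U"
    using \<omega> [of "\<lambda>_. 0"] by (auto dest!: spec [of _ "0::real"])
  then obtain u where u: "u \<in> torus_lieC n S" "\<And>q. q \<in> {1..n} \<Longrightarrow> exp (\<alpha> q) = exp (u q)"
    using line [of 0 "\<lambda>_. 0"] by auto
  \<comment> \<open>The base point is cut off outside \<open>{1..n}\<close> to be an admissible
    direction; subtracting its difference leaves a logarithm of the coefficients alone.\<close>
  define \<omega>' where "\<omega>' q = (if q \<in> {1..n} then \<omega> q else 0)" for q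
  define w where "w q = u q - (\<omega>' (\<pi> q) - \<omega>' q)" for q
  have "w \<in> torus_lieC n S"
    unfolding w_def \<pi>_def
    by (intro torus_lieC_diff [OF torus_S u(1)] dir) (simp add: \<omega>'_def del: atLeastAtMost_iff)
  have exp_w: "exp (w q) = c (\<pi> q)" for q
  proof (cases "q \<in> {1..n}")
    case True
    then have "exp (w q) = exp (\<alpha> q) / exp (\<omega> (\<pi> q) - \<omega> q)"
      using \<pi>_in [OF True] by (simp add: w_def \<omega>'_def exp_diff u(2) del: atLeastAtMost_iff)
    also have "\<dots> = exp (\<alpha> q - (\<omega> (\<pi> q) - \<omega> q))"
      by (rule exp_diff [symmetric])
    also have "\<dots> = c (\<pi> q)"
      using full_torus_nonzero [OF g(3)] by (simp add: \<alpha>_def)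
    finally show ?thesis .
  next
    case False
    then show ?thesis
      using torus_lieC_off [OF \<open>w \<in> torus_lieC n S\<close> False] \<pi>_off [OF False] full_torus_off [OF g(3) False]
      by simp
  qed
  have "w \<in> torus_lie n S"
    by (rule torus_lieC_real_exp [OF \<open>w \<in> torus_lieC n S\<close>]) (unfold exp_w, rule full_torus_cmod [OF g(3)])
  then have "(\<lambda>q. exp (w q)) \<in> S"
    by (rule exp_torus_lie)
  then show "c \<circ> inv_into UNIV \<sigma> \<in> S"
    by (simp add: exp_w comp_def \<pi>_def)
qed

end

context realization
begin

text \<open>Applied to multiples of unit vectors, the assumption gives \<open>e q - e p\<close> for
  \<open>p\<close> and \<open>q\<close> in one orbit. A function with orbit sums zero is the
  combination of these in which \<open>e q - e p\<close> has the coefficient \<open>Im (u q)\<close>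
  divided by the orbit length, for all ordered pairs in an orbit.\<close>

lemma T0_subset_if_differences:
  assumes diff: "\<And>\<sigma> \<beta>. \<sigma> \<in> P \<Longrightarrow> (\<And>q. q \<notin> {1..n} \<Longrightarrow> \<beta> q = 0) \<Longrightarrow>
      (\<lambda>q. \<beta> (inv_into UNIV \<sigma> q) - \<beta> q) \<in> torus_lieC n S"
  shows "T0 n P \<subseteq> S"
proof
  \<comment> \<open>Unit vectors times \<open>\<i>\<close>, so that the differences are imaginary
    and lie in the real Lie algebra.\<close>
  define e where "e q x = (if x = q then \<i> else 0)" for q x :: nat
  have e_diff: "(\<lambda>x. e q x - e p x) \<in> torus_lie n S" if p: "p \<in> {1..n}" and q: "q \<in> index_orbit p" for p q
  proof -
    obtain \<sigma> where \<sigma>: "\<sigma> \<in> P" "q = \<sigma> p"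
      using q by (auto simp: index_orbit_def)
    have "(\<lambda>x. e p (inv_into UNIV \<sigma> x) - e p x) \<in> torus_lieC n S"
      by (rule diff [OF \<sigma>(1)]) (use p in \<open>auto simp: e_def\<close>)
    moreover have "e p (inv_into UNIV \<sigma> x) = e q x" for x
      using permutes_inv_eq [OF P_permutes [OF \<sigma>(1)], of x p] by (auto simp: e_def \<sigma>(2))
    ultimately show ?thesis
      by (intro torus_lieC_imaginary) (auto simp: e_def)
  qed
  fix t assume t: "t \<in> T0 n P"
  have "\<exists>u. u \<in> t0_block K \<and> (\<lambda>q. if q \<in> K then t q else 1) = (\<lambda>q. exp (u q))" if "K \<in> index_orbits n P" for K
    using t that unfolding T0_def T0_block_def by blast
  then obtain U where U: "\<And>K. K \<in> index_orbits n P \<Longrightarrow> U K \<in> t0_block K \<and>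
      (\<lambda>q. if q \<in> K then t q else 1) = (\<lambda>q. exp (U K q))"
    by metis
  define u where "u q = (if q \<in> {1..n} then U (index_orbit q) q else 0)" for q
  have UK: "U (index_orbit q) \<in> t0_block (index_orbit q)" and
    Uexp: "\<And>p. p \<in> index_orbit q \<Longrightarrow> exp (U (index_orbit q) p) = t p" if q: "q \<in> {1..n}" for q
  proof -
    have K: "index_orbit q \<in> index_orbits n P" using q by (simp add: index_orbits_eq)
    show "U (index_orbit q) \<in> t0_block (index_orbit q)" using U [OF K] by blast
    fix p assume "p \<in> index_orbit q"
    moreover have "(if p \<in> index_orbit q then t p else 1) = exp (U (index_orbit q) p)"
      using U [OF K] by meson
    ultimately show "exp (U (index_orbit q) p) = t p" by simp
  qed
  have u_sum: "(\<Sum>p\<in>index_orbit q. u p) = 0" if q: "q \<in> {1..n}" for q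
  proof -
    have "(\<Sum>p\<in>index_orbit q. u p) = (\<Sum>p\<in>index_orbit q. U (index_orbit q) p)"
      using index_orbit_subset [OF q] index_orbit_eq by (intro sum.cong) (auto simp: u_def)
    then show ?thesis
      using UK [OF q] by (simp add: t0_block_def)
  qed
  have u_Re: "Re (u q) = 0" for q
    using UK [of q] self_in_index_orbit [of q] by (auto simp: u_def t0_block_def)
  have u_i: "u q = of_real (Im (u q)) * \<i>" for q
    using u_Re [of q] by (simp add: complex_eq_iff)
  have t_exp: "t = (\<lambda>q. exp (u q))"
  proof
    fix q
    show "t q = exp (u q)"
    proof (cases "q \<in> {1..n}")
      case True
      then show ?thesis using Uexp [OF True self_in_index_orbit] by (simp add: u_def)
    next
      case False
      then show ?thesis using t by (auto simp: u_def T0_def)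
    qed
  qed
  \<comment> \<open>For fixed \<open>q\<close> the term \<open>e q\<close> occurs once for each
    \<open>p\<close> in the orbit; the division compensates for that.\<close>
  define m where "m q = Im (u q) / card (index_orbit q)" for q
  have "(\<lambda>x. \<Sum>q\<in>{1..n}. \<Sum>p\<in>index_orbit q. of_real (m q) * (e q x - e p x)) \<in> torus_lie n S"
  proof (intro torus_lie_sum [OF torus_S S_subset] torus_lie_scale)
    fix q p assume q: "q \<in> {1..n}" and p: "p \<in> index_orbit q"
    then show "(\<lambda>x. e q x - e p x) \<in> torus_lie n S"
      using index_orbit_subset [OF q] index_orbit_eq [OF p] self_in_index_orbit [of q]
      by (intro e_diff) auto
  qed
  moreover have "(\<Sum>q\<in>{1..n}. \<Sum>p\<in>index_orbit q. of_real (m q) * (e q x - e p x)) = u x" for x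
  proof -
    have 1: "(\<Sum>p\<in>index_orbit q. of_real (m q) * (e q x - e p x)) =
        (if q = x then u x else 0) - (if x \<in> index_orbit q then of_real (m q) * \<i> else 0)"
      if q: "q \<in> {1..n}" for q
    proof -
      have card: "card (index_orbit q) \<noteq> 0"
        using finite_index_orbit [OF q] self_in_index_orbit [of q] by auto
      have "(\<Sum>p\<in>index_orbit q. of_real (m q) * (e q x - e p x)) =
          of_nat (card (index_orbit q)) * (of_real (m q) * e q x) - (\<Sum>p\<in>index_orbit q. of_real (m q) * e p x)"
        by (simp add: right_diff_distrib sum_subtractf)
      also have "of_nat (card (index_orbit q)) * (of_real (m q) * e q x) = (if q = x then u x else 0)"
        using card u_i [of q] by (auto simp: e_def m_def)
      also have "(\<Sum>p\<in>index_orbit q. of_real (m q) * e p x) =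
          (\<Sum>p\<in>index_orbit q. if x = p then of_real (m q) * \<i> else 0)"
        by (rule sum.cong) (auto simp: e_def)
      also have "\<dots> = (if x \<in> index_orbit q then of_real (m q) * \<i> else 0)"
        by (rule sum.delta' [OF finite_index_orbit [OF q]])
      finally show ?thesis .
    qed
    have "(\<Sum>q\<in>{1..n}. \<Sum>p\<in>index_orbit q. of_real (m q) * (e q x - e p x)) =
        (\<Sum>q\<in>{1..n}. if q = x then u x else 0) - (\<Sum>q\<in>{1..n}. if x \<in> index_orbit q then of_real (m q) * \<i> else 0)"
      by (simp add: 1 sum_subtractf cong: sum.cong del: atLeastAtMost_iff)
    also have "(\<Sum>q\<in>{1..n}. if q = x then u x else 0) = u x"
      by (simp add: sum.delta u_def)
    \<comment> \<open>The subtracted terms at \<open>x\<close> collect the mean of \<open>u\<close>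
      over the orbit of \<open>x\<close>, which is zero.\<close>
    also have "(\<Sum>q\<in>{1..n}. if x \<in> index_orbit q then of_real (m q) * \<i> else 0) = 0"
    proof (cases "x \<in> {1..n}")
      case True
      have mem: "x \<in> index_orbit q \<longleftrightarrow> q \<in> index_orbit x" for q
        using index_orbit_eq self_in_index_orbit by blast
      have "(\<Sum>q\<in>{1..n}. if x \<in> index_orbit q then of_real (m q) * \<i> else 0) =
          (\<Sum>q\<in>{1..n} \<inter> index_orbit x. of_real (m q) * \<i>)"
        unfolding mem by (rule sum.inter_restrict [symmetric]) simp
      also have "{1..n} \<inter> index_orbit x = index_orbit x"
        using index_orbit_subset [OF True] by blast
      also have "(\<Sum>q\<in>index_orbit x. of_real (m q) * \<i>) = (\<Sum>q\<in>index_orbit x. u q / card (index_orbit x))"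
        by (rule sum.cong [OF refl], subst u_i) (simp add: m_def index_orbit_eq)
      also have "\<dots> = 0"
        using u_sum [OF True] by (simp add: sum_divide_distrib [symmetric])
      finally show ?thesis .
    next
      case False
      then have "x \<notin> index_orbit q" if "q \<in> {1..n}" for q
        using index_orbit_subset [OF that] by blast
      then show ?thesis
        by (intro sum.neutral) simp
    qed
    finally show ?thesis by simp
  qed
  ultimately have "u \<in> torus_lie n S" by simp
  then show "t \<in> S"
    unfolding t_exp by (rule exp_torus_lie)
qed

end

lemma realization_exists:
  fixes smul :: "complex \<Rightarrow> 'v::real_normed_vector \<Rightarrow> 'v"
  assumes V: "fin_dim_complex_space smul"
    and sd: "semidirect_operators smul G T F"
    and T: "is_torus (\<circ>) T"
    and cyclic: "module.span smul (op_orbit T v) = UNIV"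
    and generic: "generically (\<lambda>v. op_orbit G v \<subseteq> op_orbit (torus_complexification smul T) v)"
  obtains n \<phi> P S where "realization smul n \<phi> P S G" "T0 n P \<subseteq> S"
proof -
  interpret fin_dim_complex_space smul by (rule V)
  interpret sd: semidirect_operators smul G T F by (rule sd)
  have T_lin: "Vector_Spaces.linear smul smul g" if "g \<in> T" for g
    using that sd.T_subset sd.G_linear by blast
  have F_G: "f \<in> G" if "f \<in> F" for f
    using that sd.F_subset by blast
  obtain n \<phi>0 where "linear_coordinates smul n \<phi>0"
    and diag0: "\<And>g. g \<in> T \<Longrightarrow> \<exists>t. \<forall>v q. \<phi>0 (g v) q = t q * \<phi>0 v q"
    using torus_coordinates_exist [OF T T_lin sd.T_id sd.T_left_inverse] by blast
  interpret c0: linear_coordinates smul n \<phi>0 by fact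
  have mono0: "\<exists>\<sigma> c. \<sigma> permutes {1..n} \<and> (\<forall>p. c p \<noteq> 0) \<and> c0.monomial_coords \<sigma> c f" if f: "f \<in> F" for f
  proof -
    obtain \<sigma> c where "\<sigma> permutes {1..n}" "\<And>p. c p \<noteq> 0" "c0.monomial_coords \<sigma> c f"
    proof (rule c0.normalizer_monomial [of T f])
      show "Vector_Spaces.linear smul smul f" by (rule sd.G_linear [OF F_G [OF f]])
      show "inj f" by (rule bij_is_inj [OF sd.G_bij [OF F_G [OF f]]])
      show "\<exists>t'\<in>T. t \<circ> f = f \<circ> t'" if "t \<in> T" for t
        by (rule sd.T_normal [OF F_G [OF f] that])
      show "p = q" if "p \<in> {1..n}" "q \<in> {1..n}"
        "\<And>g. g \<in> T \<Longrightarrow> \<phi>0 (g (c0.basis_vec p)) p = \<phi>0 (g (c0.basis_vec q)) q" for p q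
        by (rule c0.cyclic_weights_distinct [OF diag0 cyclic that])
    qed (use diag0 in blast)+
    then show ?thesis by blast
  qed
  obtain r where r: "\<forall>q. r q \<noteq> 0"
    and mono: "\<forall>f\<in>F. \<exists>\<sigma> c. \<sigma> permutes {1..n} \<and> c \<in> full_torus n \<and>
       (\<forall>v p. r (\<sigma> p) * \<phi>0 (f v) (\<sigma> p) = c p * (r p * \<phi>0 v p))"
    by (rule c0.unitary_rescaling [OF sd.finite_F sd.F_id sd.F_comp sd.G_linear [OF F_G] sd.G_bij [OF F_G] mono0])
      blast
  define \<phi> where "\<phi> v q = r q * \<phi>0 v q" for v q
  have "linear_coordinates smul n \<phi>"
    unfolding \<phi>_def by (rule c0.rescaled_coordinates) (simp add: r)
  then interpret linear_coordinates smul n \<phi> .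
  have diag: "\<exists>t. \<forall>v q. \<phi> (g v) q = t q * \<phi> v q" if g: "g \<in> T" for g
  proof -
    obtain t where "\<And>v q. \<phi>0 (g v) q = t q * \<phi>0 v q" using diag0 [OF g] by blast
    then have "\<phi> (g v) q = t q * \<phi> v q" for v q by (simp add: \<phi>_def)
    then show ?thesis by blast
  qed
  define S where "S = weight ` T"
  have "torus_coordinates smul n \<phi> T S"
    unfolding S_def by (rule torus_coordinates_weights [OF T T_lin sd.T_id sd.T_left_inverse diag])
  then interpret torus_coordinates smul n \<phi> T S .
  have T_iff: "g \<in> T \<longleftrightarrow> (\<exists>t\<in>S. monomial_coords id t g)" for g
    by (subst T_eq) (simp add: monomial_coords_def)
  have S_full: "t \<in> full_torus n" if "t \<in> S" for t
    using S_subset that by blast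
  define P where "P = {\<sigma>. \<exists>f\<in>F. \<exists>c\<in>full_torus n. \<sigma> permutes {1..n} \<and> monomial_coords \<sigma> c f}"
  have F_mono: "\<exists>\<sigma>\<in>P. \<exists>c\<in>full_torus n. monomial_coords \<sigma> c f" if f: "f \<in> F" for f
    using mono f unfolding P_def monomial_coords_def \<phi>_def by blast
  have P_permutes: "\<sigma> permutes {1..n}" if "\<sigma> \<in> P" for \<sigma>
    using that by (simp add: P_def)
  have id_mono: "monomial_coords id 1 id"
    by (simp add: monomial_coords_def)
  have P_comp: "\<sigma> \<circ> \<tau> \<in> P" if "\<sigma> \<in> P" "\<tau> \<in> P" for \<sigma> \<tau>
  proof -
    obtain f c where f: "f \<in> F" "c \<in> full_torus n" "monomial_coords \<sigma> c f"
      using \<open>\<sigma> \<in> P\<close> by (auto simp: P_def)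
    obtain g d where g: "g \<in> F" "d \<in> full_torus n" "monomial_coords \<tau> d g"
      using \<open>\<tau> \<in> P\<close> by (auto simp: P_def)
    have "(\<lambda>p. c (\<tau> p) * d p) \<in> full_torus n"
      using full_torus_cmod [OF f(2)] full_torus_cmod [OF g(2)] full_torus_off [OF f(2)]
        full_torus_off [OF g(2)] permutes_not_in [OF P_permutes [OF that(2)]]
      unfolding full_torus_def by (simp add: norm_mult del: atLeastAtMost_iff)
    then show ?thesis
      unfolding P_def
      using sd.F_comp [OF f(1) g(1)] monomial_coords_comp [OF f(3) g(3)]
        permutes_compose [OF P_permutes [OF that(2)] P_permutes [OF that(1)]] by blast
  qed
  \<comment> \<open>The inverse is found as the permutation of an inverse operator in
    \<open>F\<close>; uniqueness of the monomial form of \<open>id\<close> identifies the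
    two.\<close>
  have P_inv: "inv_into UNIV \<sigma> \<in> P" if \<sigma>: "\<sigma> \<in> P" for \<sigma>
  proof -
    obtain f c where f: "f \<in> F" "c \<in> full_torus n" "monomial_coords \<sigma> c f"
      using \<sigma> by (auto simp: P_def)
    obtain f' where f': "f' \<in> F" "f' \<circ> f = id" using sd.F_left_inverse [OF f(1)] by blast
    obtain \<tau> d where \<tau>: "\<tau> \<in> P" "d \<in> full_torus n" "monomial_coords \<tau> d f'"
      using F_mono [OF f'(1)] by blast
    have "(\<lambda>p. d (\<sigma> p) * c p) \<in> full_torus n"
      using full_torus_cmod [OF f(2)] full_torus_cmod [OF \<tau>(2)] full_torus_off [OF f(2)]
        full_torus_off [OF \<tau>(2)] permutes_not_in [OF P_permutes [OF \<sigma>]]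
      unfolding full_torus_def by (simp add: norm_mult del: atLeastAtMost_iff)
    then have "\<tau> \<circ> \<sigma> = id"
      using monomial_coords_comp [OF \<tau>(3) f(3)] unfolding f'(2)
      by (rule monomial_coords_unique(1) [OF _ id_mono
            permutes_compose [OF P_permutes [OF \<sigma>] P_permutes [OF \<tau>(1)]] permutes_id _ one_in_full_torus, rotated])
    then have "inv_into UNIV \<sigma> = \<tau>"
      using permutes_inv_o(1) [OF P_permutes [OF \<sigma>]] by (metis comp_assoc comp_id id_comp)
    then show ?thesis using \<tau>(1) by simp
  qed
  have "id \<in> P"
    unfolding P_def using sd.F_id id_mono one_in_full_torus permutes_id by blast
  have "subgroup P (sym_group n)"
  proof (rule group.subgroupI [OF sym_group_is_group])
    show "P \<subseteq> carrier (sym_group n)"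
      using P_permutes by (auto simp: sym_group_def simp del: One_nat_def)
    show "P \<noteq> {}" using \<open>id \<in> P\<close> by blast
    show "inv\<^bsub>sym_group n\<^esub> \<sigma> \<in> P" if "\<sigma> \<in> P" for \<sigma>
      using P_inv [OF that] sym_group_inv_equality [of \<sigma> n] P_permutes [OF that]
      by (simp add: sym_group_def)
    show "\<sigma> \<otimes>\<^bsub>sym_group n\<^esub> \<tau> \<in> P" if "\<sigma> \<in> P" "\<tau> \<in> P" for \<sigma> \<tau>
      using P_comp [OF that] by (simp only: sym_group_def monoid.simps)
  qed
  \<comment> \<open>Conjugating a diagonal operator by \<open>f\<close> permutes its entries while
    the coefficients of \<open>f\<close> cancel, so normality of \<open>T\<close> turns into
    invariance of \<open>S\<close>.\<close>
  have S_perm: "t \<circ> inv_into UNIV \<sigma> \<in> S" if "\<sigma> \<in> P" "t \<in> S" for \<sigma> t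
  proof -
    obtain f c where f: "f \<in> F" "c \<in> full_torus n" "monomial_coords \<sigma> c f"
      using \<open>\<sigma> \<in> P\<close> by (auto simp: P_def)
    have \<tau>: "monomial_coords id t (monomial_op id t)"
      by (rule monomial_op [OF permutes_id])
    then have "monomial_op id t \<in> T"
      using T_iff that(2) by blast
    then obtain g where g: "g \<in> T" "f \<circ> monomial_op id t = g \<circ> f"
      using sd.T_normal' [OF F_G [OF f(1)]] by blast
    obtain s where s: "s \<in> S" "monomial_coords id s g"
      using g(1) T_iff by blast
    have "(\<lambda>p. c (id p) * t p) = (\<lambda>p. s (\<sigma> p) * c p)"
    proof (rule monomial_coords_unique(2))
      show "monomial_coords (\<sigma> \<circ> id) (\<lambda>p. c (id p) * t p) (f \<circ> monomial_op id t)"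
        by (rule monomial_coords_comp [OF f(3) \<tau>])
      show "monomial_coords (id \<circ> \<sigma>) (\<lambda>p. s (\<sigma> p) * c p) (f \<circ> monomial_op id t)"
        unfolding g(2) by (rule monomial_coords_comp [OF s(2) f(3)])
      show "\<sigma> \<circ> id permutes {1..n}" "id \<circ> \<sigma> permutes {1..n}"
        using P_permutes [OF that(1)] by (simp_all only: comp_id id_comp)
      show "(\<lambda>p. c (id p) * t p) \<in> full_torus n"
        using mult_in_full_torus [OF f(2) S_full [OF that(2)]] by (simp only: times_fun_def id_apply)
      show "(\<lambda>p. s (\<sigma> p) * c p) \<in> full_torus n"
        using full_torus_cmod [OF f(2)] full_torus_cmod [OF S_full [OF s(1)]] full_torus_off [OF f(2)]
          full_torus_off [OF S_full [OF s(1)]] permutes_not_in [OF P_permutes [OF that(1)]]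
        unfolding full_torus_def by (simp add: norm_mult del: atLeastAtMost_iff)
    qed
    then have "c p * t p = s (\<sigma> p) * c p" for p
      by (metis id_apply)
    then have ts: "t p = s (\<sigma> p)" for p
      using full_torus_nonzero [OF f(2), of p] by (metis mult.commute mult_cancel_left)
    have "t \<circ> inv_into UNIV \<sigma> = s"
      using permutes_inverses(1) [OF P_permutes [OF that(1)]] by (simp add: fun_eq_iff ts)
    then show ?thesis using s(1) by simp
  qed
  have S_comp: "t \<circ> \<sigma> \<in> S" if "\<sigma> \<in> P" "t \<in> S" for \<sigma> t
    using S_perm [OF P_inv [OF that(1)] that(2)] permutes_inv_inv [OF P_permutes [OF that(1)]] by simp
  have c_S: "c \<in> S" if "f \<in> F" "\<sigma> \<in> P" "c \<in> full_torus n" "monomial_coords \<sigma> c f" for f \<sigma> c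
  proof -
    have "c \<circ> inv_into UNIV \<sigma> \<in> S"
      by (rule generic_orbit_condition(2) [OF generic F_G [OF that(1)] P_permutes [OF that(2)] that(3,4)])
    then have "(c \<circ> inv_into UNIV \<sigma>) \<circ> \<sigma> \<in> S"
      by (rule S_comp [OF that(2)])
    then show ?thesis
      by (simp only: comp_assoc permutes_inv_o(2) [OF P_permutes [OF that(2)]] comp_id)
  qed
  have G_mono: "g \<in> G \<longleftrightarrow> (\<exists>\<sigma>\<in>P. \<exists>t\<in>S. monomial_coords \<sigma> t g)" for g
  proof
    assume "g \<in> G"
    then obtain f h where fh: "f \<in> F" "h \<in> T" "g = f \<circ> h"
      using sd.G_iff by blast
    obtain \<sigma> c where \<sigma>: "\<sigma> \<in> P" "c \<in> full_torus n" "monomial_coords \<sigma> c f"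
      using F_mono [OF fh(1)] by blast
    obtain s where s: "s \<in> S" "monomial_coords id s h"
      using fh(2) T_iff by blast
    have "monomial_coords \<sigma> (c * s) g"
      using monomial_coords_comp [OF \<sigma>(3) s(2)] unfolding fh(3) times_fun_def
      by (simp only: comp_id id_apply)
    moreover have "c * s \<in> S"
      by (rule torus_mult_closed [OF torus_S c_S [OF fh(1) \<sigma>] s(1)])
    ultimately show "\<exists>\<sigma>\<in>P. \<exists>t\<in>S. monomial_coords \<sigma> t g"
      using \<sigma>(1) by blast
  next
    assume "\<exists>\<sigma>\<in>P. \<exists>t\<in>S. monomial_coords \<sigma> t g"
    then obtain \<sigma> t where \<sigma>: "\<sigma> \<in> P" "t \<in> S" "monomial_coords \<sigma> t g" by blast
    obtain f c where f: "f \<in> F" "c \<in> full_torus n" "monomial_coords \<sigma> c f"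
      using \<sigma>(1) by (auto simp: P_def)
    \<comment> \<open>The torus element that corrects the coefficients \<open>c\<close> of
      \<open>f\<close> to the prescribed \<open>t\<close>; it lies in \<open>S\<close> because
      \<open>c\<close> does.\<close>
    define s where "s = (\<lambda>q. inverse (c q)) * t"
    have "s \<in> S"
      unfolding s_def
      by (rule torus_mult_closed [OF torus_S inverse_in_diagonal_torus [OF torus_S S_subset c_S [OF f(1) \<sigma>(1) f(2,3)]] \<sigma>(2)])
    moreover have h: "monomial_coords id s (monomial_op id s)"
      by (rule monomial_op [OF permutes_id])
    ultimately have "monomial_op id s \<in> T"
      using T_iff by blast
    then have "f \<circ> monomial_op id s \<in> G"
      using sd.G_iff f(1) by blast
    moreover have "(\<lambda>p. c (id p) * s p) = t"
      using full_torus_nonzero [OF f(2)] by (simp add: fun_eq_iff s_def)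
    then have "monomial_coords \<sigma> t (f \<circ> monomial_op id s)"
      using monomial_coords_comp [OF f(3) h] by (simp only: comp_id)
    then have "f \<circ> monomial_op id s = g"
      using monomial_coords_inject [OF P_permutes [OF \<sigma>(1)]] \<sigma>(3) by blast
    ultimately show "g \<in> G" by simp
  qed
  have "realization smul n \<phi> P S G"
  proof (intro realization.intro realization_axioms.intro permutation_group.intro linear_coordinates_axioms
      torus_S S_subset G_mono \<open>subgroup P (sym_group n)\<close>)
    show "perm_op \<sigma> ` S \<subseteq> S" if "\<sigma> \<in> P" for \<sigma>
      using S_perm [OF that] by (auto simp: perm_op_def)
  qed
  then interpret R: realization smul n \<phi> P S G .
  have "T0 n P \<subseteq> S"
  proof (rule R.T0_subset_if_differences)
    fix \<sigma> \<beta> assume \<sigma>: "\<sigma> \<in> P" and \<beta>: "\<And>q. q \<notin> {1..n} \<Longrightarrow> \<beta> q = (0::complex)"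
    obtain f c where f: "f \<in> F" "c \<in> full_torus n" "monomial_coords \<sigma> c f"
      using \<sigma> by (auto simp: P_def)
    show "(\<lambda>q. \<beta> (inv_into UNIV \<sigma> q) - \<beta> q) \<in> torus_lieC n S"
      by (rule generic_orbit_condition(1) [OF generic F_G [OF f(1)] P_permutes [OF \<sigma>] f(2,3) \<beta>])
  qed
  then show thesis
    using that \<open>realization smul n \<phi> P S G\<close> by blast
qed

theorem theorem4p5:
  fixes smul :: "complex \<Rightarrow> 'v::real_normed_vector \<Rightarrow> 'v"
    and G T F :: "('v \<Rightarrow> 'v) set"
  assumes "fin_dim_complex_space smul"
    and "semidirect_product (GL smul) G T F"
    and "is_torus (\<circ>) T"
    and "finite F"
    and "\<exists>v. module.span smul (op_orbit T v) = UNIV"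
    and "generically (\<lambda>v. op_orbit G v \<subseteq> op_orbit (torus_complexification smul T) v)"
  shows "realizable_by_E smul G \<and>
    (type_A smul G \<longleftrightarrow>
       (\<exists>v. open (op_orbit (F <#>\<^bsub>GL smul\<^esub> torus_complexification smul T) v))) \<and>
    (type_B smul G \<longleftrightarrow> finite (center_of (GL smul) G)) \<and>
    (irreducible_on smul G \<longrightarrow> type_A smul G \<or> type_B smul G)"
proof -
  have sd: "semidirect_operators smul G T F"
    using assms(2,4) by (rule semidirect_operators.intro)
  obtain v where "module.span smul (op_orbit T v) = UNIV"
    using assms(5) by blast
  then obtain n \<phi> P S where R: "realization smul n \<phi> P S G" and T0: "T0 n P \<subseteq> S"
    by (rule realization_exists [OF assms(1) sd assms(3) _ assms(6)])
  note realized = realized_by_iff [OF assms(1)]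
  have E: "realized_by smul G n P S"
    using R T0 realized by blast
  have "type_A smul G \<longleftrightarrow> (\<exists>v. open (op_orbit (F <#>\<^bsub>GL smul\<^esub> torus_complexification smul T) v))"
  proof
    assume "type_A smul G"
    \<comment> \<open>The witness may be a realization other than the constructed one. In the
      converse direction the constructed realization serves as witness.\<close>
    then obtain n' \<phi>' P' where "realization smul n' \<phi>' P' (full_torus n') G"
      unfolding type_A_def realized by blast
    then show "\<exists>v. open (op_orbit (F <#>\<^bsub>GL smul\<^esub> torus_complexification smul T) v)"
      using realization.open_orbit_if_full_torus [OF _ sd assms(3) refl] by blast
  next
    assume "\<exists>v. open (op_orbit (F <#>\<^bsub>GL smul\<^esub> torus_complexification smul T) v)"
    then have "S = full_torus n"
      using realization.full_torus_if_open_orbit [OF R sd assms(3)] by blast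
    then show "type_A smul G"
      unfolding type_A_def using E by blast
  qed
  moreover have "type_B smul G \<longleftrightarrow> finite (center_of (GL smul) G)"
  proof
    assume "type_B smul G"
    then obtain n' \<phi>' P' where "realization smul n' \<phi>' P' (T0 n' P') G"
      unfolding type_B_def realized by blast
    then show "finite (center_of (GL smul) G)"
      by (rule realization.center_finite_if_T0) (rule refl)
  next
    assume "finite (center_of (GL smul) G)"
    then have "S = T0 n P"
      by (rule realization.T0_if_center_finite [OF R T0])
    then show "type_B smul G"
      unfolding type_B_def using E by blast
  qed
  moreover have "type_A smul G \<or> type_B smul G" if "irreducible_on smul G"
    using realization.full_torus_or_T0_if_irreducible [OF R that T0] E
    unfolding type_A_def type_B_def by blast
  ultimately show ?thesis
    unfolding realizable_by_E_def using E by blast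
qed

end
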